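(* Let $U\subset\mathbb R^n$ be open, $x\in U$, and let $\mathcal R:\sigma\mapsto\sigma(z)$ be a holomorphic regularisation procedure on $CS(U)$ such that whenever $\sigma$ has order $\alpha(0)$, $\sigma(z)$ has order $qz+\alpha(0)$ with a fixed $q\ne0$. Let $\sigma_1,\dots,\sigma_k\in CS(U)$, with $\sigma_i(z)$ of order $\alpha_i(z)=qz+\alpha_i(0)$. Then: (1) the map $z\mapsto-\!\!\!\!\!\!\int_{T_x^*U}P_1\circ\cdots\circ P_{k-1}(\sigma_1(z)\otimes\cdots\otimes\sigma_k(z))(x,\xi)\,d\xi$ is meromorphic with poles of order at most $k$, contained in $$\mathcal P_k:=\bigcup_{j=1}^k(jq)^{-1}\big(\mathbb Z-\alpha_1(0)-\alpha_2(0)-\cdots-\alpha_j(0)\big);$$ (2) the map $z\mapsto\sum_{\tau\in\Sigma_k}-\!\!\!\!\!\!\int_{T_x^*U}P_1\circ\cdots\circ P_{k-1}(\sigma_{\tau(1)}(z)\otimes\cdots\otimes\sigma_{\tau(k)}(z))(x,\xi)\,d\xi$ is meromorphic with poles of order at most $k$, and one has the equality of meromorphic functions $$\prod_{i=1}^k-\!\!\!\!\!\!\int_{T_x^*U}\sigma_i(z)(x,\xi_i)\,d\xi_i=\sum_{\tau\in\Sigma_k}-\!\!\!\!\!\!\int_{T_x^*U}P_1\circ\cdots\circ P_{k-1}\big(\sigma_{\tau(1)}(z)\otimes\cdots\otimes\sigma_{\tau(k)}(z)\big)(x,\xi)\,d\xi.$$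
   Context: $CS(U)$ is the union over $\alpha\in\mathbb C$ of the classical symbol spaces $CS^\alpha(U)$: smooth $\sigma$ on $U\times\mathbb R^n$ with $\sigma=\sum_{m=0}^{N-1}\psi(\xi)\sigma_{\alpha-m}+\sigma_{(N)}$ for all $N$, $\sigma_{\alpha-m}$ positively homogeneous of degree $\alpha-m$ in $\xi$, $\sigma_{(N)}$ of order $\mathrm{Re}\,\alpha-N$. For symbols $\sigma_1,\dots,\sigma_k$, $P_1\circ\cdots\circ P_{k-1}(\sigma_1\otimes\cdots\otimes\sigma_k)(x,\xi_1)=\sigma_1(x,\xi_1)\int_{|\xi_2|\le|\xi_1|}d\xi_2\,\sigma_2(x,\xi_2)\int_{|\xi_3|\le|\xi_2|}d\xi_3\cdots\int_{|\xi_k|\le|\xi_{k-1}|}\sigma_k(x,\xi_k)d\xi_k$, a log-polyhomogeneous symbol in $\xi_1$. $\Sigma_k$ is the symmetric group. A holomorphic family $z\mapsto\sigma(z)$ has holomorphic order, homogeneous components depending holomorphically on $z$, and remainders depending holomorphically on $z$; a holomorphic regularisation procedure assigns to each $\sigma$ a holomorphic family with $\sigma(0)=\sigma$. The cut-off integral of a log-polyhomogeneous $f$ is the constant term in the large-$R$ asymptotic expansion of $\int_{|\xi|\le R}f\,d\xi$. *)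

theory Defs
  imports "HOL-Complex_Analysis.Complex_Analysis" "HOL-Combinatorics.Permutations"
begin

type_synonym 'n symb = "((real^'n) \<times> (real^'n)) \<Rightarrow> complex"

definition pd :: "'a::real_normed_vector \<Rightarrow> ('a \<Rightarrow> complex) \<Rightarrow> 'a \<Rightarrow> complex" where
  "pd e f y = vector_derivative (\<lambda>t::real. f (y + t *\<^sub>R e)) (at 0)"

fun dpd :: "'a::real_normed_vector list \<Rightarrow> ('a \<Rightarrow> complex) \<Rightarrow> 'a \<Rightarrow> complex" where
  "dpd [] f = f"
| "dpd (e # es) f = pd e (dpd es f)"

definition smooth_on :: "'a::euclidean_space set \<Rightarrow> ('a \<Rightarrow> complex) \<Rightarrow> bool" where
  "smooth_on S f \<longleftrightarrow> (\<forall>es\<in>lists Basis. \<forall>y\<in>S. continuous (at y) (dpd es f) \<and>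
      (\<forall>e\<in>Basis. (\<lambda>t::real. dpd es f (y + t *\<^sub>R e)) differentiable (at 0)))"

definition smooth_real_on :: "'a::euclidean_space set \<Rightarrow> ('a \<Rightarrow> real) \<Rightarrow> bool" where
  "smooth_real_on S f \<longleftrightarrow> smooth_on S (\<lambda>y. complex_of_real (f y))"

text \<open>Number of xi-derivatives in a list of basis directions of the product space.\<close>
definition nxi :: "('a::real_vector \<times> 'b::real_vector) list \<Rightarrow> nat" where
  "nxi es = length (filter (\<lambda>e. fst e = 0) es)"

definition jb :: "real^'n \<Rightarrow> real" where
  "jb \<xi> = sqrt (1 + (norm \<xi>)\<^sup>2)"

definition symbol_order :: "(real^'n) set \<Rightarrow> real \<Rightarrow> 'n symb \<Rightarrow> bool" where
  "symbol_order U \<beta> \<sigma> \<longleftrightarrow> (\<forall>K. compact K \<and> K \<subseteq> U \<longrightarrow> (\<forall>es\<in>lists Basis. \<exists>C. \<forall>x\<in>K. \<forall>\<xi>.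
      norm (dpd es \<sigma> (x, \<xi>)) \<le> C * jb \<xi> powr (\<beta> - real (nxi es))))"

definition cutoff_fn :: "(real^'n \<Rightarrow> real) \<Rightarrow> bool" where
  "cutoff_fn \<psi> \<longleftrightarrow> smooth_real_on UNIV \<psi> \<and> (\<forall>\<xi>. norm \<xi> \<le> 1/2 \<longrightarrow> \<psi> \<xi> = 0)
      \<and> (\<forall>\<xi>. norm \<xi> \<ge> 1 \<longrightarrow> \<psi> \<xi> = 1)"

definition pos_homog :: "(real^'n) set \<Rightarrow> complex \<Rightarrow> 'n symb \<Rightarrow> bool" where
  "pos_homog U d s \<longleftrightarrow> (\<forall>x\<in>U. \<forall>\<xi>. \<forall>t::real. \<xi> \<noteq> 0 \<and> t > 0 \<longrightarrow>
      s (x, t *\<^sub>R \<xi>) = complex_of_real t powr d * s (x, \<xi>))"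

definition classical :: "(real^'n) set \<Rightarrow> complex \<Rightarrow> 'n symb \<Rightarrow> bool" where
  "classical U \<alpha> \<sigma> \<longleftrightarrow> smooth_on (U \<times> UNIV) \<sigma> \<and>
    (\<exists>\<psi> c. cutoff_fn \<psi> \<and>
      (\<forall>j. smooth_on (U \<times> (UNIV - {0})) (c j) \<and> pos_homog U (\<alpha> - of_nat j) (c j)) \<and>
      (\<forall>N. symbol_order U (Re \<alpha> - real N)
          (\<lambda>(x, \<xi>). \<sigma> (x, \<xi>) - (\<Sum>j<N. complex_of_real (\<psi> \<xi>) * c j (x, \<xi>)))))"

definition CS :: "(real^'n) set \<Rightarrow> 'n symb set" where
  "CS U = {\<sigma>. \<exists>\<alpha>. classical U \<alpha> \<sigma>}"

definition holo_family :: "(real^'n) set \<Rightarrow> (complex \<Rightarrow> complex) \<Rightarrow> (complex \<Rightarrow> 'n symb) \<Rightarrow> bool" where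
  "holo_family U \<alpha> \<sigma> \<longleftrightarrow> \<alpha> holomorphic_on UNIV \<and> (\<forall>z. smooth_on (U \<times> UNIV) (\<sigma> z)) \<and>
    (\<exists>\<psi> c. cutoff_fn \<psi> \<and>
      (\<forall>z j. smooth_on (U \<times> (UNIV - {0})) (c z j) \<and> pos_homog U (\<alpha> z - of_nat j) (c z j)) \<and>
      (\<forall>j. \<forall>x\<in>U. \<forall>\<xi>. \<xi> \<noteq> 0 \<longrightarrow> (\<lambda>z. c z j (x, \<xi>)) holomorphic_on UNIV) \<and>
      (\<forall>N. let r = (\<lambda>z (x, \<xi>). \<sigma> z (x, \<xi>) - (\<Sum>j<N. complex_of_real (\<psi> \<xi>) * c z j (x, \<xi>))) in
         (\<forall>x\<in>U. \<forall>\<xi>. (\<lambda>z. r z (x, \<xi>)) holomorphic_on UNIV) \<and>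
         (\<forall>K Z. compact K \<and> K \<subseteq> U \<and> compact Z \<longrightarrow> (\<forall>es\<in>lists Basis. \<exists>C. \<forall>z\<in>Z. \<forall>x\<in>K. \<forall>\<xi>.
            norm (dpd es (r z) (x, \<xi>)) \<le> C * jb \<xi> powr (Re (\<alpha> z) - real N - real (nxi es))))))"

definition holo_reg :: "(real^'n) set \<Rightarrow> ('n symb \<Rightarrow> complex \<Rightarrow> 'n symb) \<Rightarrow> bool" where
  "holo_reg U R \<longleftrightarrow> (\<forall>\<sigma>\<in>CS U. R \<sigma> 0 = \<sigma> \<and> (\<exists>\<alpha>. holo_family U \<alpha> (R \<sigma>)))"

fun pcomp :: "'n symb list \<Rightarrow> real^'n \<Rightarrow> real^'n \<Rightarrow> complex" where
  "pcomp [] x \<xi> = 1"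
| "pcomp [s] x \<xi> = s (x, \<xi>)"
| "pcomp (s # t # ss) x \<xi> = s (x, \<xi>) * integral (cball 0 (norm \<xi>)) (\<lambda>\<eta>. pcomp (t # ss) x \<eta>)"

text \<open>Cut-off integral: the constant term of the large-R asymptotic expansion of the integral
  over the ball of radius R.\<close>
definition cutoff_int :: "(real^'n \<Rightarrow> complex) \<Rightarrow> complex" where
  "cutoff_int f = (THE c. \<exists>A coef. finite A \<and> (0, 0) \<notin> A \<and>
     ((\<lambda>R::real. integral (cball 0 R) f
        - (\<Sum>(a, l)\<in>A. coef (a, l) * complex_of_real R powr a * (complex_of_real (ln R)) ^ l) - c)
      \<longlongrightarrow> 0) at_top)"

definition mero_poles_le :: "(complex \<Rightarrow> complex) \<Rightarrow> nat \<Rightarrow> bool" where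
  "mero_poles_le f k \<longleftrightarrow> f meromorphic_on UNIV \<and>
     (\<forall>p. \<exists>r>0. \<exists>g. g holomorphic_on ball p r \<and> (\<forall>z\<in>ball p r - {p}. f z = g z / (z - p) ^ k))"

definition pole_set :: "complex \<Rightarrow> (nat \<Rightarrow> complex) \<Rightarrow> nat \<Rightarrow> complex set" where
  "pole_set q a k = (\<Union>j\<in>{1..k}. {(of_int m - (\<Sum>i=1..j. a i)) / (of_nat j * q) | m. True})"

end

theory Submission
  imports Defs "HOL-Combinatorics.Multiset_Permutations"
    "HOL-Computational_Algebra.Fundamental_Theorem_Algebra"
begin

text \<open>
  In polar coordinates the nested integral becomes an iterated integral of functions
  \<open>s\<^sub>1, \<dots>, s\<^sub>k\<close> on the half line, where \<open>s\<^sub>i\<close> has an expansion in the powers \<open>r powr (b\<^sub>i - 1 - m)\<close>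
  with \<open>b\<^sub>i = \<alpha>\<^sub>i + n\<close>. Let \<open>G\<^sub>1 r\<close> be the finite part of the integral of \<open>s\<^sub>1\<close> over \<open>{r..}\<close> and, inductively,
  \<open>G\<^sub>j r\<close> the finite part of the integral of \<open>s\<^sub>j * G\<^bsub>j-1\<^esub>\<close> over \<open>{r..}\<close>. The expansion of \<open>G\<^sub>j\<close> contains only the
  powers \<open>b\<^sub>1 + \<dots> + b\<^sub>j - m\<close>, and each step divides the coefficients by these exponents, so \<open>G\<^sub>j\<close> is
  meromorphic with poles of order at most \<open>j\<close> located where some \<open>b\<^sub>1 + \<dots> + b\<^sub>i\<close>, \<open>i \<le> j\<close>, is an integer.
  Integrating by parts from the outside inwards, the iterated integral up to \<open>R\<close> equals \<open>G\<^sub>k 0\<close> minus the products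
  of \<open>G\<^sub>j R\<close> with the iterated integrals of \<open>s\<^bsub>j+1\<^esub>, \<dots>, s\<^sub>k\<close>. Away from the pole set these products have
  no constant term, even at points where the inner integrals have logarithms; so the cut-off integral is \<open>G\<^sub>k 0\<close>.

  For the product formula, the product of the integrals of the \<open>s\<^sub>i\<close> up to \<open>R\<close> is the sum over all orderings of
  the iterated integrals, and outside a discrete set of \<open>z\<close> no nonempty sum of the \<open>b\<^sub>i\<close> is an integer, so that
  taking the constant term commutes with the product.
\<close>

section \<open>Integration in polar coordinates\<close>

text \<open>Two calculi are kept apart. \<open>phg\<close> describes families that are holomorphic
  in z, with pure powers of r and bounds locally uniform in z; the outer factors stay in it, since
  it is closed under products and regularised tail integration. \<open>log_expansion\<close>
  describes one function of R at a fixed z, logarithms allowed, and records only a set that contains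
  the exponents. The obstacle is that the inner iterated integrals do not fit the first calculus:
  they can develop logarithms outside the pole set, for instance where b_2 = 0. They occur only as
  factors of boundary terms, for which the second calculus suffices, and uniqueness of the constant
  term links the two. Division by b_1 + ... + b_l - m is replaced by multiplication with a common
  factor w: w = 1 where no partial sum is an integer, w = z - p near an arbitrary point p. Each of
  the k integrations costs one factor w, hence order at most k. The dimension n contained in each
  b_i shifts the partial sums by integers and so disappears into the integers of the pole
  set.\<close>

lemma holomorphic_on_integral_param:
  fixes f :: "complex \<Rightarrow> 'a::euclidean_space \<Rightarrow> complex"
  assumes \<Omega>: "open \<Omega>"
    and hol: "\<And>t. t \<in> S \<Longrightarrow> (\<lambda>z. f z t) holomorphic_on \<Omega>"
    and int: "\<And>z. z \<in> \<Omega> \<Longrightarrow> f z integrable_on S"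
    and one: "\<And>C::real. (\<lambda>t. C) integrable_on S"
    and bd: "\<And>Z. compact Z \<Longrightarrow> Z \<subseteq> \<Omega> \<Longrightarrow> \<exists>M. \<forall>z\<in>Z. \<forall>t\<in>S. norm (f z t) \<le> M"
  shows "(\<lambda>z. integral S (f z)) holomorphic_on \<Omega>"
proof -
  have "\<exists>D. ((\<lambda>z. integral S (f z)) has_field_derivative D) (at z0)" if z0: "z0 \<in> \<Omega>" for z0
  proof -
    from \<Omega> z0 obtain e where e: "e > 0" "cball z0 e \<subseteq> \<Omega>"
      using open_contains_cball by blast
    \<comment> \<open>With half the radius, the disc of radius d about any point of
      \<open>cball z0 d\<close> stays inside \<open>cball z0 e\<close>, where f is bounded by M.
      Cauchy's estimate bounds the derivative on \<open>cball z0 d\<close> by M / d, hence also the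
      difference quotients at z0, and this constant is the dominating function.\<close>
    define d where "d = e / 2"
    have d: "d > 0" using e by (simp add: d_def)
    obtain M where M: "\<And>z t. z \<in> cball z0 e \<Longrightarrow> t \<in> S \<Longrightarrow> norm (f z t) \<le> M"
      using bd[of "cball z0 e"] e by (meson compact_cball)
    define D where "D = integral S (\<lambda>t. deriv (\<lambda>z. f z t) z0)"
    have der: "((\<lambda>z. f z t) has_field_derivative deriv (\<lambda>z. f z t) w) (at w)"
      if "t \<in> S" "w \<in> \<Omega>" for t w
      using hol[OF that(1)] \<Omega> that(2) by (rule holomorphic_derivI)
    have dbound: "norm (deriv (\<lambda>z. f z t) w) \<le> M / d" if t: "t \<in> S" and w: "w \<in> cball z0 d" for t w
    proof -
      have sub: "cball w d \<subseteq> cball z0 e"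
      proof
        fix y assume "y \<in> cball w d"
        with w have "dist w y \<le> d" "dist z0 w \<le> d" by auto
        with dist_triangle[of z0 y w] show "y \<in> cball z0 e" by (simp add: d_def)
      qed
      have h: "(\<lambda>z. f z t) holomorphic_on cball w d"
        using hol[OF t] sub e(2) by (meson holomorphic_on_subset order_trans)
      have "norm ((deriv ^^ 1) (\<lambda>z. f z t) w) \<le> (fact 1) * M / d ^ 1"
      proof (rule Cauchy_inequality)
        show "(\<lambda>z. f z t) holomorphic_on ball w d" using h ball_subset_cball holomorphic_on_subset by blast
        show "continuous_on (cball w d) (\<lambda>z. f z t)" using h holomorphic_on_imp_continuous_on by blast
        show "norm (f y t) \<le> M" if "norm (w - y) = d" for y
          by (rule M[OF _ t]) (use sub that in \<open>auto simp: dist_norm\<close>)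
      qed (rule d)
      then show ?thesis by simp
    qed
    have lip: "norm (f w t - f z0 t) \<le> M / d * norm (w - z0)" if t: "t \<in> S" and w: "w \<in> cball z0 d" for t w
    proof (rule field_differentiable_bound[where S = "cball z0 d" and f' = "deriv (\<lambda>z. f z t)"])
      show "((\<lambda>z. f z t) has_field_derivative deriv (\<lambda>z. f z t) y) (at y within cball z0 d)"
        if "y \<in> cball z0 d" for y
        by (rule has_field_derivative_at_within[OF der[OF t]]) (use that e in \<open>auto simp: d_def\<close>)
    qed (use dbound t w d in auto)
    have "((\<lambda>w. (integral S (f w) - integral S (f z0)) / (w - z0)) \<longlongrightarrow> D) (at z0)"
      unfolding tendsto_at_iff_sequentially
    proof (intro allI impI)
      fix X :: "nat \<Rightarrow> complex"
      assume X: "\<forall>i. X i \<in> UNIV - {z0}" and lim: "X \<longlonglongrightarrow> z0"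
      have "eventually (\<lambda>i. X i \<in> ball z0 d) sequentially"
        by (rule topological_tendstoD[OF lim]) (use d in auto)
      then obtain n0 where n0: "\<And>i. i \<ge> n0 \<Longrightarrow> X i \<in> ball z0 d" by (auto simp: eventually_sequentially)
      define Y where "Y i = X (i + n0)" for i
      have Y: "Y i \<in> cball z0 d" "Y i \<noteq> z0" "Y i \<in> \<Omega>" for i
        using n0[of "i + n0"] X e d by (auto simp: Y_def d_def)
      have limY: "Y \<longlonglongrightarrow> z0" unfolding Y_def using lim by (rule LIMSEQ_ignore_initial_segment)
      have "(\<lambda>i. integral S (\<lambda>t. (f (Y i) t - f z0 t) / (Y i - z0))) \<longlonglongrightarrow> D"
        unfolding D_def
      proof (rule dominated_convergence(2)[where h = "\<lambda>_. M / d"])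
        show "(\<lambda>t. (f (Y k) t - f z0 t) / (Y k - z0)) integrable_on S" for k
          unfolding divide_inverse
          by (intro integrable_on_mult_left integrable_diff int Y z0)
        show "(\<lambda>_. M / d) integrable_on S" by (rule one)
        show "norm ((f (Y k) t - f z0 t) / (Y k - z0)) \<le> M / d" if "t \<in> S" for k t
          using lip[OF that Y(1)[of k]] Y(2)[of k] by (simp add: norm_divide divide_le_eq)
        show "(\<lambda>k. (f (Y k) t - f z0 t) / (Y k - z0)) \<longlonglongrightarrow> deriv (\<lambda>z. f z t) z0" if "t \<in> S" for t
        proof -
          have "((\<lambda>w. (f w t - f z0 t) / (w - z0)) \<longlongrightarrow> deriv (\<lambda>z. f z t) z0) (at z0)"
            using der[OF that z0] by (simp add: has_field_derivative_iff)
          then show ?thesis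
            using Y(2) limY by (auto simp: tendsto_at_iff_sequentially o_def)
        qed
      qed
      moreover have "integral S (\<lambda>t. (f (Y i) t - f z0 t) / (Y i - z0))
          = (integral S (f (Y i)) - integral S (f z0)) / (Y i - z0)" for i
        using int[OF Y(3)] int[OF z0] by (simp add: integral_diff)
      ultimately have "(\<lambda>i. (integral S (f (Y i)) - integral S (f z0)) / (Y i - z0)) \<longlonglongrightarrow> D"
        by (simp only:)
      then show "((\<lambda>w. (integral S (f w) - integral S (f z0)) / (w - z0)) \<circ> X) \<longlonglongrightarrow> D"
        unfolding Y_def o_def by (rule LIMSEQ_offset)
    qed
    then show ?thesis by (auto simp: has_field_derivative_iff)
  qed
  then show ?thesis
    using \<Omega> by (auto simp: holomorphic_on_open)
qed

text \<open>The density of the ball integral of f in the radius: r^(n-1) times the integral of f(r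
  w) over the unit sphere. A surface integral of g is written as n times the integral over the unit
  ball of the degree-zero extension g(w/|w|), so that Lebesgue measure suffices. The origin is
  removed because \<open>sgn 0 = 0\<close> is not a direction.\<close>

definition radial :: "('a::euclidean_space \<Rightarrow> complex) \<Rightarrow> real \<Rightarrow> complex" where
  "radial f r = of_nat DIM('a) * of_real r ^ (DIM('a) - 1) *
     integral (cball 0 1 - {0}) (\<lambda>w::'a. f (r *\<^sub>R sgn w))"

lemma const_integrable_unit_ball: "(\<lambda>t. C::real) integrable_on (cball 0 1 - {0::'a::euclidean_space})"
proof -
  have "cball 0 1 - {0::'a} \<in> lmeasurable"
    by (intro fmeasurable_Diff) auto
  then show ?thesis
    by (simp add: integrable_on_const)
qed

lemma integrable_unit_ball:
  fixes f :: "'a::euclidean_space \<Rightarrow> complex"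
  assumes "continuous_on (cball 0 1 - {0}) f" and "\<And>w. w \<in> cball 0 1 - {0} \<Longrightarrow> norm (f w) \<le> M"
  shows "f integrable_on (cball 0 1 - {0})"
proof (rule measurable_bounded_by_integrable_imp_integrable[where g = "\<lambda>_. M"])
  show "f \<in> borel_measurable (lebesgue_on (cball 0 1 - {0}))"
    by (rule continuous_imp_measurable_on_sets_lebesgue[OF assms(1)]) auto
qed (use assms const_integrable_unit_ball in auto)

lemma integrable_sphere_fun:
  fixes f :: "'a::euclidean_space \<Rightarrow> complex"
  assumes "continuous_on (sphere 0 1) f"
  shows "(\<lambda>w. f (sgn w)) integrable_on (cball 0 1 - {0})"
proof -
  have "compact (f ` sphere 0 1)" using assms by (intro compact_continuous_image) auto
  then obtain M where M: "\<And>w. w \<in> sphere 0 1 \<Longrightarrow> norm (f w) \<le> M"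
    by (meson bounded_iff compact_imp_bounded imageI)
  show ?thesis
  proof (rule integrable_unit_ball)
    show "continuous_on (cball 0 1 - {0}) (\<lambda>w. f (sgn w))"
    proof (rule continuous_on_compose2[OF assms])
      show "continuous_on (cball 0 1 - {0}) (sgn :: 'a \<Rightarrow> 'a)"
        unfolding sgn_div_norm by (auto intro!: continuous_intros)
    qed (auto simp: norm_sgn split: if_splits)
    show "norm (f (sgn w)) \<le> M" if "w \<in> cball 0 1 - {0}" for w
      by (rule M) (use that in \<open>auto simp: norm_sgn\<close>)
  qed
qed

lemma integrable_sphere_scaled:
  fixes f :: "'a::euclidean_space \<Rightarrow> complex"
  assumes "continuous_on UNIV f"
  shows "(\<lambda>w. f (r *\<^sub>R sgn w)) integrable_on (cball 0 1 - {0})"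
proof -
  have "continuous_on (sphere 0 1) (\<lambda>w. f (r *\<^sub>R w))"
    by (rule continuous_on_compose2[OF assms]) (auto intro!: continuous_intros)
  from integrable_sphere_fun[OF this] show ?thesis .
qed

text \<open>A function of the direction alone is unchanged under w -> w / R, so only the volume
  factor R^n appears. The change of variables is applied on a cube that contains the ball, with the
  function extended by zero.\<close>

lemma has_integral_degree_zero_ball:
  fixes f :: "'a::euclidean_space \<Rightarrow> complex"
  assumes int: "(\<lambda>w. f (sgn w)) integrable_on (cball 0 1 - {0})" and "R \<ge> 0"
  shows "((\<lambda>w. f (sgn w)) has_integral
      of_real (R ^ DIM('a)) * integral (cball 0 1 - {0}) (\<lambda>w. f (sgn w))) (cball 0 R)"
proof (cases "R = 0")
  case True
  then show ?thesis using has_integral_refl(2)[of "\<lambda>w. f (sgn w)" 0] by (simp add: zero_power)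
next
  case False
  then have R: "R > 0" using assms by simp
  let ?I = "integral (cball 0 1 - {0}) (\<lambda>w. f (sgn w))"
  let ?g = "\<lambda>w. if w \<in> cball 0 1 - {0} then f (sgn w) else 0"
  let ?T = "\<Sum>i\<in>Basis. i :: 'a"
  have sub: "cball 0 1 - {0} \<subseteq> cbox (- ?T) ?T"
  proof
    fix w :: 'a assume "w \<in> cball 0 1 - {0}"
    then have "\<bar>w \<bullet> i\<bar> \<le> 1" if "i \<in> Basis" for i
      using Basis_le_norm[OF that, of w] by auto
    then show "w \<in> cbox (- ?T) ?T" by (auto simp: mem_box inner_sum_left_Basis abs_le_iff minus_le_iff)
  qed
  have "(?g has_integral ?I) (cbox (- ?T) ?T)"
    using has_integral_restrict[OF sub, of "\<lambda>w. f (sgn w)" ?I] int by (simp add: has_integral_integral)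
  from has_integral_affinity'[OF this, of "1 / R" 0] R
  have "((\<lambda>w. ?g ((1 / R) *\<^sub>R w)) has_integral (R ^ DIM('a)) *\<^sub>R ?I) (cbox (- (R *\<^sub>R ?T)) (R *\<^sub>R ?T))"
    by (simp add: power_divide cong: if_cong)
  moreover have "?g ((1 / R) *\<^sub>R w) = (if w \<in> cball 0 R - {0} then f (sgn w) else 0)" for w
    using R by (auto simp: sgn_scaleR field_simps)
  ultimately have *: "((\<lambda>w. if w \<in> cball 0 R - {0} then f (sgn w) else 0) has_integral (R ^ DIM('a)) *\<^sub>R ?I)
      (cbox (- (R *\<^sub>R ?T)) (R *\<^sub>R ?T))" by simp
  have sub: "cball 0 R - {0} \<subseteq> cbox (- (R *\<^sub>R ?T)) (R *\<^sub>R ?T)"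
  proof
    fix w :: 'a assume "w \<in> cball 0 R - {0}"
    then have "\<bar>w \<bullet> i\<bar> \<le> R" if "i \<in> Basis" for i
      using Basis_le_norm[OF that, of w] by auto
    then show "w \<in> cbox (- (R *\<^sub>R ?T)) (R *\<^sub>R ?T)"
      by (auto simp: mem_box inner_sum_left_Basis abs_le_iff minus_le_iff)
  qed
  from * have "((\<lambda>w. f (sgn w)) has_integral (R ^ DIM('a)) *\<^sub>R ?I) (cball 0 R - {0})"
    by (rule has_integral_restrict[OF sub, THEN iffD1])
  then have "((\<lambda>w. f (sgn w)) has_integral (R ^ DIM('a)) *\<^sub>R ?I) (cball 0 R)"
    by (rule has_integral_spike_set_eq[THEN iffD1, rotated 2]) (rule negligible_subset[of "{0}"], auto)+
  then show ?thesis by (simp add: scaleR_conv_of_real)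
qed

lemma continuous_integrable_cball:
  fixes f :: "'a::euclidean_space \<Rightarrow> complex"
  assumes "continuous_on UNIV f"
  shows "f integrable_on (cball 0 R)"
proof -
  have "set_integrable lborel (cball 0 R) f"
    unfolding set_integrable_def
    by (rule borel_integrable_compact) (use assms continuous_on_subset in auto)
  then show ?thesis by (rule set_borel_integral_eq_integral)
qed

text \<open>Both balls are compared through the degree-zero function \<open>f (a *\<^sub>R sgn w)\<close>, whose integral over
  a ball is known from scaling alone.\<close>
lemma integral_cball_has_vector_derivative:
  fixes f :: "'a::euclidean_space \<Rightarrow> complex"
  assumes cont: "continuous_on UNIV f" and a: "a \<ge> 0"
  shows "((\<lambda>R. integral (cball 0 R) f) has_vector_derivative radial f a) (at a within {0..})"
proof -
  let ?n = "DIM('a)"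
  define m where "m = integral (cball 0 1 - {0}) (\<lambda>w. f (a *\<^sub>R sgn w))"
  have hm: "((\<lambda>w. f (a *\<^sub>R sgn w)) has_integral of_real (R ^ ?n) * m) (cball 0 R)" if "R \<ge> 0" for R
    unfolding m_def by (rule has_integral_degree_zero_ball) (use that integrable_sphere_scaled[OF cont] in auto)
  \<comment> \<open>This is the integral over the ball of f w minus the value of f at the radial
    projection of w to the sphere of radius a. That difference is small on thin shells around the
    sphere, so \<open>?\<Psi>\<close> has derivative 0 at a, and the derivative of R^n m at a is
    \<open>radial f a\<close>.\<close>
  let ?\<Psi> = "\<lambda>R. integral (cball 0 R) f - of_real (R ^ ?n) * m"
  have \<Psi>: "?\<Psi> R = integral (cball 0 R) (\<lambda>w. f w - f (a *\<^sub>R sgn w))"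
    and \<Psi>i: "(\<lambda>w. f w - f (a *\<^sub>R sgn w)) integrable_on cball 0 R" if "R \<ge> 0" for R
    using hm[OF that] continuous_integrable_cball[OF cont, of R]
    by (auto simp: integral_diff integrable_diff has_integral_iff)
  have \<Psi>': "(?\<Psi> has_vector_derivative 0) (at a within {0..})"
    unfolding has_vector_derivative_def has_derivative_within_alt
  proof (intro conjI allI impI)
    show "bounded_linear (\<lambda>x::real. x *\<^sub>R (0::complex))" by simp
    fix e :: real assume e: "e > 0"
    \<comment> \<open>L - 1 bounds the volume of a shell with radii lo \<le> a \<le> hi \<le> a + 1
      divided by its thickness; the summand 1 makes e / L a positive tolerance.\<close>
    define L where "L = real ?n * (a + 1) ^ (?n - 1) * unit_ball_vol ?n + 1"
    have L: "L > 0" unfolding L_def using a by (intro add_nonneg_pos mult_nonneg_nonneg) auto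
    have "uniformly_continuous_on (cball 0 (a + 1)) f"
      by (rule compact_uniformly_continuous) (use cont continuous_on_subset in auto)
    then obtain \<delta> where \<delta>: "\<delta> > 0"
      "\<And>x y. x \<in> cball 0 (a+1) \<Longrightarrow> y \<in> cball 0 (a+1) \<Longrightarrow> dist y x < \<delta> \<Longrightarrow> dist (f y) (f x) < e / L"
      unfolding uniformly_continuous_on_def using e L by (metis divide_pos_pos)
    define d where "d = min \<delta> 1"
    have d: "d > 0" "d \<le> 1" "d \<le> \<delta>" using \<delta> by (auto simp: d_def)
    have key: "norm (?\<Psi> hi - ?\<Psi> lo) \<le> e * (hi - lo)"
      if h: "0 \<le> lo" "lo \<le> hi" "lo \<le> a" "a \<le> hi" "hi - lo < d" for lo hi
    proof -
      let ?A = "cball 0 hi - cball (0::'a) lo"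
      have sub: "negligible (cball (0::'a) lo - cball 0 hi)"
        by (rule negligible_subset[of "{}"]) (use h in auto)
      have int: "(\<lambda>w. f w - f (a *\<^sub>R sgn w)) integrable_on ?A"
        by (rule integrable_setdiff[OF integrable_integral integrable_integral sub]; rule \<Psi>i) (use h in auto)
      have eq: "?\<Psi> hi - ?\<Psi> lo = integral ?A (\<lambda>w. f w - f (a *\<^sub>R sgn w))"
        using \<Psi>[of hi] \<Psi>[of lo] \<Psi>i[of hi] \<Psi>i[of lo] h sub by (simp add: integral_setdiff)
      have lm: "?A \<in> lmeasurable" by (intro fmeasurable_Diff) auto
      have mA: "measure lebesgue ?A = (hi ^ ?n - lo ^ ?n) * unit_ball_vol ?n"
        using h by (subst measurable_measure_Diff) (auto simp: content_cball algebra_simps)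
      have "norm (integral ?A (\<lambda>w. f w - f (a *\<^sub>R sgn w))) \<le> integral ?A (\<lambda>_. e / L)"
      proof (rule integral_norm_bound_integral[OF int])
        show "(\<lambda>_. e / L) integrable_on ?A" using lm by (simp add: integrable_on_const)
        show "norm (f w - f (a *\<^sub>R sgn w)) \<le> e / L" if w: "w \<in> ?A" for w
        proof -
          have w': "lo < norm w" "norm w \<le> hi" "w \<noteq> 0" using w h by auto
          have "w = norm w *\<^sub>R sgn w" using w' by (simp add: sgn_div_norm)
          then have "dist w (a *\<^sub>R sgn w) = \<bar>norm w - a\<bar>"
            using w'(3) by (metis dist_norm mult.right_neutral norm_scaleR norm_sgn scaleR_diff_left)
          also have "\<dots> < \<delta>" using w' h d by auto
          finally have "dist (f w) (f (a *\<^sub>R sgn w)) < e / L"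
            by (intro \<delta>(2)) (use w' h d a in \<open>auto simp: norm_sgn\<close>)
          then show ?thesis by (simp add: dist_norm)
        qed
      qed
      also have "\<dots> = e / L * ((hi ^ ?n - lo ^ ?n) * unit_ball_vol ?n)"
        using integral_mult_right[of ?A "e / L" "\<lambda>_. 1::real"] lmeasure_integral[OF lm] mA
        by (simp only: mult_1_right)
      also have "\<dots> \<le> e / L * (L * (hi - lo))"
      proof (intro mult_left_mono)
        have "hi ^ ?n - lo ^ ?n \<le> (hi - lo) * (real ?n * (a + 1) ^ (?n - 1))"
        proof -
          have "hi ^ ?n - lo ^ ?n = (hi - lo) * (\<Sum>i<?n. lo ^ (?n - Suc i) * hi ^ i)"
            by (rule power_diff_sumr2)
          also have "\<dots> \<le> (hi - lo) * (\<Sum>i<?n. (a + 1) ^ (?n - 1))"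
          proof (intro mult_left_mono sum_mono)
            fix i assume i: "i \<in> {..<?n}"
            have "lo ^ (?n - Suc i) * hi ^ i \<le> (a+1) ^ (?n - Suc i) * (a+1) ^ i"
              using h d by (intro mult_mono power_mono) auto
            also have "\<dots> = (a+1) ^ (?n - 1)" using i by (simp add: power_add[symmetric])
            finally show "lo ^ (?n - Suc i) * hi ^ i \<le> (a+1) ^ (?n - 1)" .
          qed (use h in auto)
          finally show ?thesis by simp
        qed
        then have "(hi ^ ?n - lo ^ ?n) * unit_ball_vol ?n \<le> (hi - lo) * (real ?n * (a + 1) ^ (?n - 1)) * unit_ball_vol ?n"
          by (rule mult_right_mono) simp
        also have "\<dots> \<le> L * (hi - lo)" using h by (simp add: L_def algebra_simps)
        finally show "(hi ^ ?n - lo ^ ?n) * unit_ball_vol ?n \<le> L * (hi - lo)" .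
      qed (use e L in auto)
      also have "\<dots> = e * (hi - lo)" using L by simp
      finally show ?thesis using eq by simp
    qed
    show "\<exists>d>0. \<forall>y\<in>{0..}. norm (y - a) < d \<longrightarrow>
      norm (?\<Psi> y - ?\<Psi> a - (y - a) *\<^sub>R 0) \<le> e * norm (y - a)"
    proof (rule exI[of _ d], intro conjI ballI impI)
      fix y :: real assume y: "y \<in> {0..}" "norm (y - a) < d"
      show "norm (?\<Psi> y - ?\<Psi> a - (y - a) *\<^sub>R 0) \<le> e * norm (y - a)"
      proof (cases "y \<le> a")
        case True
        have "norm (?\<Psi> y - ?\<Psi> a) = norm (?\<Psi> a - ?\<Psi> y)" by (rule norm_minus_commute)
        also have "\<dots> \<le> e * (a - y)" by (rule key) (use y True in auto)
        finally show ?thesis using True by simp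
      next
        case False
        have "norm (?\<Psi> y - ?\<Psi> a) \<le> e * (y - a)" by (rule key) (use y False a in auto)
        then show ?thesis using False by simp
      qed
    qed (rule d)
  qed
  have "((\<lambda>R. of_real (R ^ ?n) * m) has_vector_derivative radial f a) (at a within {0..})"
  proof -
    have "((\<lambda>R::real. R ^ ?n) has_real_derivative (real ?n * a ^ (?n - 1))) (at a within {0..})"
      by (auto intro!: derivative_eq_intros)
    then have "((\<lambda>R. of_real (R ^ ?n) * m) has_vector_derivative (of_real (real ?n * a ^ (?n - 1)) * m)) (at a within {0..})"
      by (intro has_vector_derivative_mult_left has_vector_derivative_of_real)
    then show ?thesis by (simp add: radial_def m_def)
  qed
  from has_vector_derivative_add[OF \<Psi>' this] show ?thesis by simp
qed

lemma integral_has_vector_derivative_half_line: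
  fixes f :: "real \<Rightarrow> complex"
  assumes "continuous_on {0..} f" and "x \<ge> 0"
  shows "((\<lambda>R. integral {0..R} f) has_vector_derivative f x) (at x within {0..})"
proof -
  have "((\<lambda>R. integral {0..R} f) has_vector_derivative f x) (at x within {0..x+1})"
    by (rule integral_has_vector_derivative) (use assms in \<open>auto intro: continuous_on_subset\<close>)
  moreover have "at x within {0..x+1} = at x within {0..}"
    by (rule at_within_nhd[of _ "{..<x+1}"]) auto
  ultimately show ?thesis by simp
qed

lemma continuous_on_integral_half_line:
  fixes f :: "real \<Rightarrow> complex"
  assumes "continuous_on {0..} f"
  shows "continuous_on {0..} (\<lambda>R. integral {0..R} f)"
  using integral_has_vector_derivative_half_line[OF assms]
  by (auto simp: continuous_on_eq_continuous_within intro: has_vector_derivative_continuous)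

lemma ftc_half_line:
  fixes F f :: "real \<Rightarrow> complex"
  assumes "\<And>x. x \<ge> 0 \<Longrightarrow> (F has_vector_derivative f x) (at x within {0..})" "0 \<le> a" "a \<le> b"
  shows "(f has_integral F b - F a) {a..b}"
proof (rule fundamental_theorem_of_calculus[OF assms(3)])
  show "(F has_vector_derivative f x) (at x within {a..b})" if "x \<in> {a..b}" for x
    by (rule has_vector_derivative_within_subset[OF assms(1)]) (use assms that in auto)
qed

lemma continuous_on_radial:
  fixes f :: "'a::euclidean_space \<Rightarrow> complex"
  assumes cont: "continuous_on UNIV f"
  shows "continuous_on {0..} (radial f)"
proof -
  have "continuous_on {0..} (\<lambda>r. integral (cball 0 1 - {0}) (\<lambda>w. f (r *\<^sub>R sgn w)))"
    unfolding continuous_on_sequentially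
  proof (intro allI ballI impI, elim conjE)
    fix X :: "nat \<Rightarrow> real" and a :: real
    assume X: "X \<longlonglongrightarrow> a"
    then have "Bseq X" by (intro convergent_imp_Bseq convergentI)
    then obtain \<rho> where \<rho>: "\<And>n. \<bar>X n\<bar> \<le> \<rho>" unfolding Bseq_def by auto
    have "compact (f ` cball 0 \<rho>)" using cont by (intro compact_continuous_image) (auto intro: continuous_on_subset)
    then obtain M where M: "\<And>w. w \<in> cball 0 \<rho> \<Longrightarrow> norm (f w) \<le> M"
      by (meson bounded_iff compact_imp_bounded imageI)
    have "(\<lambda>k. integral (cball 0 1 - {0}) (\<lambda>w. f (X k *\<^sub>R sgn w))) \<longlonglongrightarrow> integral (cball 0 1 - {0}) (\<lambda>w. f (a *\<^sub>R sgn w))"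
    proof (rule dominated_convergence(2)[where h = "\<lambda>_. M"])
      show "norm (f (X k *\<^sub>R sgn w)) \<le> M" if "w \<in> cball 0 1 - {0}" for k w
        by (rule M) (use \<rho>[of k] that in \<open>auto simp: norm_sgn\<close>)
      have "isCont f (a *\<^sub>R sgn w)" for w using cont by (simp add: continuous_on_eq_continuous_at)
      then show "(\<lambda>k. f (X k *\<^sub>R sgn w)) \<longlonglongrightarrow> f (a *\<^sub>R sgn w)" for w
        by (rule isCont_tendsto_compose) (intro tendsto_intros X)
    qed (auto intro: integrable_sphere_scaled[OF cont] const_integrable_unit_ball)
    then show "((\<lambda>r. integral (cball 0 1 - {0}) (\<lambda>w. f (r *\<^sub>R sgn w))) \<circ> X) \<longlonglongrightarrow> integral (cball 0 1 - {0}) (\<lambda>w. f (a *\<^sub>R sgn w))"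
      by (simp add: o_def)
  qed
  then show ?thesis unfolding radial_def by (intro continuous_intros)
qed

text \<open>Polar coordinates by the fundamental theorem of calculus in R: the ball integral has
  derivative \<open>radial f\<close> and vanishes at R = 0, where the ball is a single
  point.\<close>

lemma integral_cball_eq_radial:
  fixes f :: "'a::euclidean_space \<Rightarrow> complex"
  assumes "continuous_on UNIV f" and "R \<ge> 0"
  shows "integral (cball 0 R) f = integral {0..R} (radial f)"
  using ftc_half_line[OF integral_cball_has_vector_derivative[OF assms(1)], of 0 R] assms
  by (simp add: has_integral_iff)

section \<open>Iterated integrals on the half line and their relation to
  \<open>pcomp\<close>\<close>

fun nested_int :: "(real \<Rightarrow> complex) list \<Rightarrow> real \<Rightarrow> complex" where
  "nested_int [] R = 1"
| "nested_int (s # ss) R = integral {0..R} (\<lambda>r. s r * nested_int ss r)"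

lemma continuous_on_nested_int:
  assumes "\<forall>s\<in>set ss. continuous_on {0..} s"
  shows "continuous_on {0..} (nested_int ss)"
  using assms
proof (induction ss)
  case Nil
  have "nested_int [] = (\<lambda>R. 1)" by auto
  then show ?case by simp
next
  case (Cons s ss)
  have "nested_int (s # ss) = (\<lambda>R. integral {0..R} (\<lambda>r. s r * nested_int ss r))" by auto
  then show ?case using Cons by (auto intro!: continuous_on_integral_half_line continuous_intros)
qed

lemma nested_int_has_vector_derivative:
  assumes "\<forall>s\<in>set (s # ss). continuous_on {0..} s" and "x \<ge> 0"
  shows "(nested_int (s # ss) has_vector_derivative s x * nested_int ss x) (at x within {0..})"
proof -
  have "nested_int (s # ss) = (\<lambda>R. integral {0..R} (\<lambda>r. s r * nested_int ss r))" by auto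
  then show ?thesis using assms
    by (auto intro!: integral_has_vector_derivative_half_line[where f = "\<lambda>r. s r * nested_int ss r"]
        continuous_intros continuous_on_nested_int)
qed

lemma nested_int_Cons_0: "nested_int (s # ss) 0 = 0" by simp

text \<open>The inner integral in \<open>pcomp\<close> depends on \<xi> only through its norm, so it
  can be taken out of the angular average. This reduces the nesting to one dimension.\<close>

lemma radial_mult_norm:
  fixes f :: "'a::euclidean_space \<Rightarrow> complex"
  assumes "r \<ge> 0"
  shows "radial (\<lambda>\<xi>. f \<xi> * h (norm \<xi>)) r = radial f r * h r"
proof -
  have "integral (cball 0 1 - {0}) (\<lambda>w::'a. f (r *\<^sub>R sgn w) * h (norm (r *\<^sub>R sgn w)))
      = integral (cball 0 1 - {0}) (\<lambda>w::'a. f (r *\<^sub>R sgn w) * h r)"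
    by (rule integral_cong) (use assms in \<open>auto simp: norm_sgn\<close>)
  then show ?thesis by (simp add: radial_def)
qed

text \<open>The two claims share one induction: the ball integral for a list is the inner factor of
  \<open>pcomp\<close> for the list with one more head, and rewriting that factor as a nested
  integral is what shows the longer \<open>pcomp\<close> to be continuous.\<close>

lemma pcomp_Cons:
  assumes "\<forall>s\<in>set (s # ss). continuous_on UNIV (\<lambda>\<xi>. s (x, \<xi>))"
  shows "pcomp (s # ss) x \<xi> = s (x, \<xi>) * nested_int (map (\<lambda>s. radial (\<lambda>\<xi>. s (x, \<xi>))) ss) (norm \<xi>)"
    and "R \<ge> 0 \<Longrightarrow> integral (cball 0 R) (pcomp (s # ss) x)
           = nested_int (map (\<lambda>s. radial (\<lambda>\<xi>. s (x, \<xi>))) (s # ss)) R"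
  using assms
proof (induction ss arbitrary: s \<xi> R)
  let ?N = "\<lambda>ss. nested_int (map (\<lambda>s. radial (\<lambda>\<xi>. s (x, \<xi>))) ss)"
  have step: "integral (cball 0 R) (\<lambda>\<xi>. s (x, \<xi>) * ?N ss (norm \<xi>)) = ?N (s # ss) R"
    if c: "\<forall>s\<in>set (s # ss). continuous_on UNIV (\<lambda>\<xi>. s (x, \<xi>))" and R: "R \<ge> 0" for s ss R
  proof -
    have cN: "continuous_on {0..} (?N ss)"
      by (rule continuous_on_nested_int) (use c in \<open>auto intro: continuous_on_radial\<close>)
    have "continuous_on UNIV (\<lambda>\<xi>. s (x, \<xi>) * ?N ss (norm \<xi>))"
      using c by (auto intro!: continuous_intros continuous_on_compose2[OF cN])
    then have "integral (cball 0 R) (\<lambda>\<xi>. s (x, \<xi>) * ?N ss (norm \<xi>))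
        = integral {0..R} (radial (\<lambda>\<xi>. s (x, \<xi>) * ?N ss (norm \<xi>)))"
      using R by (rule integral_cball_eq_radial)
    also have "\<dots> = ?N (s # ss) R"
      by (simp, rule integral_cong, rule radial_mult_norm) simp
    finally show ?thesis .
  qed
  {
    case Nil
    { case 1 show ?case by simp
    next
      case 2
      have "pcomp [s] x = (\<lambda>\<xi>. s (x, \<xi>) * ?N [] (norm \<xi>))" by auto
      then show ?case using step[of s "[]" R] 2 by simp }
  next
    case (Cons t ss)
    have eq: "pcomp (s # t # ss) x \<xi> = s (x, \<xi>) * ?N (t # ss) (norm \<xi>)"
      if "\<forall>s\<in>set (s # t # ss). continuous_on UNIV (\<lambda>\<xi>. s (x, \<xi>))" for s \<xi>
      using Cons.IH(2)[of "norm \<xi>" t] that by simp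
    { case 1 then show ?case by (rule eq)
    next
      case 2
      have "pcomp (s # t # ss) x = (\<lambda>\<xi>. s (x, \<xi>) * ?N (t # ss) (norm \<xi>))"
        using eq[OF 2(2)] by auto
      then show ?case using step[of s "t # ss" R] 2 by simp }
  }
qed

section \<open>Uniqueness of the constant term\<close>

lemma exp_poly_shift:
  fixes p :: "complex poly" and a b t h :: complex
  shows "exp (b * (t + h)) * poly p (t + h) - exp (a * h) * (exp (b * t) * poly p t)
     = exp (b * t) * poly (smult (exp (b * h)) (p \<circ>\<^sub>p [:h, 1:]) - smult (exp (a * h)) p) t"
  by (simp add: poly_pcompose algebra_simps exp_add)

lemma coeff_shift_same:
  fixes p :: "complex poly"
  shows "coeff (p \<circ>\<^sub>p [:h, 1:]) (degree p) = lead_coeff p"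
  using lead_coeff_comp[of "[:h, 1:]" p] by (simp add: degree_pcompose)

text \<open>The shift-difference operator \<open>f (t + h) - exp (a h) f t\<close> lowers the degree of the polynomial
  attached to the frequency \<open>a\<close> and, for suitable \<open>h\<close>, does not annihilate the one attached to
  the frequency \<open>0\<close>.\<close>
lemma exp_poly_tendsto_zero:
  fixes P :: "complex \<Rightarrow> complex poly"
  assumes "finite B" "0 \<in> B"
    and "((\<lambda>t::real. \<Sum>b\<in>B. exp (b * complex_of_real t) * poly (P b) (complex_of_real t)) \<longlongrightarrow> 0) at_top"
  shows "P 0 = 0"
  \<comment> \<open>The induction measure counts the coefficients available at the frequencies other
    than 0. A shift-difference step raises no degree, and at the chosen frequency a it cancels the
    leading coefficient, so the measure drops until only frequency 0 remains.\<close>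
  using assms(3)
proof (induction "\<Sum>b\<in>B-{0}. if P b = 0 then 0 else Suc (degree (P b))" arbitrary: P rule: less_induct)
  case less
  show ?case
  proof (cases "\<forall>b\<in>B-{0}. P b = 0")
    case True
    have "(\<Sum>b\<in>B. exp (b * complex_of_real t) * poly (P b) (complex_of_real t)) = poly (P 0) (complex_of_real t)" for t :: real
      using True assms by (subst sum.remove[of _ 0]) auto
    with less.prems have lim: "((\<lambda>t::real. poly (P 0) (complex_of_real t)) \<longlongrightarrow> 0) at_top" by simp
    obtain c p where p: "P 0 = pCons c p" by (cases "P 0") auto
    show ?thesis
    proof (cases "p = 0")
      case True
      with lim p have "((\<lambda>t::real. c) \<longlongrightarrow> 0) at_top" by simp
      then have "c = 0" by (simp add: tendsto_const_iff)
      with True p show ?thesis by simp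
    next
      case False
      from poly_infinity[OF this, of 1 c] obtain r where r: "\<And>z. r \<le> norm z \<Longrightarrow> 1 \<le> norm (poly (P 0) z)"
        using p by auto
      have "eventually (\<lambda>t::real. norm (poly (P 0) (complex_of_real t)) < 1) at_top"
        using tendstoD[OF lim, of 1] by (simp add: dist_norm)
      moreover have "eventually (\<lambda>t::real. t \<ge> max r 0) at_top" by (rule eventually_ge_at_top)
      ultimately have "eventually (\<lambda>t::real. False) at_top"
      proof eventually_elim
        case (elim t)
        then show ?case using r[of t] by simp
      qed
      then show ?thesis by simp
    qed
  next
    case False
    then obtain a where a: "a \<in> B" "a \<noteq> 0" "P a \<noteq> 0" by auto
    \<comment> \<open>This choice gives |a h| = 1, which is less than 2 pi, so exp(a h) \<noteq> 1.
      At frequency 0 the operator multiplies the leading coefficient by 1 - exp(a h), and therefore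
      \<open>Q 0 = 0\<close> forces \<open>P 0 = 0\<close>.\<close>
    define h where "h = 1 / norm a"
    have h: "h > 0" using a by (simp add: h_def)
    have ne: "exp (a * complex_of_real h) \<noteq> 1"
    proof
      assume "exp (a * complex_of_real h) = 1"
      then obtain n where n: "Re (a * complex_of_real h) = 0" "Im (a * complex_of_real h) = of_int (2 * n) * pi"
        unfolding exp_eq_1 by auto
      have nn: "norm (a * complex_of_real h) = 1" using a by (simp add: h_def norm_mult norm_divide)
      then have "\<bar>Im (a * complex_of_real h)\<bar> = 1" using cmod_eq_Im[OF n(1)] by linarith
      then have "\<bar>of_int (2 * n)\<bar> * pi = 1" unfolding n(2) abs_mult by simp
      moreover from this have "n \<noteq> 0" by auto
      then have "\<bar>of_int (2 * n)\<bar> \<ge> (1::real)" by linarith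
      then have "\<bar>of_int (2 * n)\<bar> * pi \<ge> 1 * pi" by (intro mult_right_mono) auto
      ultimately show False using pi_gt3 by linarith
    qed
    define Q where "Q b = smult (exp (b * complex_of_real h)) (P b \<circ>\<^sub>p [:complex_of_real h, 1:]) - smult (exp (a * complex_of_real h)) (P b)" for b :: complex
    have deg: "degree (Q b) \<le> degree (P b)" for b
      unfolding Q_def by (intro degree_diff_le order_trans[OF degree_smult_le]) (auto simp: degree_pcompose)
    have co: "coeff (Q b) (degree (P b)) = (exp (b * complex_of_real h) - exp (a * complex_of_real h)) * lead_coeff (P b)" for b
      unfolding Q_def by (simp add: coeff_shift_same algebra_simps)
    have Q0: "Q b = 0" if "P b = 0" for b using that by (simp add: Q_def)
    have "((\<lambda>t::real. (\<Sum>b\<in>B. exp (b * (complex_of_real t + complex_of_real h)) * poly (P b) (complex_of_real t + complex_of_real h))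
        - exp (a * complex_of_real h) * (\<Sum>b\<in>B. exp (b * complex_of_real t) * poly (P b) (complex_of_real t))) \<longlongrightarrow> 0 - exp (a * complex_of_real h) * 0) at_top"
    proof (intro tendsto_intros less.prems)
      have "filterlim (\<lambda>t::real. t + h) at_top at_top"
        using filterlim_tendsto_add_at_top[OF tendsto_const filterlim_ident, of h] by (simp add: add.commute)
      from filterlim_compose[OF less.prems this]
      show "((\<lambda>t::real. (\<Sum>b\<in>B. exp (b * (complex_of_real t + complex_of_real h)) * poly (P b) (complex_of_real t + complex_of_real h))) \<longlongrightarrow> 0) at_top" by simp
    qed
    moreover have "(\<Sum>b\<in>B. exp (b * (complex_of_real t + complex_of_real h)) * poly (P b) (complex_of_real t + complex_of_real h))
        - exp (a * complex_of_real h) * (\<Sum>b\<in>B. exp (b * complex_of_real t) * poly (P b) (complex_of_real t))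
        = (\<Sum>b\<in>B. exp (b * complex_of_real t) * poly (Q b) (complex_of_real t))" for t :: real
      unfolding sum_distrib_left sum_subtractf[symmetric] Q_def
      by (intro sum.cong refl exp_poly_shift)
    ultimately have lim: "((\<lambda>t::real. \<Sum>b\<in>B. exp (b * complex_of_real t) * poly (Q b) (complex_of_real t)) \<longlongrightarrow> 0) at_top" by simp
    have "Q 0 = 0"
    proof (rule less.hyps[OF _ lim])
      show "(\<Sum>b\<in>B-{0}. if Q b = 0 then 0 else Suc (degree (Q b)))
          < (\<Sum>b\<in>B-{0}. if P b = 0 then 0 else Suc (degree (P b)))"
      proof (rule sum_strict_mono_ex1)
        show "\<forall>b\<in>B-{0}. (if Q b = 0 then 0 else Suc (degree (Q b))) \<le> (if P b = 0 then 0 else Suc (degree (P b)))"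
          using deg Q0 by auto
        have "degree (Q a) < degree (P a)" if "Q a \<noteq> 0"
        proof -
          have "coeff (Q a) (degree (P a)) = 0" using co[of a] by simp
          with that deg[of a] show ?thesis by (metis le_neq_implies_less leading_coeff_0_iff)
        qed
        then show "\<exists>b\<in>B-{0}. (if Q b = 0 then 0 else Suc (degree (Q b))) < (if P b = 0 then 0 else Suc (degree (P b)))"
          using a by (intro bexI[of _ a]) auto
      qed (use assms in auto)
    qed
    with co[of 0] ne show ?thesis by simp
  qed
qed

text \<open>The substitution R = exp t turns R^a (ln R)^l into exp(a t) t^l, and the terms with
  equal a are collected in one polynomial. The index set B is left free so that two expansions can
  be written over the same frequencies.\<close>

lemma exp_poly_of_log_sum:
  fixes coef :: "complex \<times> nat \<Rightarrow> complex"
  assumes A: "finite A" and *: "(0, 0) \<notin> A"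
  shows "\<exists>P. (\<forall>B t. finite B \<and> fst ` A \<subseteq> B \<longrightarrow>
      (\<Sum>b\<in>B. exp (b * complex_of_real t) * poly (P b) (complex_of_real t))
      = (\<Sum>(a, l)\<in>A. coef (a, l) * complex_of_real (exp t) powr a * (complex_of_real (ln (exp t))) ^ l))
    \<and> coeff (P 0) 0 = 0"
proof -
  define P where "P b = (\<Sum>p\<in>{p\<in>A. fst p = b}. monom (coef p) (snd p))" for b :: complex
  show ?thesis
  proof (rule exI[of _ P], intro conjI allI impI; (elim conjE)?)
    fix B :: "complex set" and t :: real assume B: "finite B" "fst ` A \<subseteq> B"
    have "(\<Sum>b\<in>B. exp (b * complex_of_real t) * poly (P b) (complex_of_real t))
       = (\<Sum>b\<in>B. \<Sum>p\<in>{p\<in>A. fst p = b}. coef p * exp (fst p * complex_of_real t) * complex_of_real t ^ snd p)"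
      unfolding P_def poly_sum sum_distrib_left poly_monom
      by (intro sum.cong refl) (simp add: mult_ac)
    also have "\<dots> = (\<Sum>p\<in>A. coef p * exp (fst p * complex_of_real t) * complex_of_real t ^ snd p)"
      by (rule sum.group[OF A B])
    also have "\<dots> = (\<Sum>(a, l)\<in>A. coef (a, l) * complex_of_real (exp t) powr a * (complex_of_real (ln (exp t))) ^ l)"
    proof (intro sum.cong refl)
      fix p assume p: "p \<in> A"
      have "complex_of_real (exp t) powr fst p = exp (fst p * complex_of_real t)"
        by (simp add: powr_def Ln_of_real del: of_real_exp)
      then show "coef p * exp (fst p * complex_of_real t) * complex_of_real t ^ snd p
         = (case p of (a, l) \<Rightarrow> coef (a, l) * complex_of_real (exp t) powr a * (complex_of_real (ln (exp t))) ^ l)"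
        by (cases p) simp
    qed
    finally show "(\<Sum>b\<in>B. exp (b * complex_of_real t) * poly (P b) (complex_of_real t))
      = (\<Sum>(a, l)\<in>A. coef (a, l) * complex_of_real (exp t) powr a * (complex_of_real (ln (exp t))) ^ l)" .
  next
    have "coeff (monom (coef p) (snd p)) 0 = 0" if "p \<in> {p\<in>A. fst p = 0}" for p
      using that * by (cases p) auto
    then show "coeff (P 0) 0 = 0"
      unfolding P_def coeff_sum by (intro sum.neutral ballI)
  qed
qed

text \<open>The difference of the two expansions is an exponential polynomial that tends to 0, and
  \<open>c - c'\<close> is the constant coefficient of its polynomial at frequency 0, because
  neither sum contains the pair (0, 0). This gives the definite description in
  \<open>cutoff_int\<close> at most one candidate.\<close>

lemma log_sum_constant_unique:
  fixes coef coef' :: "complex \<times> nat \<Rightarrow> complex" and F :: "real \<Rightarrow> complex" and c c' :: complex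
  assumes A: "finite A" "(0, 0) \<notin> A" and A': "finite A'" "(0, 0) \<notin> A'"
    and lim: "((\<lambda>R::real. F R - (\<Sum>(a, l)\<in>A. coef (a, l) * complex_of_real R powr a * (complex_of_real (ln R)) ^ l) - c) \<longlongrightarrow> 0) at_top"
    and lim': "((\<lambda>R::real. F R - (\<Sum>(a, l)\<in>A'. coef' (a, l) * complex_of_real R powr a * (complex_of_real (ln R)) ^ l) - c') \<longlongrightarrow> 0) at_top"
  shows "c = c'"
proof -
  let ?S = "\<lambda>A coef R. (\<Sum>(a, l)\<in>A. coef (a, l) * complex_of_real R powr a * (complex_of_real (ln R)) ^ l)"
  from exp_poly_of_log_sum[OF A, of coef] obtain P where P: "\<forall>B t. finite B \<and> fst ` A \<subseteq> B \<longrightarrow>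
      (\<Sum>b\<in>B. exp (b * complex_of_real t) * poly (P b) (complex_of_real t)) = ?S A coef (exp t)" "coeff (P 0) 0 = 0"
    by blast
  from exp_poly_of_log_sum[OF A', of coef'] obtain P' where P': "\<forall>B t. finite B \<and> fst ` A' \<subseteq> B \<longrightarrow>
      (\<Sum>b\<in>B. exp (b * complex_of_real t) * poly (P' b) (complex_of_real t)) = ?S A' coef' (exp t)" "coeff (P' 0) 0 = 0"
    by blast
  define B where "B = insert 0 (fst ` A \<union> fst ` A')"
  have B: "finite B" "0 \<in> B" "fst ` A \<subseteq> B" "fst ` A' \<subseteq> B" using A A' by (auto simp: B_def)
  define Q where "Q b = P b - P' b + (if b = 0 then [:c - c':] else 0)" for b
  have "((\<lambda>R. (F R - ?S A' coef' R - c') - (F R - ?S A coef R - c)) \<longlongrightarrow> 0 - 0) at_top"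
    by (intro tendsto_diff lim lim')
  then have "((\<lambda>R. ?S A coef R - ?S A' coef' R + (c - c')) \<longlongrightarrow> 0) at_top"
    by (simp add: algebra_simps)
  then have "((\<lambda>t. ?S A coef (exp t) - ?S A' coef' (exp t) + (c - c')) \<longlongrightarrow> 0) at_top"
    by (rule filterlim_compose[OF _ exp_at_top])
  moreover have "?S A coef (exp t) - ?S A' coef' (exp t) + (c - c') = (\<Sum>b\<in>B. exp (b * complex_of_real t) * poly (Q b) (complex_of_real t))" for t
  proof -
    have "(\<Sum>b\<in>B. exp (b * complex_of_real t) * poly (if b = 0 then [:c - c':] else 0) (complex_of_real t))
       = (\<Sum>b\<in>B. if b = 0 then c - c' else 0)" by (intro sum.cong) auto
    also have "\<dots> = c - c'" using B by simp
    finally show ?thesis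
      using P(1)[rule_format, of B t] P'(1)[rule_format, of B t] B
      by (simp only: Q_def poly_add poly_diff distrib_left right_diff_distrib sum.distrib sum_subtractf)
  qed
  ultimately have "((\<lambda>t. \<Sum>b\<in>B. exp (b * complex_of_real t) * poly (Q b) (complex_of_real t)) \<longlongrightarrow> 0) at_top" by simp
  from exp_poly_tendsto_zero[OF B(1,2) this] have "Q 0 = 0" .
  then have "coeff (Q 0) 0 = 0" by simp
  then show ?thesis using P(2) P'(2) by (simp add: Q_def)
qed

section \<open>Expansions with logarithms\<close>

lemma powr_has_vector_derivative:
  assumes "r > 0"
  shows "((\<lambda>r. complex_of_real r powr b) has_vector_derivative b * complex_of_real r powr (b - 1)) (at r within S)"
  by (rule has_vector_derivative_real_field[where f = "\<lambda>z. z powr b"])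
    (use assms in \<open>auto intro!: derivative_eq_intros simp: complex_nonpos_Reals_iff\<close>)

lemma norm_powr_of_real: "r > 0 \<Longrightarrow> norm (complex_of_real r powr b) = r powr Re b"
  by (simp add: norm_powr_real_powr)

lemma continuous_on_powr_of_real: "continuous_on {1..} (\<lambda>r. complex_of_real r powr b)"
  unfolding continuous_on_eq_continuous_within
  by (auto intro!: has_vector_derivative_continuous[OF powr_has_vector_derivative])

text \<open>L is the improper integral of h over {1..}, and C / (-e) R^e is the integral of C
  r^(e-1) from R to infinity. The constant is explicit because \<open>phg_integral\<close> needs it
  uniformly in the parameter z.\<close>

lemma integral_tail_limit:
  fixes h :: "real \<Rightarrow> complex"
  assumes cont: "continuous_on {1..} h" and e: "e < 0"
    and bd: "\<And>r. r \<ge> 1 \<Longrightarrow> norm (h r) \<le> C * r powr (e - 1)"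
  shows "\<exists>L. \<forall>R\<ge>1. norm (integral {1..R} h - L) \<le> C / (-e) * R powr e"
proof -
  have C: "C \<ge> 0" using bd[of 1] norm_ge_zero[of "h 1"] by (simp del: norm_ge_zero)
  define K where "K = C / (-e)"
  have K: "K \<ge> 0" using C e unfolding K_def by (intro divide_nonneg_pos) auto
  have ci: "h integrable_on {a..b}" if "a \<ge> 1" for a b
    by (rule integrable_continuous_real) (use that in \<open>auto intro: continuous_on_subset[OF cont]\<close>)
  have dist: "norm (integral {1..b} h - integral {1..a} h) \<le> K * a powr e" if "1 \<le> a" "a \<le> b" for a b
  proof -
    have "integral {1..a} h + integral {a..b} h = integral {1..b} h"
      by (rule Henstock_Kurzweil_Integration.integral_combine) (use that ci in auto)
    then have "norm (integral {1..b} h - integral {1..a} h) = norm (integral {a..b} h)"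
      by (metis add_diff_cancel_left')
    also have ftc: "((\<lambda>r. C * r powr (e - 1)) has_integral (C / e * b powr e - C / e * a powr e)) {a..b}"
    proof (rule fundamental_theorem_of_calculus[OF that(2)])
      fix x assume x: "x \<in> {a..b}"
      have "((\<lambda>r. C / e * r powr e) has_real_derivative C / e * (e * x powr (e - 1))) (at x within {a..b})"
        using x that by (intro DERIV_cmult) (auto intro!: derivative_eq_intros)
      then show "((\<lambda>r. C / e * r powr e) has_vector_derivative C * x powr (e - 1)) (at x within {a..b})"
        using e by (simp add: has_real_derivative_iff_has_vector_derivative)
    qed
    have "norm (integral {a..b} h) \<le> integral {a..b} (\<lambda>r. C * r powr (e - 1))"
      by (rule integral_norm_bound_integral) (use ci that bd ftc in auto)
    also have "\<dots> = C / e * b powr e - C / e * a powr e" using ftc by (simp add: has_integral_iff)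
    also have "\<dots> = K * a powr e - K * b powr e" by (simp add: K_def)
    also have "\<dots> \<le> K * a powr e" using K by simp
    finally show ?thesis .
  qed
  have lim0: "((\<lambda>n. K * real (Suc n) powr e) \<longlonglongrightarrow> K * 0)"
    by (intro tendsto_mult tendsto_const tendsto_neg_powr[OF e] filterlim_compose[OF filterlim_real_sequentially filterlim_Suc])
  define X where "X n = integral {1..real (Suc n)} h" for n
  have "Cauchy X"
  proof (rule metric_CauchyI)
    fix \<epsilon> :: real assume "\<epsilon> > 0"
    with lim0 have "eventually (\<lambda>n. K * real (Suc n) powr e < \<epsilon> / 2) sequentially"
      by (intro order_tendstoD(2)[OF lim0]) simp
    then obtain n0 where n0: "K * real (Suc n0) powr e < \<epsilon> / 2" by (auto simp: eventually_sequentially)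
    have "dist (X m) (X n0) < \<epsilon> / 2" if "m \<ge> n0" for m
      using dist[of "real (Suc n0)" "real (Suc m)"] that n0 by (simp add: X_def dist_norm)
    then have "dist (X m) (X n) < \<epsilon>" if "m \<ge> n0" "n \<ge> n0" for m n
      using that by (metis dist_triangle_half_l)
    then show "\<exists>M. \<forall>m\<ge>M. \<forall>n\<ge>M. dist (X m) (X n) < \<epsilon>" by blast
  qed
  then obtain L where L: "X \<longlonglongrightarrow> L" using Cauchy_convergent convergent_def by blast
  show ?thesis
  proof (intro exI allI impI)
    fix R :: real assume R: "R \<ge> 1"
    have "(\<lambda>n. norm (integral {1..R} h - X n)) \<longlonglongrightarrow> norm (integral {1..R} h - L)"
      by (intro tendsto_intros L)
    moreover have "eventually (\<lambda>n. norm (integral {1..R} h - X n) \<le> K * R powr e) sequentially"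
    proof -
      obtain n0 where "R \<le> real n0" using real_arch_simple by blast
      then have "norm (integral {1..R} h - X n) \<le> K * R powr e" if "n \<ge> n0" for n
        using dist[of R "real (Suc n)"] that R by (simp add: X_def norm_minus_commute)
      then show ?thesis by (auto simp: eventually_sequentially)
    qed
    ultimately have "norm (integral {1..R} h - L) \<le> K * R powr e"
      by (intro tendsto_upperbound) auto
    then show "norm (integral {1..R} h - L) \<le> C / (-e) * R powr e" by (simp add: K_def)
  qed
qed

text \<open>Finite sums of terms c R^a (ln R)^l with a in S. The inductive form turns closure
  properties into inductions without bookkeeping of coefficients; the explicit sum is recovered
  once, in \<open>log_poly_finite_form\<close>. The last rule makes values below R = 1 irrelevant,
  where powers and logarithms misbehave.\<close>

inductive log_poly :: "complex set \<Rightarrow> (real \<Rightarrow> complex) \<Rightarrow> bool" for S where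
  zero: "log_poly S (\<lambda>R. 0)"
| monomial: "a \<in> S \<Longrightarrow> log_poly S (\<lambda>R. c * complex_of_real R powr a * complex_of_real (ln R) ^ l)"
| add: "log_poly S f \<Longrightarrow> log_poly S g \<Longrightarrow> log_poly S (\<lambda>R. f R + g R)"
| cong: "log_poly S f \<Longrightarrow> (\<And>R. R \<ge> 1 \<Longrightarrow> g R = f R) \<Longrightarrow> log_poly S g"

lemma log_poly_mono: "log_poly S f \<Longrightarrow> S \<subseteq> T \<Longrightarrow> log_poly T f"
  by (induction rule: log_poly.induct) (auto intro: log_poly.intros)

lemma log_poly_term0: "a \<in> S \<Longrightarrow> log_poly S (\<lambda>R. c * complex_of_real R powr a)"
  using log_poly.monomial[of a S c 0] by simp

lemma log_poly_const: "0 \<in> S \<Longrightarrow> log_poly S (\<lambda>R. c)"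
  by (rule log_poly.cong[OF log_poly_term0[of 0]]) auto

lemma log_poly_sum:
  "finite I \<Longrightarrow> (\<And>i. i \<in> I \<Longrightarrow> log_poly S (f i)) \<Longrightarrow> log_poly S (\<lambda>R. \<Sum>i\<in>I. f i R)"
  by (induction rule: finite_induct) (auto intro: log_poly.zero log_poly.add)

lemma log_poly_mult:
  assumes "log_poly S f" "log_poly T g" and V: "\<And>a b. a \<in> S \<Longrightarrow> b \<in> T \<Longrightarrow> a + b \<in> V"
  shows "log_poly V (\<lambda>R. f R * g R)"
  using assms(1)
proof (induction rule: log_poly.induct)
  case zero
  then show ?case by (simp add: log_poly.zero)
next
  case (monomial a c l)
  note a = monomial
  from assms(2) show ?case
  proof (induction rule: log_poly.induct)
    case zero
    then show ?case by (simp add: log_poly.zero)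
  next
    case (monomial b d m)
    have "log_poly V (\<lambda>R. (c * d) * complex_of_real R powr (a + b) * complex_of_real (ln R) ^ (l + m))"
      using V a monomial by (intro log_poly.monomial) auto
    then show ?case by (rule log_poly.cong) (simp add: powr_add power_add)
  next
    case (add f g)
    then show ?case by (simp add: distrib_left log_poly.add)
  next
    case (cong f g)
    then show ?case by (auto intro: log_poly.cong)
  qed
next
  case (add f g)
  then show ?case by (simp add: distrib_right log_poly.add)
next
  case (cong f g)
  then show ?case by (auto intro: log_poly.cong)
qed

lemma log_poly_cmult: "log_poly S f \<Longrightarrow> log_poly S (\<lambda>R. c * f R)"
  by (rule log_poly_mult[OF log_poly_const[of "{0}"]]) auto

lemma log_poly_bound:
  assumes "log_poly S f"
  shows "\<exists>C M. C \<ge> 0 \<and> (\<forall>R\<ge>1. norm (f R) \<le> C * R powr M)"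
  using assms
proof (induction rule: log_poly.induct)
  case zero
  show ?case by (rule exI[of _ 0]) simp
next
  case (monomial a c l)
  have "norm (c * complex_of_real R powr a * complex_of_real (ln R) ^ l) \<le> norm c * R powr (Re a + real l)"
    if R: "R \<ge> 1" for R
  proof -
    \<comment> \<open>A crude bound is enough, since the lemma asks only for some polynomial growth:
      each logarithm may cost a full power of R.\<close>
    have "(ln R) ^ l \<le> R ^ l" using R ln_le_minus_one[of R] by (intro power_mono) auto
    then have "\<bar>ln R\<bar> ^ l \<le> R powr real l" using R by (simp add: powr_realpow)
    then have "norm c * R powr Re a * \<bar>ln R\<bar> ^ l \<le> norm c * R powr Re a * R powr real l"
      by (intro mult_left_mono) auto
    then show ?thesis
      using R by (simp add: norm_mult norm_power norm_powr_of_real powr_add mult.assoc)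
  qed
  then show ?case by (intro exI[of _ "norm c"] exI[of _ "Re a + real l"]) auto
next
  case (add f g)
  then obtain C M D N where h: "C \<ge> 0" "\<forall>R\<ge>1. norm (f R) \<le> C * R powr M"
    "D \<ge> 0" "\<forall>R\<ge>1. norm (g R) \<le> D * R powr N" by blast
  have "norm (f R + g R) \<le> (C + D) * R powr (max M N)" if R: "R \<ge> 1" for R
  proof -
    have "norm (f R + g R) \<le> C * R powr M + D * R powr N"
      using h R by (intro order_trans[OF norm_triangle_ineq] add_mono) auto
    also have "\<dots> \<le> C * R powr (max M N) + D * R powr (max M N)"
      using h R by (intro add_mono mult_left_mono powr_mono) auto
    finally show ?thesis by (simp add: algebra_simps)
  qed
  with h show ?case by (intro exI[of _ "C + D"] exI[of _ "max M N"]) auto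
next
  case (cong f g)
  then show ?case by auto
qed

lemma log_poly_continuous:
  assumes "log_poly S f"
  shows "continuous_on {1..} f"
  using assms
proof (induction rule: log_poly.induct)
  case (cong f g)
  then show ?case using continuous_on_cong[of "{1..}" "{1..}" g f] by auto
qed (auto intro!: continuous_intros continuous_on_powr_of_real)

text \<open>Returns to the finite sum over pairs of exponents in which \<open>cutoff_int\<close> is
  phrased.\<close>

lemma log_poly_finite_form:
  assumes "log_poly S f"
  shows "\<exists>A coef. finite A \<and> A \<subseteq> S \<times> UNIV \<and>
    (\<forall>R\<ge>1. f R = (\<Sum>(a, l)\<in>A. coef (a, l) * complex_of_real R powr a * complex_of_real (ln R) ^ l))"
  using assms
proof (induction rule: log_poly.induct)
  case zero
  show ?case by (rule exI[of _ "{}"]) simp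
next
  case (monomial a c l)
  then show ?case by (intro exI[of _ "{(a, l)}"] exI[of _ "\<lambda>_. c"]) auto
next
  case (add f g)
  from add.IH(1) obtain A c where A: "finite A" "A \<subseteq> S \<times> UNIV"
    "\<forall>R\<ge>1. f R = (\<Sum>(a, l)\<in>A. c (a, l) * complex_of_real R powr a * complex_of_real (ln R) ^ l)" by blast
  from add.IH(2) obtain B d where B: "finite B" "B \<subseteq> S \<times> UNIV"
    "\<forall>R\<ge>1. g R = (\<Sum>(a, l)\<in>B. d (a, l) * complex_of_real R powr a * complex_of_real (ln R) ^ l)" by blast
  define e where "e p = (if p \<in> A then c p else 0) + (if p \<in> B then d p else 0)" for p
  have "f R + g R = (\<Sum>(a, l)\<in>A \<union> B. e (a, l) * complex_of_real R powr a * complex_of_real (ln R) ^ l)"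
    if R: "R \<ge> 1" for R
  proof -
    let ?t = "\<lambda>p. complex_of_real R powr fst p * complex_of_real (ln R) ^ snd p"
    have "f R = (\<Sum>p\<in>A. (if p \<in> A then c p else 0) * ?t p)"
      using A R by (auto simp: split_beta mult.assoc intro!: sum.cong)
    also have "\<dots> = (\<Sum>p\<in>A \<union> B. (if p \<in> A then c p else 0) * ?t p)"
      by (rule sum.mono_neutral_left) (use A B in auto)
    finally have f: "f R = (\<Sum>p\<in>A \<union> B. (if p \<in> A then c p else 0) * ?t p)" .
    have "g R = (\<Sum>p\<in>B. (if p \<in> B then d p else 0) * ?t p)"
      using B R by (auto simp: split_beta mult.assoc intro!: sum.cong)
    also have "\<dots> = (\<Sum>p\<in>A \<union> B. (if p \<in> B then d p else 0) * ?t p)"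
      by (rule sum.mono_neutral_left) (use A B in auto)
    finally have "f R + g R = (\<Sum>p\<in>A \<union> B. e p * ?t p)"
      unfolding f e_def distrib_right sum.distrib by simp
    then show ?thesis by (simp add: split_beta mult.assoc)
  qed
  then show ?case using A B by (intro exI[of _ "A \<union> B"] exI[of _ e]) auto
next
  case (cong f g)
  then show ?case by simp
qed

lemma ln_power_has_derivative:
  "x > 0 \<Longrightarrow> ((\<lambda>r. ln r ^ Suc l) has_real_derivative (real (Suc l) * ln x ^ l * (1 / x))) (at x within S)"
  using DERIV_power[OF has_field_derivative_at_within[OF DERIV_ln_divide[of x]], where n = "Suc l" and s = S]
  by (simp del: of_nat_Suc power_Suc add: mult_ac)

text \<open>Exponent -1 yields one more logarithm at exponent 0. Any other exponent is raised by
  one, and integration by parts trades one logarithm for a smaller instance. The lower limit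
  contributes a constant, which is the other reason for \<open>0 \<in> V\<close>.\<close>

lemma log_poly_integral_term:
  assumes V: "0 \<in> V" "a + 1 \<in> V"
  shows "log_poly V (\<lambda>R. integral {1..R} (\<lambda>r. complex_of_real r powr a * complex_of_real (ln r) ^ l))"
proof (cases "a = -1")
  case True
  have "integral {1..R} (\<lambda>r. complex_of_real r powr a * complex_of_real (ln r) ^ l)
      = 1 / of_nat (Suc l) * complex_of_real R powr 0 * complex_of_real (ln R) ^ Suc l" if R: "R \<ge> 1" for R
  proof -
    have "((\<lambda>r. complex_of_real r powr a * complex_of_real (ln r) ^ l) has_integral
        complex_of_real (ln R ^ Suc l / real (Suc l)) - complex_of_real (ln 1 ^ Suc l / real (Suc l))) {1..R}"
    proof (rule fundamental_theorem_of_calculus[OF R])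
      fix x assume x: "x \<in> {1..R}"
      have "((\<lambda>r. ln r ^ Suc l / real (Suc l)) has_real_derivative (ln x ^ l * (1 / x))) (at x within {1..R})"
        using DERIV_cdivide[OF ln_power_has_derivative[of x l "{1..R}"], of "real (Suc l)"] x
        by (simp del: of_nat_Suc power_Suc)
      moreover have "complex_of_real x powr a = complex_of_real (1 / x)"
        using True x by (simp add: powr_minus inverse_eq_divide)
      ultimately show "((\<lambda>r. complex_of_real (ln r ^ Suc l / real (Suc l))) has_vector_derivative
          complex_of_real x powr a * complex_of_real (ln x) ^ l) (at x within {1..R})"
        using has_vector_derivative_of_real[where 'a = complex, of "\<lambda>r. ln r ^ Suc l / real (Suc l)" "ln x ^ l * (1 / x)" "at x within {1..R}"]
        by (simp add: has_real_derivative_iff_has_vector_derivative mult.commute)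
    qed
    then show ?thesis using R by (simp add: has_integral_iff)
  qed
  then show ?thesis using log_poly.monomial[OF V(1)] by (rule log_poly.cong[rotated])
next
  case False
  then have a: "a + 1 \<noteq> 0" by (metis add_eq_0_iff2)
  show ?thesis
  proof (induction l)
    case 0
    have "integral {1..R} (\<lambda>r. complex_of_real r powr a * complex_of_real (ln r) ^ 0)
      = 1 / (a + 1) * complex_of_real R powr (a + 1) + - 1 / (a + 1)" if R: "R \<ge> 1" for R
    proof -
      have "((\<lambda>r. complex_of_real r powr a * complex_of_real (ln r) ^ 0) has_integral
         1 / (a + 1) * complex_of_real R powr (a + 1) - 1 / (a + 1) * complex_of_real 1 powr (a + 1)) {1..R}"
      proof (rule fundamental_theorem_of_calculus[OF R])
        fix x assume x: "x \<in> {1..R}"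
        show "((\<lambda>r. 1 / (a + 1) * complex_of_real r powr (a + 1)) has_vector_derivative
           complex_of_real x powr a * complex_of_real (ln x) ^ 0) (at x within {1..R})"
          using has_vector_derivative_mult_right[OF powr_has_vector_derivative[of x "a + 1" "{1..R}"], of "1 / (a + 1)"] x a
          by simp
      qed
      then show ?thesis by (simp add: has_integral_iff)
    qed
    moreover have "log_poly V (\<lambda>R. 1 / (a + 1) * complex_of_real R powr (a + 1) + - 1 / (a + 1))"
      using V by (intro log_poly.add log_poly_term0 log_poly_const)
    ultimately show ?case by (rule log_poly.cong[rotated])
  next
    case (Suc l)
    have "integral {1..R} (\<lambda>r. complex_of_real r powr a * complex_of_real (ln r) ^ Suc l)
      = 1 / (a + 1) * complex_of_real R powr (a + 1) * complex_of_real (ln R) ^ Suc l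
        + - of_nat (Suc l) / (a + 1) * integral {1..R} (\<lambda>r. complex_of_real r powr a * complex_of_real (ln r) ^ l)"
      if R: "R \<ge> 1" for R
    proof -
      let ?G = "\<lambda>r. 1 / (a + 1) * complex_of_real r powr (a + 1) * complex_of_real (ln r ^ Suc l)"
      let ?h = "\<lambda>l r. complex_of_real r powr a * complex_of_real (ln r) ^ l"
      have hi: "?h l integrable_on {1..R}" for l
        by (rule integrable_continuous_real, rule continuous_on_subset[of "{1..}"])
          (auto intro!: continuous_intros continuous_on_powr_of_real)
      have "((\<lambda>r. ?h (Suc l) r + of_nat (Suc l) / (a + 1) * ?h l r) has_integral ?G R - ?G 1) {1..R}"
      proof (rule fundamental_theorem_of_calculus[OF R])
        fix x assume x: "x \<in> {1..R}"
        have 1: "((\<lambda>r. 1 / (a + 1) * complex_of_real r powr (a + 1)) has_vector_derivative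
           complex_of_real x powr a) (at x within {1..R})"
          using has_vector_derivative_mult_right[OF powr_has_vector_derivative[of x "a + 1" "{1..R}"], of "1 / (a + 1)"] x a
          by simp
        have "((\<lambda>r. ln r ^ Suc l) has_real_derivative (real (Suc l) * ln x ^ l * (1 / x))) (at x within {1..R})"
          using x by (intro ln_power_has_derivative) auto
        then have 2: "((\<lambda>r. complex_of_real (ln r ^ Suc l)) has_vector_derivative
            complex_of_real (real (Suc l) * ln x ^ l * (1 / x))) (at x within {1..R})"
          by (intro has_vector_derivative_of_real) (simp add: has_real_derivative_iff_has_vector_derivative)
        have px: "complex_of_real x powr (a + 1) = complex_of_real x powr a * complex_of_real x"
          using x by (simp add: powr_add)
        have "1 / (a + 1) * complex_of_real x powr (a + 1) * complex_of_real (real (Suc l) * ln x ^ l * (1 / x))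
            + complex_of_real x powr a * complex_of_real (ln x ^ Suc l)
            = ?h (Suc l) x + of_nat (Suc l) / (a + 1) * ?h l x"
        proof -
          have gen: "1 / c * (w * u) * (n * L * (1 / u)) + w * M = w * M + n / c * (w * L)"
            if "c \<noteq> 0" "u \<noteq> 0" for c u w n L M :: complex
            using that by (simp add: field_simps)
          show ?thesis
            unfolding px using gen[OF a, of "complex_of_real x"] x by (simp del: of_nat_Suc)
        qed
        with has_vector_derivative_mult[OF 1 2]
        show "(?G has_vector_derivative ?h (Suc l) x + of_nat (Suc l) / (a + 1) * ?h l x) (at x within {1..R})"
          by (simp only:)
      qed
      then have "integral {1..R} (\<lambda>r. ?h (Suc l) r + of_nat (Suc l) / (a + 1) * ?h l r) = ?G R"
        by (simp add: has_integral_iff)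
      moreover have "integral {1..R} (\<lambda>r. ?h (Suc l) r + of_nat (Suc l) / (a + 1) * ?h l r)
         = integral {1..R} (?h (Suc l)) + of_nat (Suc l) / (a + 1) * integral {1..R} (?h l)"
        using Henstock_Kurzweil_Integration.integral_add[OF hi[of "Suc l"]
            integrable_on_mult_right[OF hi[of l], of "of_nat (Suc l) / (a + 1)"]]
        by (simp only: integral_mult_right)
      ultimately have "integral {1..R} (?h (Suc l)) = ?G R - of_nat (Suc l) / (a + 1) * integral {1..R} (?h l)"
        by (simp only: eq_diff_eq)
      then show ?thesis
        by (simp only: of_real_power minus_divide_left[symmetric] mult_minus_left diff_conv_add_uminus)
    qed
    moreover have "log_poly V (\<lambda>R. 1 / (a + 1) * complex_of_real R powr (a + 1) * complex_of_real (ln R) ^ Suc l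
        + - of_nat (Suc l) / (a + 1) * integral {1..R} (\<lambda>r. complex_of_real r powr a * complex_of_real (ln r) ^ l))"
      using V Suc by (intro log_poly.add log_poly_cmult log_poly.monomial)
    ultimately show ?case by (rule log_poly.cong[rotated])
  qed
qed

lemma log_poly_integral:
  assumes "log_poly S f" and V: "0 \<in> V" "\<And>a. a \<in> S \<Longrightarrow> a + 1 \<in> V"
  shows "log_poly V (\<lambda>R. integral {1..R} f)"
  using assms(1)
proof (induction rule: log_poly.induct)
  case zero
  show ?case by (simp add: log_poly.zero)
next
  case (monomial a c l)
  have "integral {1..R} (\<lambda>R. c * complex_of_real R powr a * complex_of_real (ln R) ^ l)
     = c * integral {1..R} (\<lambda>r. complex_of_real r powr a * complex_of_real (ln r) ^ l)" for R
    by (simp add: mult.assoc)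
  then show ?case using log_poly_cmult[OF log_poly_integral_term[OF V(1) V(2)[OF monomial]]] by simp
next
  case (add f g)
  have int: "f integrable_on {1..R}" "g integrable_on {1..R}" for R
    using add.hyps
    by (auto intro!: integrable_continuous_real intro: continuous_on_subset[OF log_poly_continuous])
  show ?case
    using log_poly.add[OF add.IH] by (simp add: Henstock_Kurzweil_Integration.integral_add[OF int])
next
  case (cong f g)
  have "integral {1..R} g = integral {1..R} f" for R
    by (rule integral_cong) (use cong.hyps in auto)
  with cong.IH show ?case by simp
qed

text \<open>The approximant may change with the required order N, so S may be infinite; it only
  confines the exponents. An expansion of \<open>F R - c\<close> over a set S with
  \<open>0 \<notin> S\<close> is how the development says that c is the constant term of F.\<close>

definition log_expansion :: "complex set \<Rightarrow> (real \<Rightarrow> complex) \<Rightarrow> bool" where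
  "log_expansion S f \<longleftrightarrow> (\<forall>N::real. \<exists>p C. log_poly S p \<and> C \<ge> 0 \<and>
     (\<forall>R\<ge>1. norm (f R - p R) \<le> C * R powr (- N)))"

lemma log_expansionE:
  assumes "log_expansion S f"
  obtains p C where "log_poly S p" "C \<ge> 0" "\<And>R. R \<ge> 1 \<Longrightarrow> norm (f R - p R) \<le> C * R powr (- N)"
  using assms unfolding log_expansion_def by blast

lemma log_expansion_mono: "log_expansion S f \<Longrightarrow> S \<subseteq> T \<Longrightarrow> log_expansion T f"
  unfolding log_expansion_def using log_poly_mono by blast

lemma log_expansion_cong: "log_expansion S f \<Longrightarrow> (\<And>R. R \<ge> 1 \<Longrightarrow> g R = f R) \<Longrightarrow> log_expansion S g"
  unfolding log_expansion_def by simp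

lemma log_expansion_log_poly: "log_poly S p \<Longrightarrow> log_expansion S p"
  unfolding log_expansion_def by (intro allI exI[of _ p] exI[of _ 0]) simp

lemma log_expansion_add:
  assumes "log_expansion S f" "log_expansion S g"
  shows "log_expansion S (\<lambda>R. f R + g R)"
  unfolding log_expansion_def
proof
  fix N :: real
  obtain p C where p: "log_poly S p" "C \<ge> 0" "\<And>R. R \<ge> 1 \<Longrightarrow> norm (f R - p R) \<le> C * R powr (- N)"
    using log_expansionE[OF assms(1)] by blast
  obtain q D where q: "log_poly S q" "D \<ge> 0" "\<And>R. R \<ge> 1 \<Longrightarrow> norm (g R - q R) \<le> D * R powr (- N)"
    using log_expansionE[OF assms(2)] by blast
  have "norm (f R + g R - (p R + q R)) \<le> (C + D) * R powr (- N)" if "R \<ge> 1" for R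
    using norm_triangle_ineq[of "f R - p R" "g R - q R"] p(3)[OF that] q(3)[OF that]
    by (simp add: algebra_simps)
  with p q show "\<exists>p C. log_poly S p \<and> C \<ge> 0 \<and> (\<forall>R\<ge>1. norm (f R + g R - p R) \<le> C * R powr (- N))"
    by (intro exI[of _ "\<lambda>R. p R + q R"] exI[of _ "C + D"]) (auto intro: log_poly.add)
qed

lemma log_expansion_bound:
  assumes "log_expansion S f"
  shows "\<exists>C M. C \<ge> 0 \<and> (\<forall>R\<ge>1. norm (f R) \<le> C * R powr M)"
proof -
  obtain p C where p: "log_poly S p" "C \<ge> 0" "\<And>R. R \<ge> 1 \<Longrightarrow> norm (f R - p R) \<le> C * R powr (- 0)"
    using log_expansionE[OF assms] by blast
  obtain D M where D: "D \<ge> 0" "\<forall>R\<ge>1. norm (p R) \<le> D * R powr M" using log_poly_bound[OF p(1)] by blast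
  have "norm (f R) \<le> (C + D) * R powr (max M 0)" if R: "R \<ge> 1" for R
  proof -
    have "norm (f R) \<le> norm (f R - p R) + norm (p R)" by (metis diff_add_cancel norm_triangle_ineq)
    also have "\<dots> \<le> C * R powr 0 + D * R powr M" using p(3) D R by (intro add_mono) auto
    also have "\<dots> \<le> C * R powr (max M 0) + D * R powr (max M 0)"
      using p D R by (intro add_mono mult_left_mono powr_mono) auto
    finally show ?thesis by (simp add: algebra_simps)
  qed
  then show ?thesis using p D by (intro exI[of _ "C + D"] exI[of _ "max M 0"]) auto
qed

text \<open>From f g - p q = (f - p) g + p (g - q): to reach order N, f is expanded to order N plus
  the growth exponent of g, and then g to order N plus the growth exponent of the chosen p.\<close>

lemma log_expansion_mult:
  assumes f: "log_expansion S f" and g: "log_expansion T g" and V: "\<And>a b. a \<in> S \<Longrightarrow> b \<in> T \<Longrightarrow> a + b \<in> V"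
  shows "log_expansion V (\<lambda>R. f R * g R)"
  unfolding log_expansion_def
proof
  fix N :: real
  obtain G M where G: "G \<ge> 0" "\<forall>R\<ge>1. norm (g R) \<le> G * R powr M"
    using log_expansion_bound[OF g] by blast
  obtain p C where p: "log_poly S p" "C \<ge> 0" "\<And>R. R \<ge> 1 \<Longrightarrow> norm (f R - p R) \<le> C * R powr (- (N + M))"
    using log_expansionE[OF f] by blast
  obtain P L where P: "P \<ge> 0" "\<forall>R\<ge>1. norm (p R) \<le> P * R powr L"
    using log_poly_bound[OF p(1)] by blast
  obtain q D where q: "log_poly T q" "D \<ge> 0" "\<And>R. R \<ge> 1 \<Longrightarrow> norm (g R - q R) \<le> D * R powr (- (N + L))"
    using log_expansionE[OF g] by blast
  have "norm (f R * g R - p R * q R) \<le> (C * G + P * D) * R powr (- N)" if R: "R \<ge> 1" for R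
  proof -
    have "norm (f R * g R - p R * q R) = norm ((f R - p R) * g R + p R * (g R - q R))"
      by (simp add: algebra_simps)
    also have "\<dots> \<le> norm (f R - p R) * norm (g R) + norm (p R) * norm (g R - q R)"
      by (metis norm_mult norm_triangle_ineq)
    also have "\<dots> \<le> (C * R powr (- (N + M))) * (G * R powr M) + (P * R powr L) * (D * R powr (- (N + L)))"
      using p q G P R by (intro add_mono mult_mono) auto
    also have "\<dots> = (C * G) * R powr (- (N + M) + M) + (P * D) * R powr (L + - (N + L))"
      unfolding powr_add by (simp add: mult_ac)
    finally show ?thesis by (simp add: algebra_simps)
  qed
  then show "\<exists>p C. log_poly V p \<and> C \<ge> 0 \<and> (\<forall>R\<ge>1. norm (f R * g R - p R) \<le> C * R powr (- N))"
    using p q G P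
    by (intro exI[of _ "\<lambda>R. p R * q R"] exI[of _ "C * G + P * D"]) (auto intro: log_poly_mult V)
qed

lemma log_expansion_cmult: "log_expansion S f \<Longrightarrow> log_expansion S (\<lambda>R. c * f R)"
  by (rule log_expansion_mult[OF log_expansion_log_poly[OF log_poly_const[of "{0}"]]]) auto

lemma log_expansion_zero: "log_expansion S (\<lambda>R. 0)"
  by (rule log_expansion_log_poly[OF log_poly.zero])

lemma log_expansion_sum:
  "finite I \<Longrightarrow> (\<And>i. i \<in> I \<Longrightarrow> log_expansion S (f i)) \<Longrightarrow> log_expansion S (\<lambda>R. \<Sum>i\<in>I. f i R)"
  by (induction rule: finite_induct) (auto intro: log_expansion_zero log_expansion_add)

lemma integral_from_zero_split:
  fixes f :: "real \<Rightarrow> complex"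
  assumes "continuous_on {0..} f" and "R \<ge> 1"
  shows "integral {0..R} f = integral {0..1} f + integral {1..R} f"
  by (rule Henstock_Kurzweil_Integration.integral_combine[symmetric])
    (use assms in \<open>auto intro!: integrable_continuous_real intro: continuous_on_subset[OF assms(1)]\<close>)

lemma log_expansion_integral:
  assumes cont: "continuous_on {0..} f" and f: "log_expansion S f"
    and V: "0 \<in> V" "\<And>a. a \<in> S \<Longrightarrow> a + 1 \<in> V"
  shows "log_expansion V (\<lambda>R. integral {0..R} f)"
  unfolding log_expansion_def
proof
  fix N :: real
  \<comment> \<open>The maximum with 1 keeps e negative even if N is not positive, so that the
    remainder, of order e - 1, has a convergent tail integral. The limit of that integral enters as
    a constant, and the rest is of order e \<le> - N.\<close>
  define e where "e = - (max N 1)"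
  have e: "e < 0" "e \<le> - N" by (auto simp: e_def)
  obtain p C where p: "log_poly S p" "C \<ge> 0" "\<And>R. R \<ge> 1 \<Longrightarrow> norm (f R - p R) \<le> C * R powr (- (1 - e))"
    using log_expansionE[OF f] by blast
  have cf: "continuous_on {1..} f" using cont by (rule continuous_on_subset) auto
  note cp = log_poly_continuous[OF p(1)]
  have "\<exists>L. \<forall>R\<ge>1. norm (integral {1..R} (\<lambda>R. f R - p R) - L) \<le> C / (-e) * R powr e"
    by (rule integral_tail_limit) (use p(3) e cf cp in \<open>auto intro!: continuous_intros\<close>)
  then obtain L where L: "\<And>R. R \<ge> 1 \<Longrightarrow> norm (integral {1..R} (\<lambda>R. f R - p R) - L) \<le> C / (-e) * R powr e" by blast
  have "norm (integral {0..R} f - (integral {0..1} f + L + integral {1..R} p)) \<le> C / (-e) * R powr (- N)"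
    if R: "R \<ge> 1" for R
  proof -
    have "integral {1..R} (\<lambda>R. f R - p R) = integral {1..R} f - integral {1..R} p"
      by (rule integral_diff)
        (auto intro!: integrable_continuous_real intro: continuous_on_subset[OF cf] continuous_on_subset[OF cp])
    with integral_from_zero_split[OF cont R]
    have "integral {0..R} f - (integral {0..1} f + L + integral {1..R} p)
       = integral {1..R} (\<lambda>R. f R - p R) - L" by simp
    then have "norm (integral {0..R} f - (integral {0..1} f + L + integral {1..R} p)) \<le> C / (-e) * R powr e"
      using L[OF R] by (simp only:)
    also have "\<dots> \<le> C / (-e) * R powr (- N)"
      using p e R by (intro mult_left_mono powr_mono divide_nonneg_pos) auto
    finally show ?thesis .
  qed
  moreover have "log_poly V (\<lambda>R. integral {0..1} f + L + integral {1..R} p)"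
    using V by (intro log_poly.add log_poly_const log_poly_integral[OF p(1)]) auto
  moreover have "C / (-e) \<ge> 0" using p e by (intro divide_nonneg_pos) auto
  ultimately show "\<exists>p C. log_poly V p \<and> C \<ge> 0 \<and> (\<forall>R\<ge>1. norm (integral {0..R} f - p R) \<le> C * R powr (- N))"
    by (intro exI[of _ "\<lambda>R. integral {0..1} f + L + integral {1..R} p"] exI[of _ "C / (-e)"]) auto
qed

lemma log_expansion_limit_form:
  assumes "log_expansion S (\<lambda>R. F R - c)" and S: "0 \<notin> S"
  shows "\<exists>A coef. finite A \<and> (0, 0) \<notin> A \<and>
     ((\<lambda>R::real. F R - (\<Sum>(a, l)\<in>A. coef (a, l) * complex_of_real R powr a * (complex_of_real (ln R)) ^ l) - c)
      \<longlongrightarrow> 0) at_top"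
proof -
  obtain p C where p: "log_poly S p" "C \<ge> 0" "\<And>R. R \<ge> 1 \<Longrightarrow> norm (F R - c - p R) \<le> C * R powr (- 1)"
    using log_expansionE[OF assms(1)] by blast
  from log_poly_finite_form[OF p(1)] obtain A coef where A: "finite A" "A \<subseteq> S \<times> UNIV"
    "\<forall>R\<ge>1. p R = (\<Sum>(a, l)\<in>A. coef (a, l) * complex_of_real R powr a * complex_of_real (ln R) ^ l)" by blast
  have "((\<lambda>R::real. F R - (\<Sum>(a, l)\<in>A. coef (a, l) * complex_of_real R powr a * (complex_of_real (ln R)) ^ l) - c)
      \<longlongrightarrow> 0) at_top"
  proof (rule Lim_null_comparison)
    show "\<forall>\<^sub>F R in at_top. norm (F R - (\<Sum>(a, l)\<in>A. coef (a, l) * complex_of_real R powr a * (complex_of_real (ln R)) ^ l) - c)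
        \<le> C * R powr (-1)"
      using eventually_ge_at_top[of 1]
    proof eventually_elim
      case (elim R)
      then show ?case using p(3)[OF elim] A(3) by (simp add: algebra_simps)
    qed
    have "((\<lambda>R::real. C * R powr (-1)) \<longlongrightarrow> C * 0) at_top"
      by (intro tendsto_mult tendsto_const tendsto_neg_powr filterlim_ident) auto
    then show "((\<lambda>R::real. C * R powr (-1)) \<longlongrightarrow> 0) at_top" by simp
  qed
  with A S show ?thesis by (intro exI[of _ A] exI[of _ coef]) auto
qed

lemma log_expansion_constant_unique:
  assumes "log_expansion S (\<lambda>R. F R - c)" "0 \<notin> S" "log_expansion T (\<lambda>R. F R - d)" "0 \<notin> T"
  shows "c = d"
proof -
  obtain A coef where 1: "finite A" "(0, 0) \<notin> A" "((\<lambda>R. F R -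
      (\<Sum>(a, l)\<in>A. coef (a, l) * complex_of_real R powr a * complex_of_real (ln R) ^ l) - c) \<longlongrightarrow> 0) at_top"
    using log_expansion_limit_form[OF assms(1,2)] by (elim exE conjE)
  obtain B coef' where 2: "finite B" "(0, 0) \<notin> B" "((\<lambda>R. F R -
      (\<Sum>(a, l)\<in>B. coef' (a, l) * complex_of_real R powr a * complex_of_real (ln R) ^ l) - d) \<longlongrightarrow> 0) at_top"
    using log_expansion_limit_form[OF assms(3,4)] by (elim exE conjE)
  show ?thesis by (rule log_sum_constant_unique[OF 1(1,2) 2(1,2) 1(3) 2(3)])
qed

lemma cutoff_int_eqI:
  assumes "log_expansion S (\<lambda>R. integral (cball 0 R) f - c)" and "0 \<notin> S"
  shows "cutoff_int f = c"
  unfolding cutoff_int_def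
proof (rule the_equality)
  from log_expansion_limit_form[OF assms]
  show "\<exists>A coef. finite A \<and> (0, 0) \<notin> A \<and> ((\<lambda>R. integral (cball 0 R) f -
      (\<Sum>(a, l)\<in>A. coef (a, l) * complex_of_real R powr a * complex_of_real (ln R) ^ l) - c) \<longlongrightarrow> 0) at_top" .
  then obtain A coef where 1: "finite A" "(0, 0) \<notin> A" "((\<lambda>R. integral (cball 0 R) f -
      (\<Sum>(a, l)\<in>A. coef (a, l) * complex_of_real R powr a * complex_of_real (ln R) ^ l) - c) \<longlongrightarrow> 0) at_top"
    by (elim exE conjE)
  fix d
  assume "\<exists>A coef. finite A \<and> (0, 0) \<notin> A \<and> ((\<lambda>R. integral (cball 0 R) f -
      (\<Sum>(a, l)\<in>A. coef (a, l) * complex_of_real R powr a * complex_of_real (ln R) ^ l) - d) \<longlongrightarrow> 0) at_top"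
  then obtain B coef' where 2: "finite B" "(0, 0) \<notin> B" "((\<lambda>R. integral (cball 0 R) f -
      (\<Sum>(a, l)\<in>B. coef' (a, l) * complex_of_real R powr a * complex_of_real (ln R) ^ l) - d) \<longlongrightarrow> 0) at_top"
    by (elim exE conjE)
  show "d = c" by (rule log_sum_constant_unique[OF 2(1,2) 1(1,2) 2(3) 1(3)])
qed

section \<open>Holomorphic families of polyhomogeneous functions\<close>

definition unif_bound :: "complex set \<Rightarrow> (complex \<Rightarrow> real) \<Rightarrow> (complex \<Rightarrow> real \<Rightarrow> complex) \<Rightarrow> bool" where
  "unif_bound Z e f \<longleftrightarrow> (\<exists>C\<ge>0. \<forall>z\<in>Z. \<forall>r\<ge>1. norm (f z r) \<le> C * r powr e z)"

lemma unif_boundI: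
  assumes "\<And>z r. z \<in> Z \<Longrightarrow> r \<ge> 1 \<Longrightarrow> norm (f z r) \<le> C * r powr e z"
  shows "unif_bound Z e f"
  unfolding unif_bound_def
proof (intro exI[of _ "max C 0"] conjI ballI allI impI)
  fix z r assume z: "z \<in> Z" "(r::real) \<ge> 1"
  have "C * r powr e z \<le> max C 0 * r powr e z" by (intro mult_right_mono) auto
  with assms[OF z] show "norm (f z r) \<le> max C 0 * r powr e z" by simp
qed simp

lemma unif_boundE:
  assumes "unif_bound Z e f"
  obtains C where "C \<ge> 0" "\<And>z r. z \<in> Z \<Longrightarrow> r \<ge> 1 \<Longrightarrow> norm (f z r) \<le> C * r powr e z"
  using assms unfolding unif_bound_def by blast

lemma unif_bound_cong:
  "unif_bound Z e f \<Longrightarrow> (\<And>z r. z \<in> Z \<Longrightarrow> r \<ge> 1 \<Longrightarrow> g z r = f z r) \<Longrightarrow> (\<And>z. z \<in> Z \<Longrightarrow> d z = e z)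
    \<Longrightarrow> unif_bound Z d g"
  unfolding unif_bound_def by simp

lemma unif_bound_mono:
  assumes "unif_bound Z e f" "\<And>z. z \<in> Z \<Longrightarrow> e z \<le> d z"
  shows "unif_bound Z d f"
proof -
  obtain C where C: "C \<ge> 0" "\<And>z r. z \<in> Z \<Longrightarrow> r \<ge> 1 \<Longrightarrow> norm (f z r) \<le> C * r powr e z"
    using unif_boundE[OF assms(1)] by blast
  show ?thesis
  proof (rule unif_boundI)
    fix z r assume z: "z \<in> Z" "(r::real) \<ge> 1"
    have "C * r powr e z \<le> C * r powr d z" using C z assms(2) by (intro mult_left_mono powr_mono) auto
    with C(2)[OF z] show "norm (f z r) \<le> C * r powr d z" by simp
  qed
qed

lemma unif_bound_add:
  assumes "unif_bound Z e f" "unif_bound Z e g"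
  shows "unif_bound Z e (\<lambda>z r. f z r + g z r)"
proof -
  obtain C where C: "C \<ge> 0" "\<And>z r. z \<in> Z \<Longrightarrow> r \<ge> 1 \<Longrightarrow> norm (f z r) \<le> C * r powr e z"
    using unif_boundE[OF assms(1)] by blast
  obtain D where D: "D \<ge> 0" "\<And>z r. z \<in> Z \<Longrightarrow> r \<ge> 1 \<Longrightarrow> norm (g z r) \<le> D * r powr e z"
    using unif_boundE[OF assms(2)] by blast
  show ?thesis
  proof (rule unif_boundI)
    fix z r assume z: "z \<in> Z" "(r::real) \<ge> 1"
    show "norm (f z r + g z r) \<le> (C + D) * r powr e z"
      using norm_triangle_ineq[of "f z r" "g z r"] C(2)[OF z] D(2)[OF z] by (simp add: algebra_simps)
  qed
qed

lemma unif_bound_mult: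
  assumes "unif_bound Z e f" "unif_bound Z d g"
  shows "unif_bound Z (\<lambda>z. e z + d z) (\<lambda>z r. f z r * g z r)"
proof -
  obtain C where C: "C \<ge> 0" "\<And>z r. z \<in> Z \<Longrightarrow> r \<ge> 1 \<Longrightarrow> norm (f z r) \<le> C * r powr e z"
    using unif_boundE[OF assms(1)] by blast
  obtain D where D: "D \<ge> 0" "\<And>z r. z \<in> Z \<Longrightarrow> r \<ge> 1 \<Longrightarrow> norm (g z r) \<le> D * r powr d z"
    using unif_boundE[OF assms(2)] by blast
  show ?thesis
  proof (rule unif_boundI)
    fix z r assume z: "z \<in> Z" "(r::real) \<ge> 1"
    have "norm (f z r * g z r) \<le> (C * r powr e z) * (D * r powr d z)"
      unfolding norm_mult using C D z by (intro mult_mono) auto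
    then show "norm (f z r * g z r) \<le> (C * D) * r powr (e z + d z)"
      by (simp add: powr_add mult_ac)
  qed
qed

lemma unif_bound_sum:
  "finite I \<Longrightarrow> (\<And>i. i \<in> I \<Longrightarrow> unif_bound Z e (f i)) \<Longrightarrow> unif_bound Z e (\<lambda>z r. \<Sum>i\<in>I. f i z r)"
proof (induction rule: finite_induct)
  case empty
  show ?case by (rule unif_boundI[of _ _ 0]) simp
qed (auto intro: unif_bound_add)

lemma compact_holomorphic_bound:
  assumes "compact Z" "Z \<subseteq> \<Omega>" "c holomorphic_on \<Omega>"
  obtains B where "B \<ge> 0" "\<And>z. z \<in> Z \<Longrightarrow> norm (c z) \<le> B"
proof -
  have "continuous_on Z c" using assms holomorphic_on_imp_continuous_on continuous_on_subset by blast
  then have "compact (c ` Z)" using assms compact_continuous_image by blast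
  then obtain B where "\<And>z. z \<in> Z \<Longrightarrow> norm (c z) \<le> B" by (meson bounded_iff compact_imp_bounded imageI)
  then show ?thesis using that[of "max B 0"] by (meson max.cobounded1 max.cobounded2 order_trans)
qed

lemma unif_bound_term:
  assumes "compact Z" "Z \<subseteq> \<Omega>" "c holomorphic_on \<Omega>"
  shows "unif_bound Z (\<lambda>z. Re (b z)) (\<lambda>z r. c z * complex_of_real r powr b z)"
proof -
  obtain B where B: "B \<ge> 0" "\<And>z. z \<in> Z \<Longrightarrow> norm (c z) \<le> B" using compact_holomorphic_bound[OF assms] by blast
  show ?thesis
  proof (rule unif_boundI)
    fix z r assume z: "z \<in> Z" "(r::real) \<ge> 1"
    show "norm (c z * complex_of_real r powr b z) \<le> B * r powr Re (b z)"
      using B z by (simp add: norm_mult norm_powr_of_real mult_right_mono)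
  qed
qed

definition expands :: "complex set \<Rightarrow> (complex \<Rightarrow> complex) \<Rightarrow> (nat \<Rightarrow> complex \<Rightarrow> complex) \<Rightarrow> (complex \<Rightarrow> real \<Rightarrow> complex) \<Rightarrow> nat \<Rightarrow> bool" where
  "expands Z b c g N \<longleftrightarrow> unif_bound Z (\<lambda>z. Re (b z) - real N)
     (\<lambda>z r. g z r - (\<Sum>m<N. c m z * complex_of_real r powr (b z - of_nat m)))"

text \<open>The terms between N and N' are themselves of order Re b - N, so they can be moved into
  the remainder. This allows \<open>phg_integral\<close> to establish its expansion for large orders
  only, where the tail integrals converge.\<close>

lemma expands_lower:
  assumes "expands Z b c g N'" "N \<le> N'" and Z: "compact Z" "Z \<subseteq> \<Omega>" and c: "\<And>m. c m holomorphic_on \<Omega>"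
  shows "expands Z b c g N"
proof -
  let ?t = "\<lambda>m z r. c m z * complex_of_real r powr (b z - of_nat m)"
  have "unif_bound Z (\<lambda>z. Re (b z) - real N) (\<lambda>z r. \<Sum>m\<in>{N..<N'}. ?t m z r)"
  proof (rule unif_bound_sum)
    fix m assume m: "m \<in> {N..<N'}"
    show "unif_bound Z (\<lambda>z. Re (b z) - real N) (?t m)"
      by (rule unif_bound_mono[OF unif_bound_term[OF Z c]]) (use m in auto)
  qed simp
  moreover have "unif_bound Z (\<lambda>z. Re (b z) - real N) (\<lambda>z r. g z r - (\<Sum>m<N'. ?t m z r))"
    using assms(1) unfolding expands_def by (rule unif_bound_mono) (use assms(2) in auto)
  ultimately have "unif_bound Z (\<lambda>z. Re (b z) - real N)
     (\<lambda>z r. (g z r - (\<Sum>m<N'. ?t m z r)) + (\<Sum>m\<in>{N..<N'}. ?t m z r))" by (intro unif_bound_add)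
  moreover have "(\<Sum>m<N'. ?t m z r) = (\<Sum>m<N. ?t m z r) + (\<Sum>m\<in>{N..<N'}. ?t m z r)" for z r
    using assms(2) by (metis (no_types, lifting) atLeast0LessThan le0 sum.atLeastLessThan_concat)
  ultimately show ?thesis unfolding expands_def by simp
qed

text \<open>Holomorphic families of functions on the half line with an expansion in the powers b z -
  m, without logarithms, whose coefficients are holomorphic and whose remainders are locally uniform
  in z. The bound on {0..1} supplements the expansion, which starts at r = 1; together they bound
  the family on every {0..T}, as holomorphy of its integrals requires.\<close>

definition phg :: "complex set \<Rightarrow> (complex \<Rightarrow> complex) \<Rightarrow> (complex \<Rightarrow> real \<Rightarrow> complex) \<Rightarrow> bool" where
  "phg \<Omega> b g \<longleftrightarrow> b holomorphic_on \<Omega> \<and> (\<forall>z\<in>\<Omega>. continuous_on {0..} (g z)) \<and>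
     (\<forall>r\<ge>0. (\<lambda>z. g z r) holomorphic_on \<Omega>) \<and>
     (\<forall>Z. compact Z \<and> Z \<subseteq> \<Omega> \<longrightarrow> (\<exists>C. \<forall>z\<in>Z. \<forall>r\<in>{0..1}. norm (g z r) \<le> C)) \<and>
     (\<exists>c. (\<forall>m. c m holomorphic_on \<Omega>) \<and> (\<forall>Z N. compact Z \<and> Z \<subseteq> \<Omega> \<longrightarrow> expands Z b c g N))"

lemma phg_subset: "phg \<Omega> b g \<Longrightarrow> \<Omega>' \<subseteq> \<Omega> \<Longrightarrow> phg \<Omega>' b g"
  unfolding phg_def by (meson holomorphic_on_subset order_trans subsetD)

text \<open>The starting value of the recursion in \<open>nested_family\<close>: before any
  integration the accumulated outer factor is 1, with exponent 0.\<close>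

lemma phg_one: "phg \<Omega> (\<lambda>z. 0) (\<lambda>z r. 1)"
proof -
  have "expands Z (\<lambda>z. 0) (\<lambda>m z. if m = 0 then 1 else 0) (\<lambda>z r. 1) N" for Z N
  proof (cases "N = 0")
    case True
    then show ?thesis unfolding expands_def by (intro unif_boundI[of _ _ 1]) simp
  next
    case False
    have "(\<Sum>m<N. (if m = 0 then 1 else 0) * complex_of_real r powr (0 - of_nat m)) = 1" if "r \<ge> 1" for r
      using that False by (simp add: if_distrib[of "\<lambda>a. a * b" for b] cong: if_cong)
    then show ?thesis unfolding expands_def by (intro unif_boundI[of _ _ 0]) simp
  qed
  then show ?thesis unfolding phg_def
    by (intro conjI ballI allI impI exI[of _ 1] exI[of _ "\<lambda>m z. if m = 0 then 1 else 0"])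
      (auto intro!: holomorphic_intros)
qed

lemma phg_unif_bound:
  assumes "phg \<Omega> b g" "compact Z" "Z \<subseteq> \<Omega>"
  shows "unif_bound Z (\<lambda>z. Re (b z)) g"
proof -
  from assms obtain c where "expands Z b c g 0" unfolding phg_def by meson
  then show ?thesis by (simp add: expands_def)
qed

lemma phg_bounded:
  assumes g: "phg \<Omega> b g" and Z: "compact Z" "Z \<subseteq> \<Omega>"
  shows "\<exists>M. \<forall>z\<in>Z. \<forall>r\<in>{0..T}. norm (g z r) \<le> M"
proof -
  have bh: "b holomorphic_on \<Omega>" using g by (simp add: phg_def)
  obtain C where C: "\<forall>z\<in>Z. \<forall>r\<in>{0..1}. norm (g z r) \<le> C" using g Z unfolding phg_def by meson
  obtain D where D: "D \<ge> 0" "\<And>z r. z \<in> Z \<Longrightarrow> r \<ge> 1 \<Longrightarrow> norm (g z r) \<le> D * r powr Re (b z)"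
    using unif_boundE[OF phg_unif_bound[OF assms]] by blast
  obtain B where B: "B \<ge> 0" "\<And>z. z \<in> Z \<Longrightarrow> norm (b z) \<le> B"
    using compact_holomorphic_bound[OF Z bh] by blast
  have "norm (g z r) \<le> max C (D * T powr B)" if z: "z \<in> Z" and r: "r \<in> {0..T}" for z r
  proof (cases "r \<le> 1")
    case True
    then show ?thesis using C z r by (auto intro: order_trans[OF _ max.cobounded1])
  next
    case False
    have "Re (b z) \<le> B" using B(2)[OF z] complex_Re_le_cmod[of "b z"] by linarith
    have "norm (g z r) \<le> D * r powr Re (b z)" using D(2)[OF z] False by auto
    also have "\<dots> \<le> D * r powr B" using D False \<open>Re (b z) \<le> B\<close> by (intro mult_left_mono powr_mono) auto
    also have "\<dots> \<le> D * T powr B" using D B False r by (intro mult_left_mono powr_mono2) auto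
    finally show ?thesis by simp
  qed
  then show ?thesis by blast
qed

text \<open>The coefficients form the Cauchy product. In the remainder, the i-th term of f is paired
  with g truncated at N - i, not at N, so that every pair has the order b + d - N and the main terms
  fill exactly the triangle i + j < N.\<close>

lemma phg_mult:
  assumes f: "phg \<Omega> b f" and g: "phg \<Omega> d g"
  shows "phg \<Omega> (\<lambda>z. b z + d z) (\<lambda>z r. f z r * g z r)"
proof -
  from f obtain c where c: "\<And>m. c m holomorphic_on \<Omega>" "\<And>Z N. compact Z \<Longrightarrow> Z \<subseteq> \<Omega> \<Longrightarrow> expands Z b c f N"
    unfolding phg_def by meson
  from g obtain c' where c': "\<And>m. c' m holomorphic_on \<Omega>" "\<And>Z N. compact Z \<Longrightarrow> Z \<subseteq> \<Omega> \<Longrightarrow> expands Z d c' g N"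
    unfolding phg_def by meson
  define k where "k m z = (\<Sum>i\<le>m. c i z * c' (m - i) z)" for m z
  have k: "k m holomorphic_on \<Omega>" for m
  proof -
    have "(\<lambda>z. \<Sum>i\<le>m. c i z * c' (m - i) z) holomorphic_on \<Omega>" by (intro holomorphic_intros c c')
    then show ?thesis by (simp add: k_def[abs_def])
  qed
  have ex: "expands Z (\<lambda>z. b z + d z) k (\<lambda>z r. f z r * g z r) N" if Z: "compact Z" "Z \<subseteq> \<Omega>" for Z N
  proof -
    let ?t = "\<lambda>m z r. c m z * complex_of_real r powr (b z - of_nat m)"
    let ?t' = "\<lambda>m z r. c' m z * complex_of_real r powr (d z - of_nat m)"
    let ?e = "\<lambda>z. Re (b z + d z) - real N"
    have 1: "unif_bound Z ?e (\<lambda>z r. (f z r - (\<Sum>i<N. ?t i z r)) * g z r)"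
      by (rule unif_bound_cong[OF unif_bound_mult[OF c(2)[OF Z, of N, unfolded expands_def] phg_unif_bound[OF g Z]]]) auto
    have 2: "unif_bound Z ?e (\<lambda>z r. \<Sum>i<N. ?t i z r * (g z r - (\<Sum>j<N-i. ?t' j z r)))"
    proof (rule unif_bound_sum)
      fix i assume i: "i \<in> {..<N}"
      show "unif_bound Z ?e (\<lambda>z r. ?t i z r * (g z r - (\<Sum>j<N-i. ?t' j z r)))"
        by (rule unif_bound_cong[OF unif_bound_mult[OF unif_bound_term[OF Z c(1)] c'(2)[OF Z, of "N-i", unfolded expands_def]]])
          (use i in \<open>auto simp: of_nat_diff\<close>)
    qed simp
    have eq: "f z r * g z r - (\<Sum>m<N. k m z * complex_of_real r powr (b z + d z - of_nat m))
       = (f z r - (\<Sum>i<N. ?t i z r)) * g z r + (\<Sum>i<N. ?t i z r * (g z r - (\<Sum>j<N-i. ?t' j z r)))"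
      if r: "r \<ge> 1" for z r
    proof -
      have "(\<Sum>i<N. ?t i z r * (\<Sum>j<N-i. ?t' j z r)) = (\<Sum>i<N. \<Sum>j<N-i. ?t i z r * ?t' j z r)"
        by (simp add: sum_distrib_left)
      also have "\<dots> = (\<Sum>(i, j)\<in>Sigma {..<N} (\<lambda>i. {..<N-i}). ?t i z r * ?t' j z r)"
        by (rule sum.Sigma) auto
      also have "Sigma {..<N} (\<lambda>i. {..<N-i}) = {(i, j). i + j < N}" by auto
      also have "(\<Sum>(i, j)\<in>{(i, j). i + j < N}. ?t i z r * ?t' j z r) = (\<Sum>m<N. \<Sum>i\<le>m. ?t i z r * ?t' (m - i) z r)"
        by (rule sum.triangle_reindex)
      also have "\<dots> = (\<Sum>m<N. k m z * complex_of_real r powr (b z + d z - of_nat m))"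
      proof (rule sum.cong[OF refl])
        fix m
        have "?t i z r * ?t' (m - i) z r = c i z * c' (m - i) z * complex_of_real r powr (b z + d z - of_nat m)"
          if "i \<in> {..m}" for i
        proof -
          have "b z + d z - of_nat m = (b z - of_nat i) + (d z - of_nat (m - i))"
            using that by (simp add: of_nat_diff)
          then have "complex_of_real r powr (b z + d z - of_nat m)
             = complex_of_real r powr (b z - of_nat i) * complex_of_real r powr (d z - of_nat (m - i))"
            by (metis powr_add)
          then show ?thesis by simp
        qed
        then show "(\<Sum>i\<le>m. ?t i z r * ?t' (m - i) z r) = k m z * complex_of_real r powr (b z + d z - of_nat m)"
          unfolding k_def sum_distrib_right by (rule sum.cong[OF refl])
      qed
      finally show ?thesis
        by (simp add: right_diff_distrib left_diff_distrib sum_subtractf sum_distrib_right)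
    qed
    show ?thesis
      unfolding expands_def by (rule unif_bound_cong[OF unif_bound_add[OF 1 2]]) (auto simp: eq)
  qed
  show ?thesis
    unfolding phg_def
  proof (intro conjI ballI allI impI; (elim conjE)?)
    show "\<exists>c. (\<forall>m. c m holomorphic_on \<Omega>) \<and>
        (\<forall>Z N. compact Z \<and> Z \<subseteq> \<Omega> \<longrightarrow> expands Z (\<lambda>z. b z + d z) c (\<lambda>z r. f z r * g z r) N)"
      using ex k by (intro exI[of _ k]) auto
    fix Z assume Z: "compact Z" "Z \<subseteq> \<Omega>"
    obtain M where M: "\<forall>z\<in>Z. \<forall>r\<in>{0..1}. norm (f z r) \<le> M" using phg_bounded[OF f Z] by blast
    obtain M' where M': "\<forall>z\<in>Z. \<forall>r\<in>{0..1}. norm (g z r) \<le> M'" using phg_bounded[OF g Z] by blast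
    show "\<exists>C. \<forall>z\<in>Z. \<forall>r\<in>{0..1}. norm (f z r * g z r) \<le> C"
    proof (intro exI[of _ "M * M'"] ballI)
      fix z r assume "z \<in> Z" "r \<in> {0..(1::real)}"
      then have "norm (f z r) \<le> M" "norm (g z r) \<le> M'" using M M' by auto
      then show "norm (f z r * g z r) \<le> M * M'"
        unfolding norm_mult by (intro mult_mono) (auto intro: order_trans[OF norm_ge_zero])
    qed
  qed (use f g in \<open>auto simp: phg_def intro!: holomorphic_intros continuous_intros\<close>)
qed

lemma phg_log_expansion:
  assumes g: "phg \<Omega> b g" and z: "z \<in> \<Omega>"
  shows "log_expansion {b z - of_nat m | m. True} (g z)"
  unfolding log_expansion_def
proof
  fix N :: real
  from g obtain c where c: "\<And>Z N. compact Z \<Longrightarrow> Z \<subseteq> \<Omega> \<Longrightarrow> expands Z b c g N"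
    unfolding phg_def by meson
  obtain k :: nat where k: "Re (b z) + N \<le> real k" using real_arch_simple by blast
  have "expands {z} b c g k" by (rule c) (use z in auto)
  then have "unif_bound {z} (\<lambda>_. - N) (\<lambda>z r. g z r - (\<Sum>m<k. c m z * complex_of_real r powr (b z - of_nat m)))"
    unfolding expands_def by (rule unif_bound_mono) (use k in auto)
  then obtain C where C: "C \<ge> 0"
    "\<And>r. r \<ge> 1 \<Longrightarrow> norm (g z r - (\<Sum>m<k. c m z * complex_of_real r powr (b z - of_nat m))) \<le> C * r powr (- N)"
    by (rule unif_boundE) auto
  moreover have "log_poly {b z - of_nat m | m. True} (\<lambda>r. \<Sum>m<k. c m z * complex_of_real r powr (b z - of_nat m))"
    by (intro log_poly_sum log_poly_term0) auto
  ultimately show "\<exists>p C. log_poly {b z - of_nat m | m. True} p \<and> C \<ge> 0 \<and> (\<forall>R\<ge>1. norm (g z R - p R) \<le> C * R powr (- N))"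
    by blast
qed

lemma phgD:
  assumes "phg \<Omega> b g"
  shows "b holomorphic_on \<Omega>" "\<And>z. z \<in> \<Omega> \<Longrightarrow> continuous_on {0..} (g z)"
    "\<And>r. r \<ge> 0 \<Longrightarrow> (\<lambda>z. g z r) holomorphic_on \<Omega>"
  using assms by (auto simp: phg_def)

lemma holomorphic_integral_phg:
  assumes \<Omega>: "open \<Omega>" and f: "phg \<Omega> b f"
  shows "(\<lambda>z. integral {0..R} (f z)) holomorphic_on \<Omega>"
proof (rule holomorphic_on_integral_param[OF \<Omega>])
  show "f z integrable_on {0..R}" if "z \<in> \<Omega>" for z
    by (auto intro!: integrable_continuous_real intro: continuous_on_subset[OF phgD(2)[OF f that]])
  show "(\<lambda>z. f z t) holomorphic_on \<Omega>" if "t \<in> {0..R}" for t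
    using phgD(3)[OF f, of t] that by simp
qed (use phg_bounded[OF f] in auto)

text \<open>The factor \<open>w\<close> clears the poles of the coefficients \<open>1 / (b z - m)\<close>: it is either \<open>1\<close>
  or \<open>z - p\<close>. The function \<open>K\<close> is \<open>w\<close> times the finite part of the integral of \<open>f\<close> over the half
  line, so that \<open>K z - w z * integral {0..r} (f z)\<close> is the regularised tail integral; unlike the primitive
  itself it has no constant term.\<close>
lemma phg_integral:
  assumes \<Omega>: "open \<Omega>" and f: "phg \<Omega> (\<lambda>z. b z - 1) f" and b: "b holomorphic_on \<Omega>"
    and w: "w holomorphic_on \<Omega>" and u: "\<And>m. u m holomorphic_on \<Omega>"
    and uw: "\<And>z m. z \<in> \<Omega> \<Longrightarrow> u m z * (b z - of_nat m) = w z"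
  shows "\<exists>K. K holomorphic_on \<Omega> \<and> phg \<Omega> b (\<lambda>z r. K z - w z * integral {0..r} (f z))"
proof -
  from f obtain c where c: "\<And>m. c m holomorphic_on \<Omega>"
    "\<And>Z N. compact Z \<Longrightarrow> Z \<subseteq> \<Omega> \<Longrightarrow> expands Z (\<lambda>z. b z - 1) c f N"
    unfolding phg_def by meson
  \<comment> \<open>This is w c_m / (b - m) with its pole cleared: differentiating k_m r^(b-m) gives
    w c_m r^(b-1-m). Where b z = m, the hypothesis on u makes w z = 0, so no logarithm appears in
    the primitive.\<close>
  define k where "k m z = u m z * c m z" for m z
  have k: "k m holomorphic_on \<Omega>" for m
    using holomorphic_on_mult[OF u c(1)] by (simp add: k_def[abs_def])
  define D where "D N z R = w z * integral {0..R} (f z)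
     - (\<Sum>m<N. k m z * complex_of_real R powr (b z - of_nat m))" for N z R
  have cf: "continuous_on {0..} (f z)" if "z \<in> \<Omega>" for z by (rule phgD(2)[OF f that])
  have holD: "(\<lambda>z. D N z R) holomorphic_on \<Omega>" if "R \<ge> 1" for N R
    unfolding D_def using that
    by (intro holomorphic_intros w holomorphic_integral_phg[OF \<Omega> f] k b) auto
  \<comment> \<open>The limit L still depends on z without any regularity, but the constant C does
    not depend on z. Requiring Re b + 1 \<le> N makes the exponent e at most -1, so that C0 / (-e)
    is bounded by C0.\<close>
  have step1: "\<exists>C\<ge>0. \<forall>z\<in>Z. \<exists>L. \<forall>R\<ge>1. norm (D N z R - L) \<le> C * R powr (Re (b z) - real N)"
    if Z: "compact Z" "Z \<subseteq> \<Omega>" and N: "\<And>z. z \<in> Z \<Longrightarrow> Re (b z) + 1 \<le> real N" for Z N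
  proof -
    let ?s = "\<lambda>z r. \<Sum>m<N. c m z * complex_of_real r powr (b z - 1 - of_nat m)"
    obtain C0 where C0: "C0 \<ge> 0"
      "\<And>z r. z \<in> Z \<Longrightarrow> r \<ge> 1 \<Longrightarrow> norm (f z r - ?s z r) \<le> C0 * r powr (Re (b z - 1) - real N)"
      using unif_boundE[OF c(2)[OF Z, of N, unfolded expands_def]] by blast
    obtain W where W: "W \<ge> 0" "\<And>z. z \<in> Z \<Longrightarrow> norm (w z) \<le> W"
      using compact_holomorphic_bound[OF Z w] by blast
    have "\<exists>L. \<forall>R\<ge>1. norm (D N z R - L) \<le> (W * C0) * R powr (Re (b z) - real N)" if z: "z \<in> Z" for z
    proof -
      define e where "e = Re (b z) - real N"
      have e: "e \<le> -1" using N[OF z] by (simp add: e_def)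
      have z\<Omega>: "z \<in> \<Omega>" using z Z by auto
      have cf1: "continuous_on {1..} (f z)" using cf[OF z\<Omega>] by (rule continuous_on_subset) auto
      have cs: "continuous_on {1..} (?s z)" by (intro continuous_intros continuous_on_powr_of_real)
      have "\<exists>L. \<forall>R\<ge>1. norm (integral {1..R} (\<lambda>r. f z r - ?s z r) - L) \<le> C0 / (-e) * R powr e"
      proof (rule integral_tail_limit)
        show "continuous_on {1..} (\<lambda>r. f z r - ?s z r)" by (intro continuous_intros cf1 cs)
        show "norm (f z r - ?s z r) \<le> C0 * r powr (e - 1)" if "r \<ge> 1" for r
          using C0(2)[OF z that] by (simp add: e_def algebra_simps)
      qed (use e in auto)
      then obtain L0 where L0: "\<And>R. R \<ge> 1 \<Longrightarrow> norm (integral {1..R} (\<lambda>r. f z r - ?s z r) - L0) \<le> C0 / (-e) * R powr e"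
        by blast
      define L where "L = w z * integral {0..1} (f z) - (\<Sum>m<N. k m z) + w z * L0"
      have "norm (D N z R - L) \<le> (W * C0) * R powr e" if R: "R \<ge> 1" for R
      proof -
        have t: "((\<lambda>r. w z * (c m z * complex_of_real r powr (b z - 1 - of_nat m))) has_integral
            k m z * complex_of_real R powr (b z - of_nat m) - k m z * complex_of_real 1 powr (b z - of_nat m)) {1..R}" for m
        proof (rule fundamental_theorem_of_calculus[OF R])
          fix x assume x: "x \<in> {1..R}"
          have "k m z * ((b z - of_nat m) * complex_of_real x powr (b z - of_nat m - 1))
             = w z * (c m z * complex_of_real x powr (b z - 1 - of_nat m))"
            unfolding k_def uw[OF z\<Omega>, of m, symmetric] by (simp add: algebra_simps)
          with has_vector_derivative_mult_right[OF powr_has_vector_derivative[of x "b z - of_nat m" "{1..R}"], of "k m z"] x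
          show "((\<lambda>r. k m z * complex_of_real r powr (b z - of_nat m)) has_vector_derivative
             w z * (c m z * complex_of_real x powr (b z - 1 - of_nat m))) (at x within {1..R})"
            by simp
        qed
        have "((\<lambda>r. \<Sum>m<N. w z * (c m z * complex_of_real r powr (b z - 1 - of_nat m))) has_integral
            (\<Sum>m<N. k m z * complex_of_real R powr (b z - of_nat m) - k m z * complex_of_real 1 powr (b z - of_nat m))) {1..R}"
          by (intro has_integral_sum t) auto
        then have "integral {1..R} (\<lambda>r. w z * ?s z r) = (\<Sum>m<N. k m z * complex_of_real R powr (b z - of_nat m)) - (\<Sum>m<N. k m z)"
          by (simp add: has_integral_iff sum_distrib_left sum_subtractf)
        then have ws: "w z * integral {1..R} (?s z) = (\<Sum>m<N. k m z * complex_of_real R powr (b z - of_nat m)) - (\<Sum>m<N. k m z)"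
          by simp
        have "integral {1..R} (\<lambda>r. f z r - ?s z r) = integral {1..R} (f z) - integral {1..R} (?s z)"
          by (rule integral_diff)
            (auto intro!: integrable_continuous_real intro: continuous_on_subset[OF cf1] continuous_on_subset[OF cs])
        then have "D N z R - L = w z * (integral {1..R} (\<lambda>r. f z r - ?s z r) - L0)"
          unfolding D_def L_def integral_from_zero_split[OF cf[OF z\<Omega>] R] right_diff_distrib distrib_left
          using ws by (simp add: right_diff_distrib)
        then have "norm (D N z R - L) = norm (w z) * norm (integral {1..R} (\<lambda>r. f z r - ?s z r) - L0)"
          by (simp add: norm_mult)
        also have "\<dots> \<le> W * (C0 / (-e) * R powr e)" using W z L0[OF R] by (intro mult_mono) auto
        also have "\<dots> \<le> W * (C0 * R powr e)"
        proof -
          have "C0 / (-e) \<le> C0 / 1" using C0 e by (intro divide_left_mono) auto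
          then show ?thesis using W by (intro mult_left_mono mult_right_mono) auto
        qed
        finally show ?thesis by (simp add: mult.assoc)
      qed
      then show ?thesis unfolding e_def by blast
    qed
    moreover have "W * C0 \<ge> 0" using W C0 by simp
    ultimately show ?thesis by blast
  qed
  have conv: "\<exists>L. (D N z \<longlongrightarrow> L) at_top" if z: "z \<in> \<Omega>" and N: "Re (b z) + 1 \<le> real N" for z N
  proof -
    obtain C L where L: "\<And>R. R \<ge> 1 \<Longrightarrow> norm (D N z R - L) \<le> C * R powr (Re (b z) - real N)"
      using step1[of "{z}" N] z N by auto
    have "((\<lambda>R. D N z R - L) \<longlongrightarrow> 0) at_top"
    proof (rule Lim_null_comparison)
      show "\<forall>\<^sub>F R in at_top. norm (D N z R - L) \<le> C * R powr (Re (b z) - real N)"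
        using eventually_ge_at_top[of 1] by eventually_elim (rule L)
      have "((\<lambda>R::real. C * R powr (Re (b z) - real N)) \<longlongrightarrow> C * 0) at_top"
        by (intro tendsto_mult tendsto_const tendsto_neg_powr filterlim_ident) (use N in auto)
      then show "((\<lambda>R::real. C * R powr (Re (b z) - real N)) \<longlongrightarrow> 0) at_top" by simp
    qed
    then show ?thesis using Lim_null by blast
  qed
  \<comment> \<open>Two sufficiently long truncations differ by powers of negative real part, so the
    limit does not depend on N.\<close>
  have same: "((\<lambda>R. D N z R - D N' z R) \<longlongrightarrow> 0) at_top"
    if N: "Re (b z) + 1 \<le> real N" "N \<le> N'" for z N N'
  proof -
    have "D N z R - D N' z R = (\<Sum>m\<in>{N..<N'}. k m z * complex_of_real R powr (b z - of_nat m))" for R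
    proof -
      have "(\<Sum>m<N'. k m z * complex_of_real R powr (b z - of_nat m))
        = (\<Sum>m<N. k m z * complex_of_real R powr (b z - of_nat m)) + (\<Sum>m\<in>{N..<N'}. k m z * complex_of_real R powr (b z - of_nat m))"
        using N(2) by (metis (no_types, lifting) atLeast0LessThan le0 sum.atLeastLessThan_concat)
      then show ?thesis by (simp add: D_def)
    qed
    moreover have "((\<lambda>R. \<Sum>m\<in>{N..<N'}. k m z * complex_of_real R powr (b z - of_nat m)) \<longlongrightarrow> (\<Sum>m\<in>{N..<N'}. 0)) at_top"
    proof (rule tendsto_sum)
      fix m assume m: "m \<in> {N..<N'}"
      have "((\<lambda>R. complex_of_real R powr (b z - of_nat m)) \<longlongrightarrow> 0) at_top"
      proof (rule Lim_null_comparison)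
        show "\<forall>\<^sub>F R in at_top. norm (complex_of_real R powr (b z - of_nat m)) \<le> R powr (Re (b z) - real m)"
          using eventually_ge_at_top[of 1] by eventually_elim (simp add: norm_powr_of_real)
        show "((\<lambda>R::real. R powr (Re (b z) - real m)) \<longlongrightarrow> 0) at_top"
          by (intro tendsto_neg_powr filterlim_ident) (use N m in auto)
      qed
      then show "((\<lambda>R. k m z * complex_of_real R powr (b z - of_nat m)) \<longlongrightarrow> 0) at_top"
        by (rule tendsto_mult_right_zero)
    qed
    ultimately show ?thesis by simp
  qed
  \<comment> \<open>The truncation order jumps with z, so K is not visibly holomorphic. By
    \<open>same\<close>, any large N gives the same limit, and on a small disc one N serves for all
    z.\<close>
  define K where "K z = Lim at_top (D (nat \<lceil>Re (b z)\<rceil> + 1) z)" for z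
  have limK: "(D N z \<longlongrightarrow> K z) at_top" if z: "z \<in> \<Omega>" and N: "Re (b z) + 1 \<le> real N" for z N
  proof -
    define N0 where "N0 = nat \<lceil>Re (b z)\<rceil> + 1"
    have N0: "Re (b z) + 1 \<le> real N0" unfolding N0_def by linarith
    obtain L where L: "(D N0 z \<longlongrightarrow> L) at_top" using conv[OF z N0] by blast
    then have "K z = L" unfolding K_def N0_def by (intro tendsto_Lim) auto
    define N' where "N' = max N N0"
    have a: "((\<lambda>R. D N0 z R - D N' z R) \<longlongrightarrow> 0) at_top" by (rule same[OF N0]) (simp add: N'_def)
    have bb: "((\<lambda>R. D N z R - D N' z R) \<longlongrightarrow> 0) at_top" by (rule same[OF N]) (simp add: N'_def)
    have "((\<lambda>R. D N0 z R - (D N0 z R - D N' z R) + (D N z R - D N' z R)) \<longlongrightarrow> L - 0 + 0) at_top"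
      by (intro tendsto_intros L a bb)
    with \<open>K z = L\<close> show ?thesis by simp
  qed
  have bound: "\<exists>C\<ge>0. \<forall>z\<in>Z. \<forall>R\<ge>1. norm (D N z R - K z) \<le> C * R powr (Re (b z) - real N)"
    if Z: "compact Z" "Z \<subseteq> \<Omega>" and N: "\<And>z. z \<in> Z \<Longrightarrow> Re (b z) + 1 \<le> real N" for Z N
  proof -
    obtain C where C: "C \<ge> 0" "\<forall>z\<in>Z. \<exists>L. \<forall>R\<ge>1. norm (D N z R - L) \<le> C * R powr (Re (b z) - real N)"
      using step1[OF Z N] by blast
    have "norm (D N z R - K z) \<le> C * R powr (Re (b z) - real N)" if z: "z \<in> Z" and R: "R \<ge> 1" for z R
    proof -
      have z\<Omega>: "z \<in> \<Omega>" using z Z by auto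
      obtain L where L: "\<And>R. R \<ge> 1 \<Longrightarrow> norm (D N z R - L) \<le> C * R powr (Re (b z) - real N)" using C(2) z by blast
      have "((\<lambda>R. D N z R - L) \<longlongrightarrow> 0) at_top"
      proof (rule Lim_null_comparison)
        show "\<forall>\<^sub>F R in at_top. norm (D N z R - L) \<le> C * R powr (Re (b z) - real N)"
          using eventually_ge_at_top[of 1] by eventually_elim (rule L)
        have "((\<lambda>R::real. C * R powr (Re (b z) - real N)) \<longlongrightarrow> C * 0) at_top"
          by (intro tendsto_mult tendsto_const tendsto_neg_powr filterlim_ident) (use N[OF z] in auto)
        then show "((\<lambda>R::real. C * R powr (Re (b z) - real N)) \<longlongrightarrow> 0) at_top" by simp
      qed
      then have "(D N z \<longlongrightarrow> L) at_top" using Lim_null by blast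
      with limK[OF z\<Omega> N[OF z]] have "L = K z" using tendsto_unique trivial_limit_at_top_linorder by blast
      with L R show ?thesis by simp
    qed
    with C(1) show ?thesis by blast
  qed
  have large: "\<exists>N. \<forall>z\<in>Z. Re (b z) + 1 \<le> real N" if Z: "compact Z" "Z \<subseteq> \<Omega>" for Z
  proof -
    obtain B where B: "B \<ge> 0" "\<And>z. z \<in> Z \<Longrightarrow> norm (b z) \<le> B" using compact_holomorphic_bound[OF Z b] by blast
    obtain N where "B + 1 \<le> real N" using real_arch_simple by blast
    then show ?thesis using B(2) complex_Re_le_cmod by (meson add_right_mono order_trans)
  qed
  have K: "K holomorphic_on \<Omega>"
  proof -
    have "\<exists>K'. (K has_field_derivative K') (at z0)" if z0: "z0 \<in> \<Omega>" for z0
    proof -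
      obtain e where e: "e > 0" "cball z0 e \<subseteq> \<Omega>" using \<Omega> z0 open_contains_cball by blast
      obtain N where N: "\<forall>z\<in>cball z0 e. Re (b z) + 1 \<le> real N" using large[of "cball z0 e"] e by auto
      obtain C where C: "C \<ge> 0" "\<forall>z\<in>cball z0 e. \<forall>R\<ge>1. norm (D N z R - K z) \<le> C * R powr (Re (b z) - real N)"
        using bound[of "cball z0 e" N] e N by auto
      \<comment> \<open>On this disc Re b - N \<le> -1, so \<open>D N z R\<close> converges to K
        uniformly in z at the rate 1 / R, and a locally uniform limit of holomorphic functions is
        holomorphic.\<close>
      have "K holomorphic_on ball z0 e"
      proof (rule holomorphic_uniform_limit[where f = "\<lambda>R z. D N z R" and F = at_top and g = K])
        show "\<forall>\<^sub>F R in at_top. continuous_on (cball z0 e) (\<lambda>z. D N z R) \<and> (\<lambda>z. D N z R) holomorphic_on ball z0 e"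
          using eventually_ge_at_top[of 1]
        proof eventually_elim
          case (elim R)
          from holD[OF elim] show ?case
            using e by (meson ball_subset_cball holomorphic_on_imp_continuous_on holomorphic_on_subset order_trans)
        qed
        show "uniform_limit (cball z0 e) (\<lambda>R z. D N z R) K at_top"
        proof (rule uniform_limitI)
          fix \<epsilon> :: real assume \<epsilon>: "\<epsilon> > 0"
          have lim: "((\<lambda>R::real. C * R powr (-1)) \<longlongrightarrow> C * 0) at_top"
            by (intro tendsto_mult tendsto_const tendsto_neg_powr filterlim_ident) auto
          have "\<forall>\<^sub>F R in at_top. C * R powr (-1) < \<epsilon>" by (rule order_tendstoD(2)[OF lim]) (use \<epsilon> in simp)
          then show "\<forall>\<^sub>F R in at_top. \<forall>z\<in>cball z0 e. dist (D N z R) (K z) < \<epsilon>"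
            using eventually_ge_at_top[of 1]
          proof eventually_elim
            case (elim R)
            show ?case
            proof
              fix z assume z: "z \<in> cball z0 e"
              have "norm (D N z R - K z) \<le> C * R powr (Re (b z) - real N)" using C z elim by blast
              also have "\<dots> \<le> C * R powr (-1)" using C elim N z by (intro mult_left_mono powr_mono) force+
              also have "\<dots> < \<epsilon>" using elim by simp
              finally show "dist (D N z R) (K z) < \<epsilon>" by (simp add: dist_norm)
            qed
          qed
        qed
      qed auto
      then show ?thesis using e by (meson centre_in_ball holomorphic_derivI open_ball)
    qed
    then show ?thesis using \<Omega> by (auto simp: holomorphic_on_open)
  qed
  let ?g = "\<lambda>z r. K z - w z * integral {0..r} (f z)"
  have "phg \<Omega> b ?g"
    unfolding phg_def
  proof (intro conjI ballI allI impI; (elim conjE)?)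
    show "continuous_on {0..} (?g z)" if "z \<in> \<Omega>" for z
      by (intro continuous_intros continuous_on_integral_half_line cf that)
    show "(\<lambda>z. ?g z r) holomorphic_on \<Omega>" for r
      by (intro holomorphic_intros K w holomorphic_integral_phg[OF \<Omega> f])
    show "\<exists>C. \<forall>z\<in>Z. \<forall>r\<in>{0..1}. norm (?g z r) \<le> C" if Z: "compact Z" "Z \<subseteq> \<Omega>" for Z
    proof -
      obtain M where M: "\<forall>z\<in>Z. \<forall>r\<in>{0..1}. norm (f z r) \<le> M" using phg_bounded[OF f Z] by blast
      obtain W where W: "W \<ge> 0" "\<And>z. z \<in> Z \<Longrightarrow> norm (w z) \<le> W"
        using compact_holomorphic_bound[OF Z w] by blast
      obtain B where B: "B \<ge> 0" "\<And>z. z \<in> Z \<Longrightarrow> norm (K z) \<le> B"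
        using compact_holomorphic_bound[OF Z K] by blast
      have "norm (?g z r) \<le> B + W * \<bar>M\<bar>" if z: "z \<in> Z" and r: "r \<in> {0..1}" for z r
      proof -
        have "norm (integral {0..r} (f z)) \<le> \<bar>M\<bar> * (r - 0)"
        proof (rule integral_bound)
          show "continuous_on {0..r} (f z)"
            by (rule continuous_on_subset[OF cf]) (use z Z in auto)
          show "norm (f z t) \<le> \<bar>M\<bar>" if "t \<in> {0..r}" for t
            using M z r that by (force intro: order_trans[OF _ abs_ge_self])
        qed (use r in auto)
        also have "\<dots> \<le> \<bar>M\<bar> * 1" using r by (intro mult_left_mono) auto
        finally have "norm (w z * integral {0..r} (f z)) \<le> W * \<bar>M\<bar>"
          unfolding norm_mult using W z by (intro mult_mono) auto
        then show ?thesis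
          using norm_triangle_ineq4[of "K z" "w z * integral {0..r} (f z)"] B(2)[OF z] by linarith
      qed
      then show ?thesis by blast
    qed
    show "\<exists>c. (\<forall>m. c m holomorphic_on \<Omega>) \<and> (\<forall>Z N. compact Z \<and> Z \<subseteq> \<Omega> \<longrightarrow> expands Z b c ?g N)"
    \<comment> \<open>The sign changes because the primitive is subtracted from K. That subtraction
      cancels the constant term, which would otherwise be an extra exponent 0 outside the sequence b
      - m.\<close>
    proof (intro exI[of _ "\<lambda>m z. - k m z"] conjI allI impI; (elim conjE)?)
      show hk: "(\<lambda>z. - k m z) holomorphic_on \<Omega>" for m by (intro holomorphic_intros k)
      fix Z N0 assume Z: "compact Z" "Z \<subseteq> \<Omega>"
      obtain N where N: "\<forall>z\<in>Z. Re (b z) + 1 \<le> real N" using large[OF Z] by blast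
      define N1 where "N1 = max N N0"
      have N1: "Re (b z) + 1 \<le> real N1" if "z \<in> Z" for z
        using N that by (auto simp: N1_def intro: order_trans)
      obtain C where C: "C \<ge> 0" "\<forall>z\<in>Z. \<forall>R\<ge>1. norm (D N1 z R - K z) \<le> C * R powr (Re (b z) - real N1)"
        using bound[OF Z N1] by blast
      have "expands Z b (\<lambda>m z. - k m z) ?g N1"
        unfolding expands_def
      proof (rule unif_boundI)
        fix z r assume z: "z \<in> Z" "(r::real) \<ge> 1"
        have "?g z r - (\<Sum>m<N1. - k m z * complex_of_real r powr (b z - of_nat m)) = - (D N1 z r - K z)"
          by (simp add: D_def sum_negf)
        then have "norm (?g z r - (\<Sum>m<N1. - k m z * complex_of_real r powr (b z - of_nat m))) = norm (D N1 z r - K z)"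
          by (simp only: norm_minus_cancel)
        then show "norm (?g z r - (\<Sum>m<N1. - k m z * complex_of_real r powr (b z - of_nat m))) \<le> C * r powr (Re (b z) - real N1)"
          using C z by simp
      qed
      then show "expands Z b (\<lambda>m z. - k m z) ?g N0"
        by (rule expands_lower[OF _ _ Z]) (auto simp: N1_def intro: hk)
    qed
  qed (rule b)
  with K show ?thesis by blast
qed

section \<open>Nested integrals\<close>

definition prefix_sum :: "complex list \<Rightarrow> nat \<Rightarrow> complex" where
  "prefix_sum bs l = sum_list (take l bs)"

lemma prefix_sum_simps [simp]:
  "prefix_sum bs 0 = 0" "prefix_sum (b # bs) (Suc l) = b + prefix_sum bs l"
  by (simp_all add: prefix_sum_def)

text \<open>A coarse statement at one fixed z. The index l = 0 is included: each integration may
  produce a constant and, by resonance, logarithms. Such an inner integral is used only after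
  multiplication by an outer factor, which shifts all these exponents by a partial sum.\<close>

lemma nested_int_log_expansion:
  assumes "\<forall>(b, s)\<in>set ps. continuous_on {0..} s \<and> log_expansion {b - 1 - of_nat m | m. True} s"
  shows "log_expansion {prefix_sum (map fst ps) l - of_nat m | l m. l \<le> length ps} (nested_int (map snd ps))"
  using assms
proof (induction ps)
  case Nil
  have "nested_int [] = (\<lambda>R. 1)" by auto
  moreover have "log_expansion {prefix_sum [] l - of_nat m | l m. l \<le> 0} (\<lambda>R. 1)"
    by (intro log_expansion_log_poly log_poly_const CollectI exI[of _ 0]) simp
  ultimately show ?case by simp
next
  case (Cons p ps)
  obtain b s where p: "p = (b, s)" by (cases p)
  let ?E = "\<lambda>ps. {prefix_sum (map fst ps) l - of_nat m | l m. l \<le> length (ps :: (complex \<times> (real \<Rightarrow> complex)) list)}"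
  let ?N = "nested_int (map snd ps)"
  have s: "continuous_on {0..} s" "log_expansion {b - 1 - of_nat m | m. True} s"
    using Cons.prems p by auto
  have N: "log_expansion (?E ps) ?N" using Cons by simp
  have cN: "continuous_on {0..} ?N" by (rule continuous_on_nested_int) (use Cons.prems in auto)
  have eq: "nested_int (map snd (p # ps)) = (\<lambda>R. integral {0..R} (\<lambda>r. s r * ?N r))" by (auto simp: p)
  show ?case
    unfolding eq
  proof (rule log_expansion_integral)
    show "continuous_on {0..} (\<lambda>r. s r * ?N r)" by (intro continuous_intros s cN)
    show "log_expansion {a + e | a e. a \<in> {b - 1 - of_nat m | m. True} \<and> e \<in> ?E ps} (\<lambda>r. s r * ?N r)"
      by (rule log_expansion_mult[OF s(2) N]) blast
    show "0 \<in> ?E (p # ps)"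
      by (intro CollectI exI[of _ 0]) simp
    fix a assume "a \<in> {a + e | a e. a \<in> {b - 1 - of_nat m | m. True} \<and> e \<in> ?E ps}"
    then obtain m l m' where "a = (b - 1 - of_nat m) + (prefix_sum (map fst ps) l - of_nat m')" "l \<le> length ps" by blast
    then show "a + 1 \<in> ?E (p # ps)"
      by (intro CollectI exI[of _ "Suc l"] exI[of _ "m + m'"]) (simp add: p)
  qed
qed

text \<open>The integrals are regularised from the outermost variable inwards: integrating the outer factor
  by parts against the tail integrals of \<open>phg_integral\<close> leaves boundary terms whose exponents all start
  with the exponent of the outermost factor. This is why only the partial sums from the left produce poles.\<close>
lemma nested_family:
  fixes fs :: "((complex \<Rightarrow> complex) \<times> (complex \<Rightarrow> real \<Rightarrow> complex)) list"
  assumes \<Omega>: "open \<Omega>" and w: "w holomorphic_on \<Omega>"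
    and g: "phg \<Omega> b g"
    and fs: "\<forall>(\<beta>, s)\<in>set fs. \<beta> holomorphic_on \<Omega> \<and> phg \<Omega> (\<lambda>z. \<beta> z - 1) s"
    and ne: "fs \<noteq> []"
    and u: "\<forall>l\<in>{1..length fs}. \<exists>u. (\<forall>m. u m holomorphic_on \<Omega>) \<and>
       (\<forall>z\<in>\<Omega>. \<forall>m. u m z * (b z + prefix_sum (map (\<lambda>p. fst p z) fs) l - of_nat m) = w z)"
  shows "\<exists>K. K holomorphic_on \<Omega> \<and> (\<forall>z\<in>\<Omega>.
     log_expansion {b z + prefix_sum (map (\<lambda>p. fst p z) fs) l - of_nat m | l m. l \<in> {1..length fs}}
       (\<lambda>R. w z ^ length fs * integral {0..R} (\<lambda>r. g z r * snd (hd fs) z r * nested_int (map (\<lambda>p. snd p z) (tl fs)) r) - K z))"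
  using g fs ne u
proof (induction fs arbitrary: b g)
  case Nil
  then show ?case by simp
next
  case (Cons p fs)
  obtain \<beta> s where p: "p = (\<beta>, s)" by (cases p)
  have \<beta>: "\<beta> holomorphic_on \<Omega>" and s: "phg \<Omega> (\<lambda>z. \<beta> z - 1) s" using Cons.prems(2) p by auto
  have bh: "b holomorphic_on \<Omega>" by (rule phgD[OF Cons.prems(1)])
  \<comment> \<open>Here g is the regularised tail integral of the factors already processed, of
    exponent b. Multiplying by the next factor gives exponent b + \<beta> - 1, ready for another
    tail integration.\<close>
  define f where "f z r = g z r * s z r" for z r
  define b' where "b' z = b z + \<beta> z" for z
  have "phg \<Omega> (\<lambda>z. b z + (\<beta> z - 1)) (\<lambda>z r. g z r * s z r)" by (rule phg_mult[OF Cons.prems(1) s])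
  then have f: "phg \<Omega> (\<lambda>z. b' z - 1) f" by (simp add: f_def[abs_def] b'_def add_diff_eq)
  have b'h: "b' holomorphic_on \<Omega>"
    using holomorphic_on_add[OF bh \<beta>] by (simp add: b'_def[abs_def])
  obtain u where u: "\<And>m. u m holomorphic_on \<Omega>" "\<And>z m. z \<in> \<Omega> \<Longrightarrow> u m z * (b' z - of_nat m) = w z"
    using bspec[OF Cons.prems(4), of 1] by (auto simp: p b'_def)
  from phg_integral[OF \<Omega> f b'h w u] obtain K1 where K1: "K1 holomorphic_on \<Omega>"
    "phg \<Omega> b' (\<lambda>z r. K1 z - w z * integral {0..r} (f z))" by blast
  define G where "G z r = K1 z - w z * integral {0..r} (f z)" for z r
  have G: "phg \<Omega> b' G" using K1(2) by (simp add: G_def[abs_def])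
  have cf: "continuous_on {0..} (f z)" if "z \<in> \<Omega>" for z by (rule phgD(2)[OF f that])
  let ?E = "\<lambda>z. {b z + prefix_sum (map (\<lambda>p. fst p z) (p # fs)) l - of_nat m | l m. l \<in> {1..length (p # fs)}}"
  show ?case
  proof (cases fs)
    case Nil
    have "log_expansion (?E z) (\<lambda>R. w z ^ 1 * integral {0..R} (\<lambda>r. g z r * s z r * 1) - K1 z)" if z: "z \<in> \<Omega>" for z
    proof (rule log_expansion_cong)
      have "log_expansion (?E z) (G z)"
      proof (rule log_expansion_mono[OF phg_log_expansion[OF G z]], safe)
        fix m
        show "\<exists>l ma. b' z - of_nat m = b z + prefix_sum (map (\<lambda>p. fst p z) (p # fs)) l - of_nat ma \<and> l \<in> {1..length (p # fs)}"
          by (intro exI[of _ 1] exI[of _ m]) (simp add: p b'_def)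
      qed
      then show "log_expansion (?E z) (\<lambda>R. (-1) * G z R)" by (rule log_expansion_cmult)
      show "w z ^ 1 * integral {0..R} (\<lambda>r. g z r * s z r * 1) - K1 z = (-1) * G z R" for R
        by (simp add: G_def f_def[abs_def])
    qed
    with K1(1) Nil show ?thesis by (intro exI[of _ K1]) (simp add: p)
  next
    case (Cons p' fs')
    have us: "\<forall>l\<in>{1..length fs}. \<exists>u. (\<forall>m. u m holomorphic_on \<Omega>) \<and>
       (\<forall>z\<in>\<Omega>. \<forall>m. u m z * (b' z + prefix_sum (map (\<lambda>p. fst p z) fs) l - of_nat m) = w z)"
    proof
      fix l assume "l \<in> {1..length fs}"
      with bspec[OF Cons.prems(4), of "Suc l"] show "\<exists>u. (\<forall>m. u m holomorphic_on \<Omega>) \<and>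
       (\<forall>z\<in>\<Omega>. \<forall>m. u m z * (b' z + prefix_sum (map (\<lambda>p. fst p z) fs) l - of_nat m) = w z)"
        by (simp add: p b'_def add.assoc)
    qed
    obtain K2 where K2: "K2 holomorphic_on \<Omega>" "\<And>z. z \<in> \<Omega> \<Longrightarrow>
       log_expansion {b' z + prefix_sum (map (\<lambda>p. fst p z) fs) l - of_nat m | l m. l \<in> {1..length fs}}
       (\<lambda>R. w z ^ length fs * integral {0..R} (\<lambda>r. G z r * snd (hd fs) z r * nested_int (map (\<lambda>p. snd p z) (tl fs)) r) - K2 z)"
      using Cons.IH[OF G _ _ us] Cons.prems(2) Cons by auto
    have "log_expansion (?E z) (\<lambda>R. w z ^ Suc (length fs) * integral {0..R} (\<lambda>r. g z r * s z r * nested_int (map (\<lambda>p. snd p z) fs) r) - K2 z)"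
      if z: "z \<in> \<Omega>" for z
    proof -
      let ?N = "nested_int (map (\<lambda>p. snd p z) fs)"
      let ?N' = "nested_int (map (\<lambda>p. snd p z) fs')"
      let ?s' = "snd p' z"
      let ?I = "\<lambda>R. integral {0..R} (\<lambda>r. G z r * ?s' r * ?N' r)"
      have cfs: "\<forall>s\<in>set (map (\<lambda>p. snd p z) fs). continuous_on {0..} s"
        using Cons.prems(2) phgD(2)[OF _ z] by fastforce
      have Ndef: "?N = nested_int (?s' # map (\<lambda>p. snd p z) fs')" by (simp add: Cons)
      have cN: "continuous_on {0..} ?N" by (rule continuous_on_nested_int[OF cfs])
      have cN': "continuous_on {0..} ?N'" by (rule continuous_on_nested_int) (use cfs Cons in auto)
      have cs': "continuous_on {0..} ?s'" using cfs Cons by auto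
      have cG: "continuous_on {0..} (G z)" by (rule phgD(2)[OF G z])
      \<comment> \<open>G has derivative - w f, so integration by parts replaces the outermost
        integral by G times the next factor. The boundary term at 0 vanishes because
        \<open>fs\<close> is nonempty and a nonempty nested integral is 0 at 0; only the one at R is
        left. The step uses up one factor w.\<close>
      have parts: "w z * integral {0..R} (\<lambda>r. g z r * s z r * ?N r) = - (G z R * ?N R) + ?I R" if R: "R \<ge> 0" for R
      proof -
        have dG: "(G z has_vector_derivative - (w z * f z x)) (at x within {0..})" if "x \<ge> 0" for x
          unfolding G_def
          using has_vector_derivative_diff[OF has_vector_derivative_const
              has_vector_derivative_mult_right[OF integral_has_vector_derivative_half_line[OF cf[OF z] that]], of "K1 z" "w z"]
          by simp
        have dN: "(?N has_vector_derivative ?s' x * ?N' x) (at x within {0..})" if "x \<ge> 0" for x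
          unfolding Ndef by (rule nested_int_has_vector_derivative) (use cfs Cons that in auto)
        have "((\<lambda>r. G z r * ?N r) has_vector_derivative G z x * (?s' x * ?N' x) + - (w z * f z x) * ?N x) (at x within {0..})"
          if "x \<ge> 0" for x
          by (rule has_vector_derivative_mult[OF dG dN]) (use that in auto)
        from ftc_half_line[OF this, of 0 R] R
        have i1: "((\<lambda>x. G z x * (?s' x * ?N' x) + - (w z * f z x) * ?N x) has_integral G z R * ?N R - G z 0 * ?N 0) {0..R}"
          by simp
        have N0: "?N 0 = 0" unfolding Ndef by (rule nested_int_Cons_0)
        have i2: "((\<lambda>x. G z x * ?s' x * ?N' x) has_integral ?I R) {0..R}"
          by (intro integrable_integral integrable_continuous_real continuous_intros
              continuous_on_subset[OF cG] continuous_on_subset[OF cs'] continuous_on_subset[OF cN']) auto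
        have "((\<lambda>x. G z x * ?s' x * ?N' x - (G z x * (?s' x * ?N' x) + - (w z * f z x) * ?N x))
            has_integral ?I R - G z R * ?N R) {0..R}"
          using has_integral_diff[OF i2 i1] unfolding N0 mult_zero_right diff_zero .
        then have "((\<lambda>x. w z * (g z x * s z x * ?N x)) has_integral ?I R - G z R * ?N R) {0..R}"
          by (simp add: f_def mult_ac)
        then have "integral {0..R} (\<lambda>x. w z * (g z x * s z x * ?N x)) = ?I R - G z R * ?N R"
          by (simp add: has_integral_iff)
        then show ?thesis by simp
      qed
      have eN: "log_expansion {prefix_sum (map (\<lambda>p. fst p z) fs) l - of_nat m | l m. l \<le> length fs} ?N"
      proof -
        have "\<forall>(b, s)\<in>set (map (\<lambda>p. (fst p z, snd p z)) fs). continuous_on {0..} s \<and> log_expansion {b - 1 - of_nat m | m. True} s"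
        proof clarsimp
          fix B S assume "(B, S) \<in> set fs"
          then have "phg \<Omega> (\<lambda>z. B z - 1) S" using Cons.prems(2) by auto
          from phgD(2)[OF this z] phg_log_expansion[OF this z]
          show "continuous_on {0..} (S z) \<and> log_expansion {u. \<exists>m. u = B z - 1 - of_nat m} (S z)" by simp
        qed
        from nested_int_log_expansion[OF this] show ?thesis by (simp add: o_def)
      qed
      \<comment> \<open>The exponents of the boundary term are b' = b + \<beta> plus an inner
        partial sum, possibly the empty one, so they are partial sums of the full list with index at
        least 1. The term therefore leaves the constant K2 unchanged.\<close>
      have eGN: "log_expansion (?E z) (\<lambda>R. G z R * ?N R)"
      proof (rule log_expansion_mult[OF phg_log_expansion[OF G z] eN])
        fix a e assume "a \<in> {b' z - of_nat m | m. True}"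
          "e \<in> {prefix_sum (map (\<lambda>p. fst p z) fs) l - of_nat m | l m. l \<le> length fs}"
        then obtain m l m' where "a = b' z - of_nat m" "e = prefix_sum (map (\<lambda>p. fst p z) fs) l - of_nat m'" "l \<le> length fs"
          by blast
        then show "a + e \<in> ?E z"
          by (intro CollectI exI[of _ "Suc l"] exI[of _ "m + m'"]) (simp add: p b'_def)
      qed
      have eI: "log_expansion (?E z) (\<lambda>R. w z ^ length fs * ?I R - K2 z)"
      proof (rule log_expansion_mono)
        show "log_expansion {b' z + prefix_sum (map (\<lambda>p. fst p z) fs) l - of_nat m | l m. l \<in> {1..length fs}}
           (\<lambda>R. w z ^ length fs * ?I R - K2 z)" using K2(2)[OF z] Cons by simp
        show "{b' z + prefix_sum (map (\<lambda>p. fst p z) fs) l - of_nat m | l m. l \<in> {1..length fs}} \<subseteq> ?E z"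
        proof
          fix a assume "a \<in> {b' z + prefix_sum (map (\<lambda>p. fst p z) fs) l - of_nat m | l m. l \<in> {1..length fs}}"
          then obtain l m where "a = b' z + prefix_sum (map (\<lambda>p. fst p z) fs) l - of_nat m" "l \<le> length fs" by auto
          then show "a \<in> ?E z"
            by (intro CollectI exI[of _ "Suc l"] exI[of _ m]) (simp add: p b'_def)
        qed
      qed
      show ?thesis
      proof (rule log_expansion_cong[OF log_expansion_add[OF log_expansion_cmult[OF eGN, of "- (w z ^ length fs)"] eI]])
        fix R :: real assume "R \<ge> 1"
        then have eq: "w z ^ Suc (length fs) * integral {0..R} (\<lambda>r. g z r * s z r * ?N r)
           = w z ^ length fs * (- (G z R * ?N R) + ?I R)" using parts[of R] by (simp only: power_Suc2 mult.assoc)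
        show "w z ^ Suc (length fs) * integral {0..R} (\<lambda>r. g z r * s z r * ?N r) - K2 z
           = - (w z ^ length fs) * (G z R * ?N R) + (w z ^ length fs * ?I R - K2 z)"
          unfolding eq by (simp add: right_diff_distrib)
      qed
    qed
    with K2(1) show ?thesis by (intro exI[of _ K2]) (simp add: p)
  qed
qed

corollary nested_int_family:
  fixes fs :: "((complex \<Rightarrow> complex) \<times> (complex \<Rightarrow> real \<Rightarrow> complex)) list"
  assumes \<Omega>: "open \<Omega>" and w: "w holomorphic_on \<Omega>"
    and fs: "\<forall>(\<beta>, s)\<in>set fs. \<beta> holomorphic_on \<Omega> \<and> phg \<Omega> (\<lambda>z. \<beta> z - 1) s"
    and ne: "fs \<noteq> []"
    and u: "\<forall>l\<in>{1..length fs}. \<exists>u. (\<forall>m. u m holomorphic_on \<Omega>) \<and>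
       (\<forall>z\<in>\<Omega>. \<forall>m. u m z * (prefix_sum (map (\<lambda>p. fst p z) fs) l - of_nat m) = w z)"
  shows "\<exists>K. K holomorphic_on \<Omega> \<and> (\<forall>z\<in>\<Omega>.
     log_expansion {prefix_sum (map (\<lambda>p. fst p z) fs) l - of_nat m | l m. l \<in> {1..length fs}}
       (\<lambda>R. w z ^ length fs * nested_int (map (\<lambda>p. snd p z) fs) R - K z))"
proof -
  have "\<exists>K. K holomorphic_on \<Omega> \<and> (\<forall>z\<in>\<Omega>.
     log_expansion {0 + prefix_sum (map (\<lambda>p. fst p z) fs) l - of_nat m | l m. l \<in> {1..length fs}}
       (\<lambda>R. w z ^ length fs * integral {0..R} (\<lambda>r. 1 * snd (hd fs) z r * nested_int (map (\<lambda>p. snd p z) (tl fs)) r) - K z))"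
    by (rule nested_family[OF \<Omega> w phg_one fs ne]) (use u in simp)
  moreover have "nested_int (map (\<lambda>p. snd p z) fs) R
      = integral {0..R} (\<lambda>r. 1 * snd (hd fs) z r * nested_int (map (\<lambda>p. snd p z) (tl fs)) r)" for z R
    using ne by (cases fs) auto
  ultimately show ?thesis by simp
qed

section \<open>Products and permutations\<close>

lemma sum_permutations_of_set_Cons:
  assumes "finite I" "I \<noteq> {}"
  shows "(\<Sum>xs\<in>permutations_of_set I. h xs) = (\<Sum>i\<in>I. \<Sum>ys\<in>permutations_of_set (I - {i}). h (i # ys))"
proof -
  have "(\<Sum>xs\<in>permutations_of_set I. h xs) = (\<Sum>xs\<in>(\<Union>i\<in>I. (#) i ` permutations_of_set (I - {i})). h xs)"
    by (simp add: permutations_of_set_nonempty[OF assms(2)])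
  also have "\<dots> = (\<Sum>i\<in>I. \<Sum>xs\<in>(#) i ` permutations_of_set (I - {i}). h xs)"
    by (rule sum.UNION_disjoint) (use assms in auto)
  also have "\<dots> = (\<Sum>i\<in>I. \<Sum>ys\<in>permutations_of_set (I - {i}). h (i # ys))"
  proof (rule sum.cong[OF refl])
    fix i
    show "(\<Sum>xs\<in>(#) i ` permutations_of_set (I - {i}). h xs) = (\<Sum>ys\<in>permutations_of_set (I - {i}). h (i # ys))"
      by (subst sum.reindex) auto
  qed
  finally show ?thesis .
qed

text \<open>The cube {0..R}^I splits according to the order of the variables. Instead of decomposing
  the domain, both sides are differentiated in R: the derivatives agree by the induction hypothesis
  for I with one element removed, and both sides vanish at R = 0.\<close>

lemma prod_integral_eq_sum_nested_int:
  fixes s :: "'i \<Rightarrow> real \<Rightarrow> complex"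
  assumes "finite I" "\<forall>i\<in>I. continuous_on {0..} (s i)" "R \<ge> 0"
  shows "(\<Prod>i\<in>I. nested_int [s i] R) = (\<Sum>xs\<in>permutations_of_set I. nested_int (map s xs) R)"
  using assms
proof (induction I arbitrary: R rule: finite_psubset_induct)
  case (psubset I)
  show ?case
  proof (cases "I = {}")
    case True
    then show ?thesis by simp
  next
    case False
    let ?f = "\<lambda>x. \<Sum>i\<in>I. s i x * (\<Prod>j\<in>I-{i}. nested_int [s j] x)"
    let ?P = "\<lambda>R. \<Prod>i\<in>I. nested_int [s i] R"
    let ?S = "\<lambda>R. \<Sum>i\<in>I. \<Sum>ys\<in>permutations_of_set (I - {i}). nested_int (s i # map s ys) R"
    have dP: "(?P has_vector_derivative ?f x) (at x within {0..})" if x: "x \<ge> 0" for x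
    proof -
      have "(nested_int [s i] has_derivative (\<lambda>y. y *\<^sub>R s i x)) (at x within {0..})" if "i \<in> I" for i
        using nested_int_has_vector_derivative[of "s i" "[]" x] psubset.prems(1) that x
        by (simp add: has_vector_derivative_def)
      from has_derivative_prod[of I "\<lambda>i. nested_int [s i]" "\<lambda>i y. y *\<^sub>R s i x", OF this]
      show ?thesis by (simp add: has_vector_derivative_def scaleR_sum_right)
    qed
    have dS: "(?S has_vector_derivative ?f x) (at x within {0..})" if x: "x \<ge> 0" for x
    proof -
      have "(?S has_vector_derivative (\<Sum>i\<in>I. \<Sum>ys\<in>permutations_of_set (I - {i}). s i x * nested_int (map s ys) x)) (at x within {0..})"
      proof (intro has_vector_derivative_sum nested_int_has_vector_derivative x)
        fix i ys assume "i \<in> I" "ys \<in> permutations_of_set (I - {i})"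
        then show "\<forall>s\<in>set (s i # map s ys). continuous_on {0..} s"
          using psubset.prems(1) by (auto dest: permutations_of_setD)
      qed
      moreover have "(\<Sum>ys\<in>permutations_of_set (I - {i}). s i x * nested_int (map s ys) x)
          = s i x * (\<Prod>j\<in>I-{i}. nested_int [s j] x)" if "i \<in> I" for i
      proof -
        have "I - {i} \<subset> I" using that by blast
        from psubset.IH[OF this _ x] psubset.prems(1) show ?thesis
          unfolding sum_distrib_left[symmetric] by simp
      qed
      ultimately show ?thesis by simp
    qed
    have "(?f has_integral ?P R - ?P 0) {0..R}" by (rule ftc_half_line[OF dP]) (use psubset.prems in auto)
    moreover have "(?f has_integral ?S R - ?S 0) {0..R}" by (rule ftc_half_line[OF dS]) (use psubset.prems in auto)
    ultimately have "?P R - ?P 0 = ?S R - ?S 0" by (rule has_integral_unique)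
    moreover have "?P 0 = 0" using False psubset.hyps by (intro prod_zero) auto
    moreover have "?S 0 = 0" by simp
    ultimately have "?P R = ?S R" by (simp only: diff_zero)
    then show ?thesis
      using sum_permutations_of_set_Cons[OF psubset.hyps False, of "\<lambda>xs. nested_int (map s xs) R"] by simp
  qed
qed

text \<open>A permutation of {1..k} is determined by its list of values there; that every ordering
  arises follows by counting.\<close>

lemma sum_permutes_eq_sum_permutations_of_set:
  "(\<Sum>\<tau>\<in>{\<tau>. \<tau> permutes {1..k}}. h (map \<tau> [1..<k+1])) = (\<Sum>xs\<in>permutations_of_set {1..k::nat}. h xs)"
proof -
  let ?m = "\<lambda>\<tau>::nat \<Rightarrow> nat. map \<tau> [1..<k+1]"
  have set: "set [1..<k+1] = {1..k}" by auto
  have inj: "inj_on ?m {\<tau>. \<tau> permutes {1..k}}"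
  proof (rule inj_onI, rule ext)
    fix \<tau> \<tau>' i assume *: "\<tau> \<in> {\<tau>. \<tau> permutes {1..k}}" "\<tau>' \<in> {\<tau>. \<tau> permutes {1..k}}" "?m \<tau> = ?m \<tau>'"
    show "\<tau> i = \<tau>' i"
    proof (cases "i \<in> {1..k}")
      case True
      then have "i \<in> set [1..<k+1]" using set by simp
      with *(3) show ?thesis by (metis map_eq_conv)
    next
      case False
      then show ?thesis using *(1,2) permutes_not_in[of \<tau> "{1..k}" i] permutes_not_in[of \<tau>' "{1..k}" i] by simp
    qed
  qed
  have sub: "?m ` {\<tau>. \<tau> permutes {1..k}} \<subseteq> permutations_of_set {1..k}"
  proof safe
    fix \<tau> assume \<tau>: "\<tau> permutes {1..k}"
    show "?m \<tau> \<in> permutations_of_set {1..k}"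
    proof (rule permutations_of_setI)
      show "set (?m \<tau>) = {1..k}" unfolding set_map set by (rule permutes_image[OF \<tau>])
      show "distinct (?m \<tau>)" using permutes_inj[OF \<tau>] by (simp add: distinct_map inj_on_def inj_def)
    qed
  qed
  have "card (?m ` {\<tau>. \<tau> permutes {1..k}}) = card (permutations_of_set {1..k})"
    using card_image[OF inj] card_permutations[of "{1..k}" k] by simp
  then have "?m ` {\<tau>. \<tau> permutes {1..k}} = permutations_of_set {1..k}"
    using sub by (intro card_subset_eq) auto
  with sum.reindex[OF inj, of h] show ?thesis by simp
qed

text \<open>With F and G tending to F0 and G0 in the sense of constant terms, F G - F0 G0 = (F -
  F0)(G - G0) + G0 (F - F0) + F0 (G - G0). Each summand collects the exponents of a nonempty subset
  of the factors. A constant term is multiplicative only if none of these subset sums can cancel to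
  0.\<close>

lemma log_expansion_prod:
  fixes \<beta> :: "'i \<Rightarrow> complex"
  assumes "finite I" "\<forall>i\<in>I. log_expansion {\<beta> i - of_nat m | m. True} (\<lambda>R. f i R - c i)"
  shows "log_expansion {(\<Sum>i\<in>J. \<beta> i) - of_nat m | J m. J \<subseteq> I \<and> J \<noteq> {}} (\<lambda>R. (\<Prod>i\<in>I. f i R) - (\<Prod>i\<in>I. c i))"
  using assms
proof (induction rule: finite_induct)
  case empty
  then show ?case by (simp add: log_expansion_zero)
next
  case (insert i I)
  let ?T = "\<lambda>I. {(\<Sum>i\<in>J. \<beta> i) - of_nat m | J m. J \<subseteq> I \<and> J \<noteq> {}}"
  let ?p = "\<lambda>R. (\<Prod>i\<in>I. f i R) - (\<Prod>i\<in>I. c i)"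
  let ?e = "\<lambda>R. f i R - c i"
  have e: "log_expansion {\<beta> i - of_nat m | m. True} ?e" and p: "log_expansion (?T I) ?p" using insert by auto
  have "log_expansion (?T (insert i I)) (\<lambda>R. ?e R * ?p R)"
  proof (rule log_expansion_mult[OF e p])
    fix a b assume "a \<in> {\<beta> i - of_nat m | m. True}" "b \<in> ?T I"
    then obtain m J m' where h: "a = \<beta> i - of_nat m" "b = (\<Sum>i\<in>J. \<beta> i) - of_nat m'" "J \<subseteq> I" by blast
    then have "(\<Sum>i\<in>insert i J. \<beta> i) = \<beta> i + (\<Sum>i\<in>J. \<beta> i)"
      using insert.hyps finite_subset by (subst sum.insert) auto
    with h show "a + b \<in> ?T (insert i I)"
      by (intro CollectI exI[of _ "insert i J"] exI[of _ "m + m'"]) auto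
  qed
  moreover have "log_expansion (?T (insert i I)) ?e"
  proof (rule log_expansion_mono[OF e], safe)
    fix m show "\<exists>J ma. \<beta> i - of_nat m = (\<Sum>i\<in>J. \<beta> i) - of_nat ma \<and> J \<subseteq> insert i I \<and> J \<noteq> {}"
      by (intro exI[of _ "{i}"] exI[of _ m]) auto
  qed
  moreover have "log_expansion (?T (insert i I)) ?p"
    by (rule log_expansion_mono[OF p]) blast
  ultimately have "log_expansion (?T (insert i I)) (\<lambda>R. ?e R * ?p R + (\<Prod>i\<in>I. c i) * ?e R + c i * ?p R)"
    by (intro log_expansion_add log_expansion_cmult)
  then show ?case
    by (rule log_expansion_cong) (use insert in \<open>simp add: algebra_simps\<close>)
qed

section \<open>Generic points and the local form of poles\<close>

lemma eventually_affine_not_Ints: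
  fixes c d p :: complex
  assumes "c \<noteq> 0"
  shows "\<forall>\<^sub>F z in at p. c * z + d \<notin> \<int>"
proof -
  have lim: "((\<lambda>z. c * z + d) \<longlongrightarrow> c * p + d) (at p)" by (intro tendsto_intros)
  show ?thesis
  proof (cases "c * p + d \<in> \<int>")
    case False
    have "\<forall>\<^sub>F z in at p. c * z + d \<in> - \<int>"
      by (rule topological_tendstoD[OF lim]) (use False closed_Ints in auto)
    then show ?thesis by simp
  next
    case True
    then obtain m where m: "c * p + d = of_int m" by (auto elim: Ints_cases)
    have "\<forall>\<^sub>F z in at p. dist (c * z + d) (c * p + d) < 1" by (rule tendstoD[OF lim]) simp
    moreover have "\<forall>\<^sub>F z in at p. z \<noteq> p" by (rule eventually_neq_at_within)
    ultimately show ?thesis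
    proof eventually_elim
      case (elim z)
      show ?case
      proof
        assume "c * z + d \<in> \<int>"
        then obtain m' where m': "c * z + d = of_int m'" by (auto elim: Ints_cases)
        have "\<bar>real_of_int (m' - m)\<bar> < 1"
          using elim(1) unfolding m m' dist_norm by (metis norm_of_int of_int_diff)
        then have "m' = m" by linarith
        then have "c * z = c * p" using m m' by (metis add_right_cancel)
        with assms elim(2) show False by simp
      qed
    qed
  qed
qed

lemma mero_poles_leI:
  assumes "\<And>p. \<exists>r>0. \<exists>g. g holomorphic_on ball p r \<and> (\<forall>z\<in>ball p r - {p}. f z = g z / (z - p) ^ k)"
  shows "mero_poles_le f k"
proof -
  have "f meromorphic_on {p}" for p
  proof -
    obtain r g where g: "r > 0" "g holomorphic_on ball p r" "\<forall>z\<in>ball p r - {p}. f z = g z / (z - p) ^ k"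
      using assms by blast
    have "g analytic_on {p}" using g by (meson analytic_at centre_in_ball open_ball)
    then have "(\<lambda>z. g z / (z - p) ^ k) meromorphic_on {p}"
      by (intro meromorphic_intros analytic_on_imp_meromorphic_on) (auto intro!: analytic_intros)
    moreover have "\<forall>\<^sub>F z in at p. f z = g z / (z - p) ^ k"
      using g by (auto simp: eventually_at intro!: exI[of _ r] simp: dist_commute)
    ultimately show ?thesis by (subst meromorphic_on_cong) auto
  qed
  then have "f meromorphic_on UNIV" by (auto simp: meromorphic_on_def)
  with assms show ?thesis by (simp add: mero_poles_le_def)
qed

lemma mero_poles_le_sum:
  assumes "finite A" "\<And>i. i \<in> A \<Longrightarrow> mero_poles_le (f i) k"
  shows "mero_poles_le (\<lambda>z. \<Sum>i\<in>A. f i z) k"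
  using assms
proof (induction rule: finite_induct)
  case empty
  show ?case by (rule mero_poles_leI, intro exI[of _ 1] conjI exI[of _ "\<lambda>_. 0"]) auto
next
  case (insert i A)
  show ?case
  proof (rule mero_poles_leI)
    fix p
    obtain r g where g: "r > 0" "g holomorphic_on ball p r" "\<forall>z\<in>ball p r - {p}. f i z = g z / (z - p) ^ k"
      using insert.prems[of i] unfolding mero_poles_le_def by blast
    obtain r' g' where g': "r' > 0" "g' holomorphic_on ball p r'" "\<forall>z\<in>ball p r' - {p}. (\<Sum>i\<in>A. f i z) = g' z / (z - p) ^ k"
      using insert.IH insert.prems unfolding mero_poles_le_def by blast
    show "\<exists>r>0. \<exists>g. g holomorphic_on ball p r \<and> (\<forall>z\<in>ball p r - {p}. (\<Sum>i\<in>insert i A. f i z) = g z / (z - p) ^ k)"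
    proof (intro exI[of _ "min r r'"] exI[of _ "\<lambda>z. g z + g' z"] conjI ballI)
      show "(\<lambda>z. g z + g' z) holomorphic_on ball p (min r r')"
        using g g' by (intro holomorphic_intros) (auto elim: holomorphic_on_subset)
      fix z assume "z \<in> ball p (min r r') - {p}"
      then show "(\<Sum>i\<in>insert i A. f i z) = (g z + g' z) / (z - p) ^ k"
        using insert.hyps g g' by (simp add: add_divide_distrib)
    qed (use g g' in auto)
  qed
qed

section \<open>Radial parts of classical symbols\<close>

lemma smooth_on_imp_continuous_slice:
  assumes "smooth_on (U \<times> V) f" "x \<in> U"
  shows "continuous_on V (\<lambda>\<xi>. f (x, \<xi>))"
proof -
  have "isCont f (x, \<xi>)" if "\<xi> \<in> V" for \<xi>
    using assms that unfolding smooth_on_def by (metis SigmaI dpd.simps(1) lists.Nil)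
  moreover have "isCont (Pair x) \<xi>" for \<xi> by (intro continuous_intros)
  ultimately have "isCont (\<lambda>\<xi>. f (x, \<xi>)) \<xi>" if "\<xi> \<in> V" for \<xi>
    using that isCont_o2 by blast
  then show ?thesis by (simp add: continuous_at_imp_continuous_on)
qed

lemma jb_powr_le_sphere:
  assumes "e \<le> B"
  shows "jb \<xi> powr e \<le> sqrt (1 + (norm \<xi>)\<^sup>2) powr B"
  unfolding jb_def using assms by (intro powr_mono) auto

text \<open>For |\<xi>| \<ge> 1 one has |\<xi>| \<le> \<open>jb \<xi>\<close> \<le> 2 |\<xi>|; the
  sign of e decides which of the two inequalities applies. The constant depends only on a bound for
  |e|, so it is uniform when the order varies over a compact set of z.\<close>

lemma jb_powr_le_norm:
  assumes "norm \<xi> \<ge> 1" "\<bar>e\<bar> \<le> B"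
  shows "jb \<xi> powr e \<le> 2 powr B * norm \<xi> powr e"
proof (cases "e \<ge> 0")
  case True
  have "jb \<xi> \<le> 2 * norm \<xi>"
    unfolding jb_def using one_le_power[OF assms(1), of 2]
    by (intro real_le_lsqrt) (auto simp: power_mult_distrib)
  then have "jb \<xi> powr e \<le> (2 * norm \<xi>) powr e" using True by (intro powr_mono2) (auto simp: jb_def)
  also have "\<dots> = 2 powr e * norm \<xi> powr e" by (simp add: powr_mult)
  also have "\<dots> \<le> 2 powr B * norm \<xi> powr e" using assms by (intro mult_right_mono powr_mono) auto
  finally show ?thesis .
next
  case False
  have "norm \<xi> \<le> jb \<xi>" unfolding jb_def by (rule real_le_rsqrt) simp
  then have "jb \<xi> powr e \<le> norm \<xi> powr e" using False assms(1) by (intro powr_mono2') auto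
  also have "\<dots> \<le> 2 powr B * norm \<xi> powr e"
    using assms by (intro mult_le_cancel_right1[THEN iffD2] impI conjI ge_one_powr_ge_zero) auto
  finally show ?thesis .
qed

lemma norm_integral_unit_ball_le:
  fixes f :: "'a::euclidean_space \<Rightarrow> complex"
  assumes "f integrable_on (cball 0 1 - {0})" "\<And>w. w \<in> cball 0 1 - {0} \<Longrightarrow> norm (f w) \<le> M"
  shows "norm (integral (cball 0 1 - {0}) f) \<le> M * integral (cball 0 1 - {0::'a}) (\<lambda>_. 1)"
proof -
  have "norm (integral (cball 0 1 - {0}) f) \<le> integral (cball 0 1 - {0}) (\<lambda>_::'a. M * 1)"
    by (rule integral_norm_bound_integral[OF assms(1)]) (use assms(2) const_integrable_unit_ball in auto)
  then show ?thesis by (simp only: integral_mult_right)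
qed

lemma holo_family_continuous:
  assumes "holo_family U \<alpha> \<sigma>" "x \<in> U"
  shows "continuous_on UNIV (\<lambda>\<xi>. \<sigma> z (x, \<xi>))"
proof (rule smooth_on_imp_continuous_slice)
  show "smooth_on (U \<times> UNIV) (\<sigma> z)" using assms(1) unfolding holo_family_def by blast
qed (rule assms(2))

text \<open>By homogeneity the component of degree \<alpha> - m contributes r^(\<alpha>-m) times its
  average over the sphere, and the volume factor r^(n-1) moves the exponents to \<alpha> + n - 1 -
  m. For r \<ge> 1 the cut-off function equals 1 and leaves no trace.\<close>

lemma holo_family_radial_phg:
  fixes U :: "(real^'n) set"
  assumes fam: "holo_family U \<alpha> \<sigma>" and x: "x \<in> U"
  shows "phg UNIV (\<lambda>z. \<alpha> z + of_nat DIM(real^'n) - 1) (\<lambda>z. radial (\<lambda>\<xi>. \<sigma> z (x, \<xi>)))"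
proof -
  let ?n = "DIM(real^'n)"
  let ?B = "cball 0 1 - {0 :: real^'n}"
  from fam obtain \<psi> c where \<alpha>: "\<alpha> holomorphic_on UNIV" and \<psi>: "cutoff_fn \<psi>"
    and csm: "\<And>z j. smooth_on (U \<times> (UNIV - {0})) (c z j)"
    and chom: "\<And>z j. pos_homog U (\<alpha> z - of_nat j) (c z j)"
    and chol: "\<And>j \<xi>. \<xi> \<noteq> 0 \<Longrightarrow> (\<lambda>z. c z j (x, \<xi>)) holomorphic_on UNIV"
    and rest: "\<And>N. let r = (\<lambda>z (x, \<xi>). \<sigma> z (x, \<xi>) - (\<Sum>j<N. complex_of_real (\<psi> \<xi>) * c z j (x, \<xi>))) in
         (\<forall>x\<in>U. \<forall>\<xi>. (\<lambda>z. r z (x, \<xi>)) holomorphic_on UNIV) \<and>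
         (\<forall>K Z. compact K \<and> K \<subseteq> U \<and> compact Z \<longrightarrow> (\<forall>es\<in>lists Basis. \<exists>C. \<forall>z\<in>Z. \<forall>x\<in>K. \<forall>\<xi>.
            norm (dpd es (r z) (x, \<xi>)) \<le> C * jb \<xi> powr (Re (\<alpha> z) - real N - real (nxi es))))"
    unfolding holo_family_def using x by blast
  define \<rho> where "\<rho> N z \<xi> = \<sigma> z (x, \<xi>) - (\<Sum>j<N. complex_of_real (\<psi> \<xi>) * c z j (x, \<xi>))" for N z \<xi>
  have \<rho>hol: "(\<lambda>z. \<rho> N z \<xi>) holomorphic_on UNIV" for N \<xi>
    using rest[of N] x by (simp add: Let_def \<rho>_def)
  have \<rho>bd: "\<exists>C\<ge>0. \<forall>z\<in>Z. \<forall>\<xi>. norm (\<rho> N z \<xi>) \<le> C * jb \<xi> powr (Re (\<alpha> z) - real N)" if Z: "compact Z" for N Z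
  proof -
    have "\<exists>C. \<forall>z\<in>Z. \<forall>x\<in>{x}. \<forall>\<xi>. norm (\<sigma> z (x, \<xi>) - (\<Sum>j<N. complex_of_real (\<psi> \<xi>) * c z j (x, \<xi>)))
        \<le> C * jb \<xi> powr (Re (\<alpha> z) - real N - real (nxi ([] :: ((real^'n) \<times> (real^'n)) list)))"
    proof -
      \<comment> \<open>Only the fibre over x is integrated, so the remainder estimate is taken on
        the compact set {x} and for the empty list of derivatives.\<close>
      have "compact {x} \<and> {x} \<subseteq> U \<and> compact Z" using x Z by simp
      with rest[of N] have "\<forall>es\<in>lists Basis. \<exists>C. \<forall>z\<in>Z. \<forall>x\<in>{x}. \<forall>\<xi>.
            norm (dpd es ((\<lambda>z (x, \<xi>). \<sigma> z (x, \<xi>) - (\<Sum>j<N. complex_of_real (\<psi> \<xi>) * c z j (x, \<xi>))) z) (x, \<xi>))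
             \<le> C * jb \<xi> powr (Re (\<alpha> z) - real N - real (nxi es))"
        unfolding Let_def by blast
      from bspec[OF this lists.Nil] show ?thesis by simp
    qed
    then obtain C where C: "\<And>z \<xi>. z \<in> Z \<Longrightarrow> norm (\<rho> N z \<xi>) \<le> C * jb \<xi> powr (Re (\<alpha> z) - real N)"
      by (auto simp: \<rho>_def nxi_def)
    have "norm (\<rho> N z \<xi>) \<le> max C 0 * jb \<xi> powr (Re (\<alpha> z) - real N)" if "z \<in> Z" for z \<xi>
    proof -
      have "C * jb \<xi> powr (Re (\<alpha> z) - real N) \<le> max C 0 * jb \<xi> powr (Re (\<alpha> z) - real N)"
        by (intro mult_right_mono) auto
      with C[OF that] show ?thesis by (rule order_trans)
    qed
    then show ?thesis by (intro exI[of _ "max C 0"]) auto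
  qed
  have \<sigma>\<rho>: "\<rho> 0 z \<xi> = \<sigma> z (x, \<xi>)" for z \<xi> by (simp add: \<rho>_def)
  have \<psi>1: "\<psi> \<xi> = 1" if "norm \<xi> \<ge> 1" for \<xi> using \<psi> that by (simp add: cutoff_fn_def)
  \<comment> \<open>The homogeneous components come with holomorphy at each point but without bounds
    uniform in z. On the unit sphere a component is the difference of two successive remainders,
    which do have such bounds; this gives the domination needed for the holomorphy of
    \<kappa>.\<close>
  have c\<rho>: "c z j (x, \<xi>) = \<rho> j z \<xi> - \<rho> (Suc j) z \<xi>" if "norm \<xi> \<ge> 1" for z j \<xi>
    using \<psi>1[OF that] by (simp add: \<rho>_def)
  have \<rho>sph: "\<exists>M\<ge>0. \<forall>z\<in>Z. \<forall>\<xi>. norm \<xi> \<le> T \<longrightarrow> norm (\<rho> N z \<xi>) \<le> M" if Z: "compact Z" for N Z T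
  proof -
    obtain C where C: "C \<ge> 0" "\<And>z \<xi>. z \<in> Z \<Longrightarrow> norm (\<rho> N z \<xi>) \<le> C * jb \<xi> powr (Re (\<alpha> z) - real N)"
      using \<rho>bd[OF Z, of N] by blast
    obtain A where A: "A \<ge> 0" "\<And>z. z \<in> Z \<Longrightarrow> norm (\<alpha> z) \<le> A"
      using compact_holomorphic_bound[OF Z subset_UNIV \<alpha>] by blast
    have "norm (\<rho> N z \<xi>) \<le> C * sqrt (1 + T\<^sup>2) powr A" if z: "z \<in> Z" and \<xi>: "norm \<xi> \<le> T" for z \<xi>
    proof -
      have "Re (\<alpha> z) - real N \<le> A" using A(2)[OF z] complex_Re_le_cmod[of "\<alpha> z"] by linarith
      from jb_powr_le_sphere[OF this, of \<xi>] C(2)[OF z, of \<xi>] C(1)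
      have "norm (\<rho> N z \<xi>) \<le> C * sqrt (1 + (norm \<xi>)\<^sup>2) powr A"
        by (meson mult_left_mono order_trans)
      also have "\<dots> \<le> C * sqrt (1 + T\<^sup>2) powr A"
        using C A \<xi> by (intro mult_left_mono powr_mono2) (auto intro: power_mono)
      finally show ?thesis .
    qed
    then show ?thesis using C(1) by (intro exI[of _ "C * sqrt (1 + T\<^sup>2) powr A"]) auto
  qed
  have \<sigma>c: "continuous_on UNIV (\<lambda>\<xi>. \<sigma> z (x, \<xi>))" for z by (rule holo_family_continuous[OF fam x])
  have \<sigma>i: "(\<lambda>w. \<sigma> z (x, r *\<^sub>R sgn w)) integrable_on ?B" for z r
    by (rule integrable_sphere_scaled[OF \<sigma>c])
  have cc: "continuous_on (sphere 0 1) (\<lambda>\<xi>. c z j (x, \<xi>))" for z j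
    by (rule continuous_on_subset[OF smooth_on_imp_continuous_slice[OF csm x]]) auto
  have ci: "(\<lambda>w. c z j (x, sgn w)) integrable_on ?B" for z j
    by (rule integrable_sphere_fun[OF cc])
  define \<kappa> where "\<kappa> j z = of_nat ?n * integral ?B (\<lambda>w. c z j (x, sgn w))" for j z
  have \<kappa>hol: "\<kappa> j holomorphic_on UNIV" for j
  proof -
    have "(\<lambda>z. integral ?B (\<lambda>w. c z j (x, sgn w))) holomorphic_on UNIV"
    proof (rule holomorphic_on_integral_param)
      show "(\<lambda>z. c z j (x, sgn w)) holomorphic_on UNIV" if "w \<in> ?B" for w
        by (rule chol) (use that in \<open>auto simp: sgn_zero_iff\<close>)
      show "\<exists>M. \<forall>z\<in>Z. \<forall>w\<in>?B. norm (c z j (x, sgn w)) \<le> M" if Z: "compact Z" for Z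
      proof -
        obtain M where M: "\<forall>z\<in>Z. \<forall>\<xi>. norm \<xi> \<le> 1 \<longrightarrow> norm (\<rho> j z \<xi>) \<le> M" using \<rho>sph[OF Z] by blast
        obtain M' where M': "\<forall>z\<in>Z. \<forall>\<xi>. norm \<xi> \<le> 1 \<longrightarrow> norm (\<rho> (Suc j) z \<xi>) \<le> M'" using \<rho>sph[OF Z] by blast
        have "norm (c z j (x, sgn w)) \<le> M + M'" if "z \<in> Z" "w \<in> ?B" for z w
        proof -
          have nw: "norm (sgn w) = 1" using that by (simp add: norm_sgn)
          then have "norm (c z j (x, sgn w)) \<le> norm (\<rho> j z (sgn w)) + norm (\<rho> (Suc j) z (sgn w))"
            by (simp add: c\<rho> norm_triangle_ineq4)
          also have "\<dots> \<le> M + M'" using M M' that nw by (intro add_mono) auto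
          finally show ?thesis .
        qed
        then show ?thesis by blast
      qed
    qed (auto intro: ci const_integrable_unit_ball)
    then show ?thesis unfolding \<kappa>_def by (intro holomorphic_intros)
  qed
  define V where "V = integral ?B (\<lambda>_. 1::real)"
  have V: "V \<ge> 0" unfolding V_def by (rule Henstock_Kurzweil_Integration.integral_nonneg) (auto intro: const_integrable_unit_ball)
  let ?b = "\<lambda>z. \<alpha> z + of_nat ?n - 1"
  let ?g = "\<lambda>z. radial (\<lambda>\<xi>. \<sigma> z (x, \<xi>))"
  have remainder: "?g z r - (\<Sum>m<N. \<kappa> m z * complex_of_real r powr (?b z - of_nat m))
      = of_nat ?n * complex_of_real r ^ (?n - 1) * integral ?B (\<lambda>w. \<rho> N z (r *\<^sub>R sgn w))"
    and rem_int: "(\<lambda>w. \<rho> N z (r *\<^sub>R sgn w)) integrable_on ?B" if r: "r \<ge> 1" for z r N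
  proof -
    have pt: "\<rho> N z (r *\<^sub>R sgn w) = \<sigma> z (x, r *\<^sub>R sgn w)
        - (\<Sum>m<N. complex_of_real r powr (\<alpha> z - of_nat m) * c z m (x, sgn w))" if "w \<in> ?B" for w
    proof -
      have nw: "norm (sgn w) = 1" and ne: "sgn w \<noteq> 0" using that by (auto simp: norm_sgn sgn_zero_iff)
      have "\<psi> (r *\<^sub>R sgn w) = 1" using nw r by (intro \<psi>1) simp
      moreover have "c z m (x, r *\<^sub>R sgn w) = complex_of_real r powr (\<alpha> z - of_nat m) * c z m (x, sgn w)" for m
        using chom[of z m] x ne r unfolding pos_homog_def by auto
      ultimately show ?thesis by (simp add: \<rho>_def)
    qed
    have hs: "((\<lambda>w. \<sigma> z (x, r *\<^sub>R sgn w)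
        - (\<Sum>m<N. complex_of_real r powr (\<alpha> z - of_nat m) * c z m (x, sgn w))) has_integral
        integral ?B (\<lambda>w. \<sigma> z (x, r *\<^sub>R sgn w))
        - (\<Sum>m<N. complex_of_real r powr (\<alpha> z - of_nat m) * integral ?B (\<lambda>w. c z m (x, sgn w)))) ?B"
      by (intro has_integral_diff has_integral_sum has_integral_mult_right integrable_integral \<sigma>i ci) auto
    have h\<rho>: "((\<lambda>w. \<rho> N z (r *\<^sub>R sgn w)) has_integral
        integral ?B (\<lambda>w. \<sigma> z (x, r *\<^sub>R sgn w))
        - (\<Sum>m<N. complex_of_real r powr (\<alpha> z - of_nat m) * integral ?B (\<lambda>w. c z m (x, sgn w)))) ?B"
      by (rule has_integral_eq[OF _ hs]) (simp add: pt)
    then show "(\<lambda>w. \<rho> N z (r *\<^sub>R sgn w)) integrable_on ?B" by (rule has_integral_integrable)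
    have pw: "complex_of_real r powr (?b z - of_nat m) = complex_of_real r ^ (?n - 1) * complex_of_real r powr (\<alpha> z - of_nat m)" for m
    proof -
      have "?b z - of_nat m = of_nat (?n - 1) + (\<alpha> z - of_nat m)"
        using DIM_positive[where 'a = "real^'n"] by (simp add: of_nat_diff)
      moreover have "complex_of_real r powr of_nat (?n - 1) = complex_of_real r ^ (?n - 1)"
        using r by (intro powr_nat') auto
      ultimately show ?thesis by (simp only: powr_add)
    qed
    show "?g z r - (\<Sum>m<N. \<kappa> m z * complex_of_real r powr (?b z - of_nat m))
      = of_nat ?n * complex_of_real r ^ (?n - 1) * integral ?B (\<lambda>w. \<rho> N z (r *\<^sub>R sgn w))"
      unfolding integral_unique[OF h\<rho>] radial_def pw \<kappa>_def right_diff_distrib sum_distrib_left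
      by (simp add: mult_ac)
  qed
  have ex: "expands Z ?b \<kappa> ?g N" if Z: "compact Z" for Z N
  proof -
    obtain C where C: "C \<ge> 0" "\<And>z \<xi>. z \<in> Z \<Longrightarrow> norm (\<rho> N z \<xi>) \<le> C * jb \<xi> powr (Re (\<alpha> z) - real N)"
      using \<rho>bd[OF Z, of N] by blast
    obtain A where A: "A \<ge> 0" "\<And>z. z \<in> Z \<Longrightarrow> norm (\<alpha> z) \<le> A"
      using compact_holomorphic_bound[OF Z subset_UNIV \<alpha>] by blast
    define D where "D = C * 2 powr (A + real N)"
    have D: "norm (\<rho> N z \<xi>) \<le> D * norm \<xi> powr (Re (\<alpha> z) - real N)" if z: "z \<in> Z" and \<xi>: "norm \<xi> \<ge> 1" for z \<xi>
    proof -
      have "\<bar>Re (\<alpha> z) - real N\<bar> \<le> A + real N" using A(2)[OF z] abs_Re_le_cmod[of "\<alpha> z"] by linarith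
      from jb_powr_le_norm[OF \<xi> this] C(2)[OF z, of \<xi>] C(1) show ?thesis
        unfolding D_def mult.assoc by (meson mult_left_mono order_trans)
    qed
    show ?thesis
      unfolding expands_def
    proof (rule unif_boundI)
      fix z r assume z: "z \<in> Z" "(r::real) \<ge> 1"
      have "norm (integral ?B (\<lambda>w. \<rho> N z (r *\<^sub>R sgn w))) \<le> (D * r powr (Re (\<alpha> z) - real N)) * V"
        unfolding V_def
      proof (rule norm_integral_unit_ball_le[OF rem_int[OF z(2)]])
        fix w assume "w \<in> ?B"
        then have "norm (r *\<^sub>R sgn w) = r" using z by (simp add: norm_sgn)
        then show "norm (\<rho> N z (r *\<^sub>R sgn w)) \<le> D * r powr (Re (\<alpha> z) - real N)"
          using D[OF z(1), of "r *\<^sub>R sgn w"] z by simp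
      qed
      then have "norm (of_nat ?n * complex_of_real r ^ (?n - 1) * integral ?B (\<lambda>w. \<rho> N z (r *\<^sub>R sgn w)))
         \<le> (real ?n * r ^ (?n - 1)) * ((D * r powr (Re (\<alpha> z) - real N)) * V)"
        unfolding norm_mult norm_power using z by (intro mult_mono) auto
      also have "r ^ (?n - 1) = r powr real (?n - 1)" using z by (subst powr_realpow) auto
      also have "(real ?n * r powr real (?n - 1)) * ((D * r powr (Re (\<alpha> z) - real N)) * V)
         = (real ?n * D * V) * r powr (real (?n - 1) + (Re (\<alpha> z) - real N))"
        by (simp only: powr_add mult_ac)
      also have "real (?n - 1) + (Re (\<alpha> z) - real N) = Re (?b z) - real N"
        using DIM_positive[where 'a = "real^'n"] by (simp add: of_nat_diff)
      finally show "norm (?g z r - (\<Sum>m<N. \<kappa> m z * complex_of_real r powr (?b z - of_nat m)))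
         \<le> (real ?n * D * V) * r powr (Re (?b z) - real N)"
        unfolding remainder[OF z(2)] .
    qed
  qed
  show ?thesis
    unfolding phg_def
  proof (intro conjI ballI allI impI; (elim conjE)?)
    show "?b holomorphic_on UNIV" by (intro holomorphic_intros \<alpha>)
    show "continuous_on {0..} (?g z)" for z by (rule continuous_on_radial[OF \<sigma>c])
    show "(\<lambda>z. ?g z r) holomorphic_on UNIV" if r: "r \<ge> 0" for r
    proof -
      have "(\<lambda>z. integral ?B (\<lambda>w. \<sigma> z (x, r *\<^sub>R sgn w))) holomorphic_on UNIV"
      proof (rule holomorphic_on_integral_param)
        show "(\<lambda>z. \<sigma> z (x, r *\<^sub>R sgn w)) holomorphic_on UNIV" for w
          using \<rho>hol[of 0 "r *\<^sub>R sgn w"] by (simp add: \<sigma>\<rho>)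
        show "\<exists>M. \<forall>z\<in>Z. \<forall>w\<in>?B. norm (\<sigma> z (x, r *\<^sub>R sgn w)) \<le> M" if Z: "compact Z" for Z
        proof -
          obtain M where M: "\<forall>z\<in>Z. \<forall>\<xi>. norm \<xi> \<le> r \<longrightarrow> norm (\<rho> 0 z \<xi>) \<le> M" using \<rho>sph[OF Z] by blast
          have "norm (\<sigma> z (x, r *\<^sub>R sgn w)) \<le> M" if "z \<in> Z" "w \<in> ?B" for z w
            using M[rule_format, of z "r *\<^sub>R sgn w"] that r by (simp add: \<sigma>\<rho> norm_sgn)
          then show ?thesis by blast
        qed
      qed (auto intro: \<sigma>i const_integrable_unit_ball)
      then show ?thesis unfolding radial_def by (intro holomorphic_intros)
    qed
    show "\<exists>C. \<forall>z\<in>Z. \<forall>r\<in>{0..1}. norm (?g z r) \<le> C" if Z: "compact Z" for Z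
    proof -
      obtain M where M: "M \<ge> 0" "\<forall>z\<in>Z. \<forall>\<xi>. norm \<xi> \<le> 1 \<longrightarrow> norm (\<rho> 0 z \<xi>) \<le> M" using \<rho>sph[OF Z] by blast
      have "norm (?g z r) \<le> (real ?n * 1) * (M * V)" if z: "z \<in> Z" and r: "r \<in> {0..1}" for z r
      proof -
        have "norm (integral ?B (\<lambda>w. \<sigma> z (x, r *\<^sub>R sgn w))) \<le> M * V"
          unfolding V_def
        proof (rule norm_integral_unit_ball_le[OF \<sigma>i])
          show "norm (\<sigma> z (x, r *\<^sub>R sgn w)) \<le> M" if "w \<in> ?B" for w
            using M(2)[rule_format, OF z, of "r *\<^sub>R sgn w"] r that by (simp add: \<sigma>\<rho> norm_sgn)
        qed
        moreover have "r ^ (?n - 1) \<le> 1" using r by (intro power_le_one) auto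
        ultimately show ?thesis
          unfolding radial_def norm_mult norm_power using r M V by (intro mult_mono) auto
      qed
      then show ?thesis by blast
    qed
    show "\<exists>c. (\<forall>m. c m holomorphic_on UNIV) \<and> (\<forall>Z N. compact Z \<and> Z \<subseteq> UNIV \<longrightarrow> expands Z ?b c ?g N)"
      using \<kappa>hol ex by (intro exI[of _ \<kappa>]) auto
  qed
qed

section \<open>Cut-off integrals of symbol families\<close>

text \<open>Working with lists over \<open>I\<close> covers the given order of the symbols, its
  permutations and the single factors of the product by the same lemmas.\<close>

locale symbol_families =
  fixes U :: "(real^'n) set" and x :: "real^'n" and q :: complex and I :: "nat set"
    and a :: "nat \<Rightarrow> complex" and fam :: "nat \<Rightarrow> complex \<Rightarrow> 'n symb"
  assumes x: "x \<in> U" and q: "q \<noteq> 0"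
    and fam: "\<And>i. i \<in> I \<Longrightarrow> holo_family U (\<lambda>z. q * z + a i) (fam i)"
begin

text \<open>The order raised by the dimension n, so that the radial density has the exponents
  \<beta> - 1 - m and its integral the exponents \<beta> - m.\<close>

definition \<beta> :: "nat \<Rightarrow> complex \<Rightarrow> complex" where
  "\<beta> i z = q * z + a i + of_nat DIM(real^'n)"

definition rad :: "nat \<Rightarrow> complex \<Rightarrow> real \<Rightarrow> complex" where
  "rad i z = radial (\<lambda>\<xi>. fam i z (x, \<xi>))"

definition exponents :: "nat list \<Rightarrow> complex \<Rightarrow> complex set" where
  "exponents js z = {prefix_sum (map (\<lambda>i. \<beta> i z) js) l - of_nat m | l m. l \<in> {1..length js}}"

text \<open>At such points no exponent of the expansion is 0. All integers are excluded, in
  accordance with \<open>pole_set\<close>; since the integers form a closed set, the good points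
  form an open one.\<close>

definition good :: "nat list \<Rightarrow> complex \<Rightarrow> bool" where
  "good js z \<longleftrightarrow> (\<forall>l\<in>{1..length js}. prefix_sum (map (\<lambda>i. \<beta> i z) js) l \<notin> \<int>)"

definition fp :: "nat list \<Rightarrow> complex \<Rightarrow> complex" where
  "fp js z = cutoff_int (pcomp (map (\<lambda>i. fam i z) js) x)"

lemma good_not_exponent:
  assumes "good js z"
  shows "0 \<notin> exponents js z"
proof
  assume "0 \<in> exponents js z"
  then obtain l m where "prefix_sum (map (\<lambda>i. \<beta> i z) js) l = of_nat m" "l \<in> {1..length js}"
    by (auto simp: exponents_def)
  with assms show False unfolding good_def by (metis Ints_of_nat)
qed

lemma phg_rad: "i \<in> I \<Longrightarrow> phg UNIV (\<lambda>z. \<beta> i z - 1) (rad i)"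
  using holo_family_radial_phg[OF fam x] by (simp add: \<beta>_def rad_def[abs_def])

lemma integral_pcomp:
  assumes "set js \<subseteq> I" "js \<noteq> []" "R \<ge> 0"
  shows "integral (cball 0 R) (pcomp (map (\<lambda>i. fam i z) js) x) = nested_int (map (\<lambda>i. rad i z) js) R"
proof -
  obtain j js' where js: "js = j # js'" using assms by (cases js) auto
  have "\<forall>s\<in>set (fam j z # map (\<lambda>i. fam i z) js'). continuous_on UNIV (\<lambda>\<xi>. s (x, \<xi>))"
    using assms(1) js holo_family_continuous[OF fam x] by auto
  from pcomp_Cons(2)[OF this assms(3)] show ?thesis by (simp add: js rad_def o_def)
qed

text \<open>At a good point 0 is not an exponent, so K / w^k is the constant term and hence the
  cut-off integral. The lemma is applied with w = 1 on the open set of good points, which yields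
  holomorphy, and with w = z - p on a ball about p, which yields the order of the pole.\<close>

lemma fp_eq_quotient:
  assumes js: "set js \<subseteq> I" "js \<noteq> []" and \<Omega>: "open \<Omega>" and w: "w holomorphic_on \<Omega>"
    and u: "\<forall>l\<in>{1..length js}. \<exists>u. (\<forall>m. u m holomorphic_on \<Omega>) \<and>
       (\<forall>z\<in>\<Omega>. \<forall>m. u m z * (prefix_sum (map (\<lambda>i. \<beta> i z) js) l - of_nat m) = w z)"
  shows "\<exists>K. K holomorphic_on \<Omega> \<and> (\<forall>z\<in>\<Omega>. w z \<noteq> 0 \<longrightarrow> good js z \<longrightarrow>
     fp js z = K z / w z ^ length js \<and>
     log_expansion (exponents js z) (\<lambda>R. nested_int (map (\<lambda>i. rad i z) js) R - fp js z))"
proof -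
  let ?fs = "map (\<lambda>i. (\<beta> i, rad i)) js"
  have "\<exists>K. K holomorphic_on \<Omega> \<and> (\<forall>z\<in>\<Omega>.
     log_expansion {prefix_sum (map (\<lambda>p. fst p z) ?fs) l - of_nat m | l m. l \<in> {1..length ?fs}}
       (\<lambda>R. w z ^ length ?fs * nested_int (map (\<lambda>p. snd p z) ?fs) R - K z))"
  proof (rule nested_int_family[OF \<Omega> w])
    show "\<forall>(B, S)\<in>set ?fs. B holomorphic_on \<Omega> \<and> phg \<Omega> (\<lambda>z. B z - 1) S"
      using js(1) phg_subset[OF phg_rad] by (auto simp: \<beta>_def[abs_def] intro!: holomorphic_intros)
  qed (use js u in \<open>auto simp: o_def\<close>)
  then obtain K where K: "K holomorphic_on \<Omega>" "\<And>z. z \<in> \<Omega> \<Longrightarrow> log_expansion (exponents js z)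
       (\<lambda>R. w z ^ length js * nested_int (map (\<lambda>i. rad i z) js) R - K z)"
    by (auto simp: o_def exponents_def)
  have "fp js z = K z / w z ^ length js"
    and "log_expansion (exponents js z) (\<lambda>R. nested_int (map (\<lambda>i. rad i z) js) R - K z / w z ^ length js)"
    if z: "z \<in> \<Omega>" "w z \<noteq> 0" "good js z" for z
  proof -
    have "log_expansion (exponents js z)
       (\<lambda>R. (1 / w z ^ length js) * (w z ^ length js * nested_int (map (\<lambda>i. rad i z) js) R - K z))"
      by (rule log_expansion_cmult[OF K(2)[OF z(1)]])
    then show 1: "log_expansion (exponents js z) (\<lambda>R. nested_int (map (\<lambda>i. rad i z) js) R - K z / w z ^ length js)"
      by (rule log_expansion_cong) (use z(2) in \<open>simp add: diff_divide_distrib\<close>)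
    show "fp js z = K z / w z ^ length js"
      unfolding fp_def
    proof (rule cutoff_int_eqI[OF _ good_not_exponent[OF z(3)]])
      show "log_expansion (exponents js z)
         (\<lambda>R. integral (cball 0 R) (pcomp (map (\<lambda>i. fam i z) js) x) - K z / w z ^ length js)"
        by (rule log_expansion_cong[OF 1]) (simp add: integral_pcomp[OF js])
    qed
  qed
  with K(1) show ?thesis by (intro exI[of _ K]) simp
qed

lemma prefix_sum_affine:
  "l \<le> length js \<Longrightarrow> prefix_sum (map (\<lambda>i. \<beta> i z) js) l
     = (of_nat l * q) * z + prefix_sum (map (\<lambda>i. a i + of_nat DIM(real^'n)) js) l"
proof (induction js arbitrary: l)
  case (Cons j js)
  then show ?case by (cases l) (simp_all add: \<beta>_def algebra_simps)
qed simp

lemma prefix_sum_holomorphic: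
  assumes "l \<le> length js"
  shows "(\<lambda>z. prefix_sum (map (\<lambda>i. \<beta> i z) js) l) holomorphic_on \<Omega>"
  unfolding prefix_sum_affine[OF assms] by (intro holomorphic_intros)

lemma eventually_good: "\<forall>\<^sub>F z in at p. good js z"
  unfolding good_def
proof (rule eventually_ball_finite, simp, rule ballI)
  fix l assume "l \<in> {1..length js}"
  then show "\<forall>\<^sub>F z in at p. prefix_sum (map (\<lambda>i. \<beta> i z) js) l \<notin> \<int>"
    using eventually_affine_not_Ints[of "of_nat l * q" "prefix_sum (map (\<lambda>i. a i + of_nat DIM(real^'n)) js) l" p] q
    by (simp add: prefix_sum_affine[of l js])
qed

lemma open_good: "open {z. good js z}"
proof -
  have "open (\<Inter>l\<in>{1..length js}. (\<lambda>z. prefix_sum (map (\<lambda>i. \<beta> i z) js) l) -` (- \<int>))"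
  proof (intro open_INT ballI)
    fix l assume "l \<in> {1..length js}"
    then have "continuous_on UNIV (\<lambda>z. prefix_sum (map (\<lambda>i. \<beta> i z) js) l)"
      by (intro holomorphic_on_imp_continuous_on prefix_sum_holomorphic) simp
    then show "open ((\<lambda>z. prefix_sum (map (\<lambda>i. \<beta> i z) js) l) -` (- \<int>))"
      using closed_Ints by (intro open_vimage) (auto simp: open_Compl)
  qed simp
  also have "(\<Inter>l\<in>{1..length js}. (\<lambda>z. prefix_sum (map (\<lambda>i. \<beta> i z) js) l) -` (- \<int>)) = {z. good js z}"
    by (auto simp: good_def)
  finally show ?thesis .
qed

lemma good_fp:
  assumes js: "set js \<subseteq> I" "js \<noteq> []"
  shows "fp js holomorphic_on {z. good js z}"
    and "good js z \<Longrightarrow> log_expansion (exponents js z) (\<lambda>R. nested_int (map (\<lambda>i. rad i z) js) R - fp js z)"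
proof -
  let ?\<Omega> = "{z. good js z}"
  have "\<exists>K. K holomorphic_on ?\<Omega> \<and> (\<forall>z\<in>?\<Omega>. (1::complex) \<noteq> 0 \<longrightarrow> good js z \<longrightarrow>
     fp js z = K z / 1 ^ length js \<and>
     log_expansion (exponents js z) (\<lambda>R. nested_int (map (\<lambda>i. rad i z) js) R - fp js z))"
  proof (rule fp_eq_quotient[OF js open_good, where w = "\<lambda>_. 1"], simp, rule ballI)
    fix l assume l: "l \<in> {1..length js}"
    have ne: "prefix_sum (map (\<lambda>i. \<beta> i z) js) l - of_nat m \<noteq> 0" if "z \<in> ?\<Omega>" for z m
    proof
      assume "prefix_sum (map (\<lambda>i. \<beta> i z) js) l - of_nat m = 0"
      then have "prefix_sum (map (\<lambda>i. \<beta> i z) js) l \<in> \<int>" by (metis Ints_of_nat eq_iff_diff_eq_0)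
      with that l show False by (auto simp: good_def)
    qed
    show "\<exists>u. (\<forall>m. u m holomorphic_on ?\<Omega>) \<and>
       (\<forall>z\<in>?\<Omega>. \<forall>m. u m z * (prefix_sum (map (\<lambda>i. \<beta> i z) js) l - of_nat m) = 1)"
    proof (intro exI[of _ "\<lambda>m z. 1 / (prefix_sum (map (\<lambda>i. \<beta> i z) js) l - of_nat m)"] conjI allI ballI)
      show "(\<lambda>z. 1 / (prefix_sum (map (\<lambda>i. \<beta> i z) js) l - of_nat m)) holomorphic_on ?\<Omega>" for m
        by (intro holomorphic_intros prefix_sum_holomorphic ne) (use l in auto)
      show "1 / (prefix_sum (map (\<lambda>i. \<beta> i z) js) l - of_nat m) * (prefix_sum (map (\<lambda>i. \<beta> i z) js) l - of_nat m) = 1"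
        if "z \<in> ?\<Omega>" for z m
        using ne[OF that, of m] by simp
    qed
  qed
  then obtain K where K: "K holomorphic_on ?\<Omega>"
    and K': "\<forall>z\<in>?\<Omega>. (1::complex) \<noteq> 0 \<longrightarrow> good js z \<longrightarrow> fp js z = K z / 1 ^ length js \<and>
      log_expansion (exponents js z) (\<lambda>R. nested_int (map (\<lambda>i. rad i z) js) R - fp js z)"
    by (elim exE conjE)
  show "fp js holomorphic_on ?\<Omega>" by (rule holomorphic_transform[OF K]) (use K' in simp)
  show "good js z \<Longrightarrow> log_expansion (exponents js z) (\<lambda>R. nested_int (map (\<lambda>i. rad i z) js) R - fp js z)"
    using K' one_neq_zero by blast
qed

lemma fp_mero_poles_le:
  assumes js: "set js \<subseteq> I" "js \<noteq> []"
  shows "mero_poles_le (fp js) (length js)"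
proof (rule mero_poles_leI)
  fix p
  obtain r where r: "r > 0" "\<And>z. z \<in> ball p r - {p} \<Longrightarrow> good js z"
    using eventually_good[of js p] by (auto simp: eventually_at dist_commute)
  have "\<exists>K. K holomorphic_on ball p r \<and> (\<forall>z\<in>ball p r. z - p \<noteq> 0 \<longrightarrow> good js z \<longrightarrow>
     fp js z = K z / (z - p) ^ length js \<and>
     log_expansion (exponents js z) (\<lambda>R. nested_int (map (\<lambda>i. rad i z) js) R - fp js z))"
  proof (rule fp_eq_quotient[OF js open_ball])
    show "(\<lambda>z. z - p) holomorphic_on ball p r" by (intro holomorphic_intros)
    show "\<forall>l\<in>{1..length js}. \<exists>u. (\<forall>m. u m holomorphic_on ball p r) \<and>
       (\<forall>z\<in>ball p r. \<forall>m. u m z * (prefix_sum (map (\<lambda>i. \<beta> i z) js) l - of_nat m) = z - p)"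
    proof
      fix l assume l: "l \<in> {1..length js}"
      let ?b = "\<lambda>z. prefix_sum (map (\<lambda>i. \<beta> i z) js) l"
      have lq: "of_nat l * q \<noteq> 0" using l q by simp
      have aff: "?b z - ?b p = of_nat l * q * (z - p)" for z
        using prefix_sum_affine[of l js z] prefix_sum_affine[of l js p] l by (simp add: algebra_simps)
      \<comment> \<open>The partial sum \<open>?b\<close> is affine in z with slope l q. If it
        equals m at p, then \<open>?b z - m\<close> is l q (z - p) and division by it cancels w.
        Otherwise it has no zero in the ball, because r was chosen such that every point other than
        p is good.\<close>
      define u where "u m z = (if ?b p = of_nat m then 1 / (of_nat l * q) else (z - p) / (?b z - of_nat m))" for m z
      have ne: "?b z - of_nat m \<noteq> 0" if "?b p \<noteq> of_nat m" "z \<in> ball p r" for z m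
      proof (cases "z = p")
        case False
        then have "good js z" using r that by auto
        then have "?b z \<notin> \<int>" using l by (auto simp: good_def)
        then show ?thesis by (metis Ints_of_nat eq_iff_diff_eq_0)
      qed (use that in auto)
      have "u m holomorphic_on ball p r" for m
      proof (cases "?b p = of_nat m")
        case True
        then have "u m = (\<lambda>z. 1 / (of_nat l * q))" by (auto simp: u_def)
        then show ?thesis by simp
      next
        case False
        have "(\<lambda>z. (z - p) / (?b z - of_nat m)) holomorphic_on ball p r"
          using False l by (intro holomorphic_intros prefix_sum_holomorphic ne) auto
        moreover have "u m = (\<lambda>z. (z - p) / (?b z - of_nat m))" using False by (auto simp: u_def)
        ultimately show ?thesis by simp
      qed
      moreover have "u m z * (?b z - of_nat m) = z - p" if "z \<in> ball p r" for z m
      proof (cases "?b p = of_nat m")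
        case True
        then show ?thesis using aff[of z] lq by (simp add: u_def)
      next
        case False
        then show ?thesis using ne[OF False that] by (simp add: u_def)
      qed
      ultimately show "\<exists>u. (\<forall>m. u m holomorphic_on ball p r) \<and> (\<forall>z\<in>ball p r. \<forall>m. u m z * (?b z - of_nat m) = z - p)"
        by (intro exI[of _ u]) auto
    qed
  qed
  then obtain K where "K holomorphic_on ball p r"
    "\<And>z. z \<in> ball p r \<Longrightarrow> z \<noteq> p \<Longrightarrow> good js z \<Longrightarrow> fp js z = K z / (z - p) ^ length js"
    by auto
  with r show "\<exists>r>0. \<exists>g. g holomorphic_on ball p r \<and> (\<forall>z\<in>ball p r - {p}. fp js z = g z / (z - p) ^ length js)"
    by (intro exI[of _ r] conjI exI[of _ K]) auto
qed

text \<open>The same function of R, the product of the one-dimensional integrals, is expanded in two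
  ways: factor by factor and as a sum over orderings. The assumption on subset sums keeps 0 out of
  the exponents of the product and also makes every ordering good, as its partial sums are subset
  sums.\<close>

lemma prod_fp_eq_sum:
  assumes I: "finite I" "I \<noteq> {}"
    and z: "\<forall>J\<in>Pow I - {{}}. (\<Sum>i\<in>J. \<beta> i z) \<notin> \<int>"
  shows "(\<Prod>i\<in>I. fp [i] z) = (\<Sum>js\<in>permutations_of_set I. fp js z)"
proof -
  have good: "good js z" if "set js \<subseteq> I" "distinct js" for js
    unfolding good_def
  proof
    fix l assume l: "l \<in> {1..length js}"
    have "prefix_sum (map (\<lambda>i. \<beta> i z) js) l = (\<Sum>i\<in>set (take l js). \<beta> i z)"
      using that by (simp add: prefix_sum_def take_map sum_list_distinct_conv_sum_set)
    moreover have "set (take l js) \<in> Pow I - {{}}"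
      using that l set_take_subset[of l js] by auto
    ultimately show "prefix_sum (map (\<lambda>i. \<beta> i z) js) l \<notin> \<int>" using z by simp
  qed
  let ?F = "\<lambda>R. \<Prod>i\<in>I. nested_int [rad i z] R"
  let ?T = "{(\<Sum>i\<in>J. \<beta> i z) - of_nat m | J m. J \<subseteq> I \<and> J \<noteq> {}}"
  have "log_expansion {\<beta> i z - of_nat m | m. True} (\<lambda>R. nested_int [rad i z] R - fp [i] z)" if "i \<in> I" for i
  proof -
    have "exponents [i] z = {\<beta> i z - of_nat m | m. True}"
    proof -
      have "exponents [i] z = {prefix_sum [\<beta> i z] (Suc 0) - of_nat m | m. True}"
        unfolding exponents_def by (auto simp: le_Suc_eq)
      then show ?thesis by simp
    qed
    then show ?thesis using good_fp(2)[of "[i]" z] good[of "[i]"] that by simp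
  qed
  then have 1: "log_expansion ?T (\<lambda>R. ?F R - (\<Prod>i\<in>I. fp [i] z))"
    using log_expansion_prod[OF I(1), of "\<lambda>i. \<beta> i z" "\<lambda>i. nested_int [rad i z]" "\<lambda>i. fp [i] z"] by blast
  have T: "0 \<notin> ?T"
  proof
    assume "0 \<in> ?T"
    then obtain J m where J: "(\<Sum>i\<in>J. \<beta> i z) = of_nat m" "J \<subseteq> I" "J \<noteq> {}" by auto
    with z have "of_nat m \<notin> (\<int> :: complex set)" by (metis Diff_iff PowI singletonD)
    then show False by simp
  qed
  \<comment> \<open>The exponents differ from one ordering to the next; the complement of {0} is a
    common set that still keeps the constant term determined.\<close>
  have "log_expansion (- {0}) (\<lambda>R. \<Sum>js\<in>permutations_of_set I. nested_int (map (\<lambda>i. rad i z) js) R - fp js z)"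
  proof (rule log_expansion_sum)
    fix js assume "js \<in> permutations_of_set I"
    then have js: "set js = I" "distinct js" by (auto dest: permutations_of_setD)
    with I have "js \<noteq> []" by auto
    show "log_expansion (- {0}) (\<lambda>R. nested_int (map (\<lambda>i. rad i z) js) R - fp js z)"
      by (rule log_expansion_mono[OF good_fp(2)]) (use js \<open>js \<noteq> []\<close> good good_not_exponent in auto)
  qed simp
  then have 2: "log_expansion (- {0}) (\<lambda>R. ?F R - (\<Sum>js\<in>permutations_of_set I. fp js z))"
  proof (rule log_expansion_cong)
    fix R :: real assume "R \<ge> 1"
    then have "?F R = (\<Sum>js\<in>permutations_of_set I. nested_int (map (\<lambda>i. rad i z) js) R)"
      using prod_integral_eq_sum_nested_int[of I "\<lambda>i. rad i z" R] I phgD(2)[OF phg_rad] by simp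
    then show "?F R - (\<Sum>js\<in>permutations_of_set I. fp js z)
       = (\<Sum>js\<in>permutations_of_set I. nested_int (map (\<lambda>i. rad i z) js) R - fp js z)"
      by (simp only: sum_subtractf)
  qed
  show ?thesis by (rule log_expansion_constant_unique[OF 1 T 2]) simp
qed

lemma eventually_prod_fp_eq_sum:
  assumes I: "finite I" "I \<noteq> {}"
  shows "\<forall>\<^sub>F z in cosparse UNIV. (\<Prod>i\<in>I. fp [i] z) = (\<Sum>js\<in>permutations_of_set I. fp js z)"
proof -
  have "\<forall>\<^sub>F z in at p. \<forall>J\<in>Pow I - {{}}. (\<Sum>i\<in>J. \<beta> i z) \<notin> \<int>" for p
  proof (rule eventually_ball_finite)
    show "finite (Pow I - {{}})" using I by simp
    show "\<forall>J\<in>Pow I - {{}}. \<forall>\<^sub>F z in at p. (\<Sum>i\<in>J. \<beta> i z) \<notin> \<int>"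
    proof
      \<comment> \<open>All families have the same slope q, so a subset sum is affine with slope
        \<open>card J * q\<close>. No cancellation of slopes can occur, and near any p the sum
        avoids the integers.\<close>
      fix J assume J: "J \<in> Pow I - {{}}"
      then have "finite J" "J \<noteq> {}" using I finite_subset by auto
      then have "of_nat (card J) * q \<noteq> 0" using q by simp
      moreover have "(\<Sum>i\<in>J. \<beta> i z) = of_nat (card J) * q * z + (\<Sum>i\<in>J. a i + of_nat DIM(real^'n))" for z
        by (simp add: \<beta>_def sum.distrib algebra_simps)
      ultimately show "\<forall>\<^sub>F z in at p. (\<Sum>i\<in>J. \<beta> i z) \<notin> \<int>"
        using eventually_affine_not_Ints[of "of_nat (card J) * q" "\<Sum>i\<in>J. a i + of_nat DIM(real^'n)" p] by simp
    qed
  qed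
  then have "\<forall>\<^sub>F z in at p. (\<Prod>i\<in>I. fp [i] z) = (\<Sum>js\<in>permutations_of_set I. fp js z)" for p
    by (rule eventually_mono) (rule prod_fp_eq_sum[OF I])
  then show ?thesis by (simp add: eventually_cosparse_open_eq)
qed

end

lemma prefix_sum_upt:
  assumes "j \<le> k"
  shows "prefix_sum (map f [1..<k+1]) j = (\<Sum>i=1..j. f i)"
proof -
  have "take j [1..<k+1] = [1..<j+1]" using take_upt[of 1 j "k+1"] assms by simp
  moreover have "sum_list (map f [1..<j+1]) = sum f (set [1..<j+1])"
    by (rule sum_list_distinct_conv_sum_set) simp
  moreover have "set [1..<j+1] = {1..j}" by auto
  ultimately show ?thesis by (simp add: prefix_sum_def take_map)
qed

theorem theorem5:
  fixes U :: "(real^'n) set" and x :: "real^'n"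
    and R :: "'n symb \<Rightarrow> complex \<Rightarrow> 'n symb" and q :: complex
    and k :: nat and sig :: "nat \<Rightarrow> 'n symb" and a :: "nat \<Rightarrow> complex"
  assumes "open U" and "x \<in> U"
    and "holo_reg U R"
    and "q \<noteq> 0"
    and "\<forall>\<sigma> \<alpha>. classical U \<alpha> \<sigma> \<longrightarrow> holo_family U (\<lambda>z. q * z + \<alpha>) (R \<sigma>)"
    and "k \<ge> 1"
    and "\<forall>i\<in>{1..k}. classical U (a i) (sig i)"
  shows "mero_poles_le (\<lambda>z. cutoff_int (pcomp (map (\<lambda>i. R (sig i) z) [1..<k+1]) x)) k
      \<and> (\<lambda>z. cutoff_int (pcomp (map (\<lambda>i. R (sig i) z) [1..<k+1]) x))
           holomorphic_on (UNIV - pole_set q a k)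
      \<and> mero_poles_le (\<lambda>z. \<Sum>\<tau>\<in>{\<tau>. \<tau> permutes {1..k}}.
           cutoff_int (pcomp (map (\<lambda>i. R (sig (\<tau> i)) z) [1..<k+1]) x)) k
      \<and> (\<forall>\<^sub>F z in cosparse UNIV. (\<Prod>i=1..k. cutoff_int (\<lambda>\<xi>. R (sig i) z (x, \<xi>)))
           = (\<Sum>\<tau>\<in>{\<tau>. \<tau> permutes {1..k}}.
               cutoff_int (pcomp (map (\<lambda>i. R (sig (\<tau> i)) z) [1..<k+1]) x)))"
proof -
  interpret symbol_families U x q "{1..k}" a "\<lambda>i. R (sig i)"
    by unfold_locales (use assms in auto)
  let ?js = "[1..<k+1]"
  have js: "set ?js \<subseteq> {1..k}" "?js \<noteq> []" and len: "length ?js = k" using assms(6) by auto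
  have fp: "cutoff_int (pcomp (map (\<lambda>i. R (sig i) z) js) x) = fp js z" for js z by (simp add: fp_def)
  have fp\<tau>: "cutoff_int (pcomp (map (\<lambda>i. R (sig (\<tau> i)) z) ?js) x) = fp (map \<tau> ?js) z" for \<tau> z
    by (simp add: fp_def o_def)
  have fp1: "cutoff_int (\<lambda>\<xi>. R (sig i) z (x, \<xi>)) = fp [i] z" for i z
  proof -
    have "pcomp [R (sig i) z] x = (\<lambda>\<xi>. R (sig i) z (x, \<xi>))" by auto
    then show ?thesis by (simp add: fp_def)
  qed
  have 1: "mero_poles_le (fp ?js) k" using fp_mero_poles_le[OF js] len by simp
  have "good ?js z" if z: "z \<notin> pole_set q a k" for z
    unfolding good_def
  proof
    fix j assume j: "j \<in> {1..length ?js}"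
    show "prefix_sum (map (\<lambda>i. \<beta> i z) ?js) j \<notin> \<int>"
    proof
      assume "prefix_sum (map (\<lambda>i. \<beta> i z) ?js) j \<in> \<int>"
      then obtain M where "prefix_sum (map (\<lambda>i. \<beta> i z) ?js) j = of_int M" by (auto elim: Ints_cases)
      moreover have "prefix_sum (map (\<lambda>i. \<beta> i z) ?js) j = (\<Sum>i=1..j. \<beta> i z)"
        by (rule prefix_sum_upt) (use j len in auto)
      ultimately have "of_nat j * q * z + (\<Sum>i=1..j. a i) + of_nat j * of_nat DIM(real^'n) = of_int M"
        by (simp add: \<beta>_def sum.distrib algebra_simps)
      \<comment> \<open>Each of the j summands contributes the dimension n through \<beta>; the
        integer j n is absorbed into the integer parameter of \<open>pole_set\<close>.\<close>
      then have "of_nat j * q * z = of_int (M - int (j * DIM(real^'n))) - (\<Sum>i=1..j. a i)"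
        by (simp add: algebra_simps)
      then have "z = (of_int (M - int (j * DIM(real^'n))) - (\<Sum>i=1..j. a i)) / (of_nat j * q)"
        using j assms(4) by (metis atLeastAtMost_iff mult_eq_0_iff nonzero_mult_div_cancel_left not_one_le_zero of_nat_eq_0_iff)
      then have "z \<in> pole_set q a k"
        unfolding pole_set_def using j len
        by (intro UN_I[of j] CollectI exI[of _ "M - int (j * DIM(real^'n))"]) auto
      with z show False by simp
    qed
  qed
  then have 2: "fp ?js holomorphic_on (UNIV - pole_set q a k)"
    by (intro holomorphic_on_subset[OF good_fp(1)[OF js]]) auto
  have 3: "mero_poles_le (\<lambda>z. \<Sum>\<tau>\<in>{\<tau>. \<tau> permutes {1..k}}. fp (map \<tau> ?js) z) k"
  proof (rule mero_poles_le_sum)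
    show "finite {\<tau>. \<tau> permutes {1..k}}" by (rule finite_permutations) simp
    fix \<tau> assume "\<tau> \<in> {\<tau>. \<tau> permutes {1..k}}"
    then have "set (map \<tau> ?js) \<subseteq> {1..k}" using js(1) permutes_in_image by fastforce
    from fp_mero_poles_le[OF this] js(2) len show "mero_poles_le (fp (map \<tau> ?js)) k" by simp
  qed
  have 4: "\<forall>\<^sub>F z in cosparse UNIV. (\<Prod>i=1..k. fp [i] z) = (\<Sum>\<tau>\<in>{\<tau>. \<tau> permutes {1..k}}. fp (map \<tau> ?js) z)"
    unfolding sum_permutes_eq_sum_permutations_of_set[of "\<lambda>js. fp js z" for z]
    by (rule eventually_prod_fp_eq_sum) (use assms(6) in auto)
  show ?thesis
    unfolding fp fp\<tau> fp1 using 1 2 3 4 by blast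
qed

end
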